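(* Let $p\ge3$ and let $A_i=T(a_i)+E_i\in\mathcal{QT}$, for $i=1,\ldots,p$, be positive definite. Let $w=(w_i)\in\mathbb R^p$ be a probability vector (i.e. $w_i>0$ for all $i$ and $\sum_{i=1}^pw_i=1$), and let $A_i^{(k)}$ be the sequences generated by $$A_i^{(0)}=A_i,\qquad A_i^{(k+1)}=A_i^{(k)}\#_{1-w_i}G_{\hat w^{(i)}}(A_1^{(k)},\ldots,A_{i-1}^{(k)},A_{i+1}^{(k)},\ldots,A_p^{(k)}),\quad i=1,\ldots,p,$$ where $\hat w^{(i)}=\frac1{1-w_i}(w_1,\ldots,w_{i-1},w_{i+1},\ldots,w_p)$. Finally, let $G=G_w(A_1,\ldots,A_p)$ be the weighted mean of $A_1,\ldots,A_p$. Then: 1. $A_i^{(k)}=T(g)+K_i^{(k)}\in\mathcal{QT}$ with $K_i^{(k)}$ compact, for $i=1,\ldots,p$ and any $k\ge1$, where $g=a_1^{w_1}a_2^{w_2}\cdots a_p^{w_p}$; 2. $G=T(g)+K_G\in\mathcal{QT}$ with $K_G$ compact; 3. $\lim_k\|K_i^{(k)}-K_G\|_2=0$, for $i=1,\ldots,p$.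
   Context: $\ell^2$ is the complex Hilbert space of square-summable sequences indexed by the positive integers and $\|\cdot\|_2$ is the operator norm on $\mathcal B(\ell^2)$. $C_{2\pi}$ is the set of continuous $a:[0,2\pi]\to\mathbb C$ with $a(0)=a(2\pi)$. For $a\in C_{2\pi}$ with Fourier series $\sum_{k}a_ke^{\mathrm{i}kt}$, $T(a)$ is the bounded operator on $\ell^2$ with matrix $(T(a))_{i,j}=a_{j-i}$, $i,j\ge1$. $\mathcal{QT}=\{T(a)+K: a\in C_{2\pi},\ K \text{ compact on }\ell^2\}$ is the $C^*$-subalgebra of $\mathcal B(\ell^2)$ of quasi-Toeplitz matrices; the decomposition $A=T(a)+K$ of $A\in\mathcal{QT}$ is unique and $a$ is called the symbol of $A$. A bounded operator $A$ is positive definite if it is self-adjoint and there is $\gamma>0$ with $v^*Av\ge\gamma\|v\|_2^2$ for all $v\in\ell^2$; its symbol, if $A\in\mathcal{QT}$, is then strictly positive. For positive definite operators $A,B$ and $t\in[0,1]$, $A\#_tB=A^{1/2}(A^{-1/2}BA^{-1/2})^tA^{1/2}$. The weighted mean is defined recursively: for two operators and a probability vector $(w_1,w_2)$, $G_{w_1,w_2}(A_1,A_2)=A_1\#_{w_2}A_2$; for $p\ge3$, $G_w(A_1,\ldots,A_p)$ is the common limit of the $p$ sequences $\{A_i^{(k)}\}_k$ displayed in the claim (each $\hat w^{(i)}$ being a probability vector in $\mathbb R^{p-1}$). It is known that this common positive definite limit exists in the Thompson metric, hence in operator norm. *)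

theory Defs
  imports "HOL-Analysis.Analysis" "HOL-Computational_Algebra.Polynomial"
begin

section \<open>The complex Hilbert space of square-summable sequences\<close>

text \<open>
  Sequences are indexed by \<^typ>\<open>nat\<close>, so the \<open>n\<close>-th entry (counted from 1) of the usual
  sequence has index \<open>n - 1\<close> here.  Toeplitz matrices depend on index differences only and are not
  affected by the shift.
\<close>

typedef ell2 = "{x :: nat \<Rightarrow> complex. summable (\<lambda>n. (cmod (x n))\<^sup>2)}"
  morphisms ell2_nth Abs_ell2
  by (rule exI[of _ "\<lambda>_. 0"]) simp

setup_lifting type_definition_ell2

lemma ell2_eqI: "(\<And>n. ell2_nth x n = ell2_nth y n) \<Longrightarrow> x = y"
  by transfer auto

lemma summable_ell2_nth: "summable (\<lambda>n. (cmod (ell2_nth x n))\<^sup>2)"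
  by transfer simp

lemma prod_le_sum_squares: "a * b \<le> a\<^sup>2 + b\<^sup>2" for a b :: real
proof -
  have "0 \<le> (a - b)\<^sup>2" "0 \<le> a\<^sup>2" "0 \<le> b\<^sup>2" by simp_all
  then show ?thesis unfolding power2_diff by linarith
qed

lemma square_summable_add:
  fixes x y :: "nat \<Rightarrow> complex"
  assumes "summable (\<lambda>n. (cmod (x n))\<^sup>2)" "summable (\<lambda>n. (cmod (y n))\<^sup>2)"
  shows "summable (\<lambda>n. (cmod (x n + y n))\<^sup>2)"
proof (rule summable_comparison_test')
  show "summable (\<lambda>n. 2 * (cmod (x n))\<^sup>2 + 2 * (cmod (y n))\<^sup>2 + (cmod (x n))\<^sup>2 + (cmod (y n))\<^sup>2)"
    using assms by (intro summable_add summable_mult)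
  fix n :: nat
  have "(cmod (x n + y n))\<^sup>2 \<le> (cmod (x n) + cmod (y n))\<^sup>2"
    by (intro power_mono norm_triangle_ineq) simp
  also have "\<dots> \<le> 2 * (cmod (x n))\<^sup>2 + 2 * (cmod (y n))\<^sup>2 + (cmod (x n))\<^sup>2 + (cmod (y n))\<^sup>2"
    using prod_le_sum_squares[of "cmod (x n)" "cmod (y n)"] by (simp add: power2_sum)
  finally show "norm ((cmod (x n + y n))\<^sup>2)
      \<le> 2 * (cmod (x n))\<^sup>2 + 2 * (cmod (y n))\<^sup>2 + (cmod (x n))\<^sup>2 + (cmod (y n))\<^sup>2"
    by simp
qed

lemma square_summable_scale:
  fixes x :: "nat \<Rightarrow> complex"
  assumes "summable (\<lambda>n. (cmod (x n))\<^sup>2)"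
  shows "summable (\<lambda>n. (cmod (c * x n))\<^sup>2)"
  using summable_mult[OF assms, of "(cmod c)\<^sup>2"] by (simp add: norm_mult power_mult_distrib)

lemma square_summable_prod:
  fixes x y :: "nat \<Rightarrow> complex"
  assumes "summable (\<lambda>n. (cmod (x n))\<^sup>2)" "summable (\<lambda>n. (cmod (y n))\<^sup>2)"
  shows "summable (\<lambda>n. cmod (x n) * cmod (y n))"
  by (rule summable_comparison_test'[OF summable_add[OF assms]])
    (simp add: prod_le_sum_squares)

lift_definition ell2_scale :: "complex \<Rightarrow> ell2 \<Rightarrow> ell2" (infixr \<open>*\<^sub>C\<close> 75)
  is "\<lambda>c x n. c * x n"
  by (rule square_summable_scale)

lift_definition ell2_basis :: "nat \<Rightarrow> ell2" is "\<lambda>j n. if n = j then 1 else 0"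
  by (rule summable_finite[of "{j}" for j]) auto

definition cinner :: "ell2 \<Rightarrow> ell2 \<Rightarrow> complex"
  where "cinner x y = (\<Sum>n. cnj (ell2_nth x n) * ell2_nth y n)"

lemma summable_cinner: "summable (\<lambda>n. cnj (ell2_nth x n) * ell2_nth y n)"
  by (rule summable_norm_cancel)
    (use square_summable_prod[OF summable_ell2_nth[of x] summable_ell2_nth[of y]] in
      \<open>simp add: norm_mult\<close>)

instantiation ell2 :: real_vector
begin

lift_definition zero_ell2 :: ell2 is "\<lambda>_. 0" by simp

lift_definition plus_ell2 :: "ell2 \<Rightarrow> ell2 \<Rightarrow> ell2" is "\<lambda>x y n. x n + y n"
  by (rule square_summable_add)

lift_definition uminus_ell2 :: "ell2 \<Rightarrow> ell2" is "\<lambda>x n. - x n"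
  by simp

lift_definition minus_ell2 :: "ell2 \<Rightarrow> ell2 \<Rightarrow> ell2" is "\<lambda>x y n. x n - y n"
  using square_summable_add[where y = "\<lambda>n. - y n" for y] by auto

lift_definition scaleR_ell2 :: "real \<Rightarrow> ell2 \<Rightarrow> ell2" is "\<lambda>r x n. r *\<^sub>R x n"
  by (subst scaleR_conv_of_real) (rule square_summable_scale)

instance
  by standard (transfer, simp add: fun_eq_iff algebra_simps)+

end

lemma ell2_nth_simps [simp]:
  "ell2_nth 0 n = 0"
  "ell2_nth (x + y) n = ell2_nth x n + ell2_nth y n"
  "ell2_nth (- x) n = - ell2_nth x n"
  "ell2_nth (x - y) n = ell2_nth x n - ell2_nth y n"
  "ell2_nth (r *\<^sub>R x) n = r *\<^sub>R ell2_nth x n"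
  "ell2_nth (c *\<^sub>C x) n = c * ell2_nth x n"
  "ell2_nth (ell2_basis j) n = (if n = j then 1 else 0)"
  by (transfer, simp)+

text \<open>The underlying real inner product is the real part of \<^const>\<open>cinner\<close>; both give the same norm.\<close>

instantiation ell2 :: real_inner
begin

definition inner_ell2 :: "ell2 \<Rightarrow> ell2 \<Rightarrow> real"
  where "inner_ell2 x y = Re (cinner x y)"

definition norm_ell2 :: "ell2 \<Rightarrow> real"
  where "norm_ell2 x = sqrt (\<Sum>n. (cmod (ell2_nth x n))\<^sup>2)"

definition dist_ell2 :: "ell2 \<Rightarrow> ell2 \<Rightarrow> real"
  where "dist_ell2 x y = norm (x - y)"

definition sgn_ell2 :: "ell2 \<Rightarrow> ell2"
  where "sgn_ell2 x = inverse (norm x) *\<^sub>R x"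

definition uniformity_ell2 :: "(ell2 \<times> ell2) filter"
  where "uniformity_ell2 = (INF e\<in>{0<..}. principal {(x, y). dist x y < e})"

definition open_ell2 :: "ell2 set \<Rightarrow> bool"
  where "open_ell2 S = (\<forall>x\<in>S. \<forall>\<^sub>F (x', y) in uniformity. x' = x \<longrightarrow> y \<in> S)"

instance
proof
  fix x y z :: ell2 and r :: real and S :: "ell2 set"
  have inner_alt: "inner u v = (\<Sum>n. Re (cnj (ell2_nth u n) * ell2_nth v n))" for u v :: ell2
    unfolding inner_ell2_def cinner_def by (rule Re_suminf[OF summable_cinner])
  have sm: "summable (\<lambda>n. Re (cnj (ell2_nth u n) * ell2_nth v n))" for u v :: ell2
    by (rule summable_Re[OF summable_cinner])
  have self: "inner u u = (\<Sum>n. (cmod (ell2_nth u n))\<^sup>2)" for u :: ell2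
    by (simp add: inner_alt cmod_power2) (simp add: power2_eq_square)
  show "dist x y = norm (x - y)" by (rule dist_ell2_def)
  show "sgn x = inverse (norm x) *\<^sub>R x" by (rule sgn_ell2_def)
  show "uniformity = (INF e\<in>{0<..}. principal {(x :: ell2, y). dist x y < e})"
    by (rule uniformity_ell2_def)
  show "open S = (\<forall>x\<in>S. \<forall>\<^sub>F (x', y) in uniformity. x' = x \<longrightarrow> y \<in> S)"
    by (rule open_ell2_def)
  show "inner x y = inner y x" by (simp add: inner_alt mult.commute)
  show "inner (x + y) z = inner x z + inner y z"
    using suminf_add[OF sm[of x z] sm[of y z]] by (simp add: inner_alt algebra_simps)
  show "inner (r *\<^sub>R x) y = r * inner x y"
    using suminf_mult[OF sm[of x y], of r] by (simp add: inner_alt algebra_simps)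
  show "0 \<le> inner x x" by (simp add: self suminf_nonneg summable_ell2_nth)
  show "inner x x = 0 \<longleftrightarrow> x = 0"
    by (auto simp: self suminf_eq_zero_iff[OF summable_ell2_nth] intro: ell2_eqI)
  show "norm x = sqrt (inner x x)" by (simp add: self norm_ell2_def)
qed

end

lemma norm_ell2_nth_le: "cmod (ell2_nth x n) \<le> norm x"
proof -
  have "(cmod (ell2_nth x n))\<^sup>2 \<le> (\<Sum>n. (cmod (ell2_nth x n))\<^sup>2)"
    using sum_le_suminf[OF summable_ell2_nth[of x], of "{n}"] by simp
  then show ?thesis unfolding norm_ell2_def by (rule real_le_rsqrt)
qed

lemma sum_le_norm_ell2: "(\<Sum>n<N. (cmod (ell2_nth x n))\<^sup>2) \<le> (norm x)\<^sup>2"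
  using sum_le_suminf[OF summable_ell2_nth[of x], of "{..<N}"]
  by (simp add: norm_ell2_def suminf_nonneg summable_ell2_nth)

lemma norm_ell2_basis [simp]: "norm (ell2_basis j) = 1"
proof -
  have "(\<Sum>n. (cmod (ell2_nth (ell2_basis j) n))\<^sup>2) = (\<Sum>n\<in>{j}. (cmod (ell2_nth (ell2_basis j) n))\<^sup>2)"
    by (rule suminf_finite) auto
  then show ?thesis by (simp add: norm_ell2_def)
qed

lemma norm_ell2_scale: "norm (c *\<^sub>C x) = cmod c * norm x"
proof -
  have "(\<Sum>n. (cmod c)\<^sup>2 * (cmod (ell2_nth x n))\<^sup>2) = (cmod c)\<^sup>2 * (\<Sum>n. (cmod (ell2_nth x n))\<^sup>2)"
    by (rule suminf_mult[OF summable_ell2_nth])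
  then show ?thesis by (simp add: norm_ell2_def norm_mult power_mult_distrib real_sqrt_mult)
qed

lemma ell2_scale_add: "c *\<^sub>C (x + y) = c *\<^sub>C x + c *\<^sub>C y"
  and ell2_scale_scaleR: "c *\<^sub>C (r *\<^sub>R x) = r *\<^sub>R (c *\<^sub>C x)"
  by (rule ell2_eqI, simp add: algebra_simps)+

lemma bounded_linear_ell2_scale: "bounded_linear (\<lambda>x. c *\<^sub>C x)"
  by (rule bounded_linear_intro[of _ "cmod c"])
    (simp_all add: ell2_scale_add ell2_scale_scaleR norm_ell2_scale)

instance ell2 :: banach
proof
  fix X :: "nat \<Rightarrow> ell2" assume X: "Cauchy X"
  have "Cauchy (\<lambda>m. ell2_nth (X m) k)" for k
  proof (rule metric_CauchyI)
    fix e :: real assume "0 < e"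
    then obtain M where M: "\<And>m n. m \<ge> M \<Longrightarrow> n \<ge> M \<Longrightarrow> dist (X m) (X n) < e"
      using metric_CauchyD[OF X] by metis
    have "dist (ell2_nth (X m) k) (ell2_nth (X n) k) < e" if "m \<ge> M" "n \<ge> M" for m n
      using norm_ell2_nth_le[of "X m - X n" k] M[OF that] by (simp add: dist_norm)
    then show "\<exists>M. \<forall>m\<ge>M. \<forall>n\<ge>M. dist (ell2_nth (X m) k) (ell2_nth (X n) k) < e" by blast
  qed
  then have "\<forall>k. \<exists>l. (\<lambda>m. ell2_nth (X m) k) \<longlonglongrightarrow> l"
    using Cauchy_convergent convergent_def by blast
  then obtain l where l: "\<And>k. (\<lambda>m. ell2_nth (X m) k) \<longlonglongrightarrow> l k" by metis
  have tail: "\<exists>M. \<forall>m\<ge>M. \<forall>N. (\<Sum>k<N. (cmod (ell2_nth (X m) k - l k))\<^sup>2) \<le> e\<^sup>2" if "0 < e" for e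
  proof -
    obtain M where M: "\<And>m n. m \<ge> M \<Longrightarrow> n \<ge> M \<Longrightarrow> dist (X m) (X n) < e"
      using metric_CauchyD[OF X \<open>0 < e\<close>] by metis
    have "(\<Sum>k<N. (cmod (ell2_nth (X m) k - l k))\<^sup>2) \<le> e\<^sup>2" if m: "m \<ge> M" for m N
    proof (rule tendsto_upperbound)
      show "(\<lambda>n. \<Sum>k<N. (cmod (ell2_nth (X m) k - ell2_nth (X n) k))\<^sup>2)
          \<longlonglongrightarrow> (\<Sum>k<N. (cmod (ell2_nth (X m) k - l k))\<^sup>2)"
        by (intro tendsto_intros l)
      show "\<forall>\<^sub>F n in sequentially. (\<Sum>k<N. (cmod (ell2_nth (X m) k - ell2_nth (X n) k))\<^sup>2) \<le> e\<^sup>2"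
      proof (rule eventually_sequentiallyI)
        fix n assume "M \<le> n"
        have "(\<Sum>k<N. (cmod (ell2_nth (X m - X n) k))\<^sup>2) \<le> (norm (X m - X n))\<^sup>2"
          by (rule sum_le_norm_ell2)
        also have "\<dots> \<le> e\<^sup>2"
          using M[OF m \<open>M \<le> n\<close>] by (intro power_mono) (simp_all add: dist_norm)
        finally show "(\<Sum>k<N. (cmod (ell2_nth (X m) k - ell2_nth (X n) k))\<^sup>2) \<le> e\<^sup>2" by simp
      qed
    qed simp
    then show ?thesis by blast
  qed
  have sq: "summable (\<lambda>k. (cmod (ell2_nth (X m) k - l k))\<^sup>2)"
    if "\<forall>N. (\<Sum>k<N. (cmod (ell2_nth (X m) k - l k))\<^sup>2) \<le> B" for m B
    by (rule bounded_imp_summable[of _ B])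
      (simp, metis that lessThan_Suc_atMost)
  obtain M1 where M1: "summable (\<lambda>k. (cmod (ell2_nth (X M1) k - l k))\<^sup>2)"
    using tail[of 1] sq by (metis order_refl zero_less_one)
  have "summable (\<lambda>k. (cmod (ell2_nth (X M1) k + (-1) * (ell2_nth (X M1) k - l k)))\<^sup>2)"
    by (intro square_summable_add square_summable_scale M1 summable_ell2_nth)
  then have "summable (\<lambda>k. (cmod (l k))\<^sup>2)" by simp
  then have nth: "ell2_nth (Abs_ell2 l) = l" by (simp add: Abs_ell2_inverse)
  have "X \<longlonglongrightarrow> Abs_ell2 l"
  proof (rule metric_LIMSEQ_I)
    fix e :: real assume e: "0 < e"
    obtain M where M: "\<forall>m\<ge>M. \<forall>N. (\<Sum>k<N. (cmod (ell2_nth (X m) k - l k))\<^sup>2) \<le> (e / 2)\<^sup>2"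
      using tail[of "e / 2"] e by auto
    have "dist (X m) (Abs_ell2 l) < e" if "m \<ge> M" for m
    proof -
      have "(\<Sum>k. (cmod (ell2_nth (X m) k - l k))\<^sup>2) \<le> (e / 2)\<^sup>2"
        by (rule suminf_le_const) (use M that sq in blast)+
      then have "norm (X m - Abs_ell2 l) \<le> e / 2"
        unfolding norm_ell2_def using e by (intro real_le_lsqrt) (simp_all add: nth)
      then show ?thesis using e by (simp add: dist_norm)
    qed
    then show "\<exists>M. \<forall>m\<ge>M. dist (X m) (Abs_ell2 l) < e" by blast
  qed
  then show "convergent X" by (auto simp: convergent_def)
qed

lifting_forget ell2.lifting


section \<open>The algebra of bounded complex-linear operators\<close>

typedef ell2_op = "{A :: ell2 \<Rightarrow>\<^sub>L ell2. \<forall>c x. blinfun_apply A (c *\<^sub>C x) = c *\<^sub>C blinfun_apply A x}"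
  morphisms blinfun_of_op Abs_ell2_op
  by (rule exI[of _ id_blinfun]) simp

setup_lifting type_definition_ell2_op

lift_definition op_apply :: "ell2_op \<Rightarrow> ell2 \<Rightarrow> ell2" (infixr \<open>$$\<close> 90) is blinfun_apply .

lemma op_eqI: "(\<And>x. A $$ x = B $$ x) \<Longrightarrow> A = B"
  by transfer (rule blinfun_eqI)

text \<open>The norm is the operator norm and multiplication is composition.\<close>

instantiation ell2_op :: real_normed_algebra_1
begin

lift_definition zero_ell2_op :: ell2_op is 0
  by (auto intro: ell2_eqI)

lift_definition one_ell2_op :: ell2_op is id_blinfun
  by simp

lift_definition plus_ell2_op :: "ell2_op \<Rightarrow> ell2_op \<Rightarrow> ell2_op" is "(+)"
  by (simp add: blinfun.add_left ell2_scale_add)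

lift_definition uminus_ell2_op :: "ell2_op \<Rightarrow> ell2_op" is uminus
  by (auto simp: blinfun.minus_left intro: ell2_eqI)

lift_definition minus_ell2_op :: "ell2_op \<Rightarrow> ell2_op \<Rightarrow> ell2_op" is "(-)"
  by (auto simp: blinfun.diff_left algebra_simps intro!: ell2_eqI)

lift_definition scaleR_ell2_op :: "real \<Rightarrow> ell2_op \<Rightarrow> ell2_op" is scaleR
  by (simp add: blinfun.scaleR_left ell2_scale_scaleR)

lift_definition times_ell2_op :: "ell2_op \<Rightarrow> ell2_op \<Rightarrow> ell2_op" is blinfun_compose
  by simp

lift_definition norm_ell2_op :: "ell2_op \<Rightarrow> real" is norm .

definition dist_ell2_op :: "ell2_op \<Rightarrow> ell2_op \<Rightarrow> real"
  where "dist_ell2_op A B = norm (A - B)"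

definition sgn_ell2_op :: "ell2_op \<Rightarrow> ell2_op"
  where "sgn_ell2_op A = inverse (norm A) *\<^sub>R A"

definition uniformity_ell2_op :: "(ell2_op \<times> ell2_op) filter"
  where "uniformity_ell2_op = (INF e\<in>{0<..}. principal {(x, y). dist x y < e})"

definition open_ell2_op :: "ell2_op set \<Rightarrow> bool"
  where "open_ell2_op S = (\<forall>x\<in>S. \<forall>\<^sub>F (x', y) in uniformity. x' = x \<longrightarrow> y \<in> S)"

instance
proof
  fix A B C :: ell2_op and r s :: real and S :: "ell2_op set"
  show "A + B + C = A + (B + C)" "A + B = B + A" "0 + A = A" "- A + A = 0" "A - B = A + - B"
    "r *\<^sub>R (A + B) = r *\<^sub>R A + r *\<^sub>R B" "(r + s) *\<^sub>R A = r *\<^sub>R A + s *\<^sub>R A"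
    "r *\<^sub>R s *\<^sub>R A = (r * s) *\<^sub>R A" "1 *\<^sub>R A = A"
    by (transfer, simp add: algebra_simps)+
  show "A * B * C = A * (B * C)" "(A + B) * C = A * C + B * C" "A * (B + C) = A * B + A * C"
    "1 * A = A" "A * 1 = A" "r *\<^sub>R A * B = r *\<^sub>R (A * B)" "A * r *\<^sub>R B = r *\<^sub>R (A * B)"
    by (transfer, auto intro!: blinfun_eqI simp: blinfun.bilinear_simps)+
  have "norm (1 :: ell2_op) = 1"
    by transfer (rule norm_blinfun_eqI[of _ _ "ell2_basis 0"], simp_all)
  then show "norm (1 :: ell2_op) = 1" "(0 :: ell2_op) \<noteq> 1"
    by (simp, metis (mono_tags) norm_ell2_op.rep_eq norm_zero zero_ell2_op.rep_eq zero_neq_one)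
  show "norm (A * B) \<le> norm A * norm B" by transfer (rule norm_blinfun_compose)
  show "dist A B = norm (A - B)" by (rule dist_ell2_op_def)
  show "sgn A = inverse (norm A) *\<^sub>R A" by (rule sgn_ell2_op_def)
  show "uniformity = (INF e\<in>{0<..}. principal {(x :: ell2_op, y). dist x y < e})"
    by (rule uniformity_ell2_op_def)
  show "open S = (\<forall>x\<in>S. \<forall>\<^sub>F (x', y) in uniformity. x' = x \<longrightarrow> y \<in> S)"
    by (rule open_ell2_op_def)
  show "norm A = 0 \<longleftrightarrow> A = 0" by transfer simp
  show "norm (A + B) \<le> norm A + norm B" by transfer (rule norm_triangle_ineq)
  show "norm (r *\<^sub>R A) = \<bar>r\<bar> * norm A" by transfer simp
qed

end

lemma op_apply_simps [simp]:
  "0 $$ x = 0" "1 $$ x = x" "(A + B) $$ x = A $$ x + B $$ x" "(- A) $$ x = - (A $$ x)"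
  "(A - B) $$ x = A $$ x - B $$ x" "(r *\<^sub>R A) $$ x = r *\<^sub>R (A $$ x)" "(A * B) $$ x = A $$ B $$ x"
  "A $$ (c *\<^sub>C x) = c *\<^sub>C (A $$ x)"
  by (transfer, simp add: blinfun.bilinear_simps)+

lemma bounded_bilinear_op_apply: "bounded_bilinear ($$)"
proof
  fix A B :: ell2_op and x y :: ell2 and r :: real
  show "(A + B) $$ x = A $$ x + B $$ x" "(r *\<^sub>R A) $$ x = r *\<^sub>R (A $$ x)" by simp_all
  show "A $$ (x + y) = A $$ x + A $$ y" "A $$ (r *\<^sub>R x) = r *\<^sub>R (A $$ x)"
    by (transfer, simp add: blinfun.bilinear_simps)+
  show "\<exists>K. \<forall>A x. norm (A $$ x) \<le> norm A * norm x * K"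
    by (rule exI[of _ 1], transfer) (simp add: norm_blinfun)
qed

instance ell2_op :: banach
proof
  fix X :: "nat \<Rightarrow> ell2_op" assume "Cauchy X"
  then have "Cauchy (\<lambda>n. blinfun_of_op (X n))"
    by (simp add: Cauchy_def dist_norm norm_ell2_op.rep_eq minus_ell2_op.rep_eq)
  then obtain L where L: "(\<lambda>n. blinfun_of_op (X n)) \<longlonglongrightarrow> L"
    using Cauchy_convergent convergent_def by blast
  have "blinfun_apply L (c *\<^sub>C x) = c *\<^sub>C blinfun_apply L x" for c x
  proof (rule LIMSEQ_unique)
    show "(\<lambda>n. blinfun_apply (blinfun_of_op (X n)) (c *\<^sub>C x)) \<longlonglongrightarrow> blinfun_apply L (c *\<^sub>C x)"
      by (intro tendsto_intros L)
    have "(\<lambda>n. c *\<^sub>C blinfun_apply (blinfun_of_op (X n)) x) \<longlonglongrightarrow> c *\<^sub>C blinfun_apply L x"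
      by (intro bounded_linear.tendsto[OF bounded_linear_ell2_scale] tendsto_intros L)
    then show "(\<lambda>n. blinfun_apply (blinfun_of_op (X n)) (c *\<^sub>C x)) \<longlonglongrightarrow> c *\<^sub>C blinfun_apply L x"
      using blinfun_of_op by simp
  qed
  then have "blinfun_of_op (Abs_ell2_op L) = L" by (simp add: Abs_ell2_op_inverse)
  with L have "X \<longlonglongrightarrow> Abs_ell2_op L"
    by (simp add: LIMSEQ_def dist_norm norm_ell2_op.rep_eq minus_ell2_op.rep_eq)
  then show "convergent X" by (auto simp: convergent_def)
qed

lift_definition scalar_op :: "complex \<Rightarrow> ell2_op" is "\<lambda>c. Blinfun (\<lambda>x. c *\<^sub>C x)"
  by (auto simp: bounded_linear_Blinfun_apply bounded_linear_ell2_scale intro!: ell2_eqI)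

lemma scalar_op_apply [simp]: "scalar_op c $$ x = c *\<^sub>C x"
  by transfer (simp add: bounded_linear_Blinfun_apply bounded_linear_ell2_scale)

definition self_adjoint :: "ell2_op \<Rightarrow> bool"
  where "self_adjoint A \<longleftrightarrow> (\<forall>x y. cinner (A $$ x) y = cinner x (A $$ y))"

text \<open>For self-adjoint \<open>A\<close> the number \<open>cinner v (A v)\<close> is real, so taking \<^const>\<open>Re\<close> loses nothing.\<close>

definition positive_definite :: "ell2_op \<Rightarrow> bool"
  where "positive_definite A \<longleftrightarrow>
    self_adjoint A \<and> (\<exists>\<gamma>>0. \<forall>v. Re (cinner v (A $$ v)) \<ge> \<gamma> * (norm v)\<^sup>2)"

definition compact_op :: "ell2_op \<Rightarrow> bool"
  where "compact_op K \<longleftrightarrow> compact (closure (op_apply K ` cball 0 1))"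

definition op_spectrum :: "ell2_op \<Rightarrow> complex set"
  where "op_spectrum A =
    {z. \<not> (\<exists>B. (A - scalar_op z) * B = 1 \<and> B * (A - scalar_op z) = 1)}"


section \<open>Continuous functional calculus and weighted geometric means\<close>

definition op_poly :: "real poly \<Rightarrow> ell2_op \<Rightarrow> ell2_op"
  where "op_poly q A = (\<Sum>i\<le>degree q. coeff q i *\<^sub>R A ^ i)"

text \<open>
  For self-adjoint \<open>A\<close> (whose spectrum is real) and \<open>f\<close> continuous on the spectrum, \<open>f(A)\<close> is the
  norm limit of \<open>q\<^sub>n(A)\<close> for polynomials \<open>q\<^sub>n\<close> converging to \<open>f\<close> uniformly on the spectrum.
\<close>

definition op_fun :: "(real \<Rightarrow> real) \<Rightarrow> ell2_op \<Rightarrow> ell2_op"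
  where "op_fun f A = (THE B. \<exists>q :: nat \<Rightarrow> real poly.
    uniform_limit {x. complex_of_real x \<in> op_spectrum A} (\<lambda>n x. poly (q n) x) f sequentially \<and>
    (\<lambda>n. op_poly (q n) A) \<longlonglongrightarrow> B)"

definition op_powr :: "ell2_op \<Rightarrow> real \<Rightarrow> ell2_op"
  where "op_powr A t = op_fun (\<lambda>x. x powr t) A"

definition geo_mean :: "ell2_op \<Rightarrow> real \<Rightarrow> ell2_op \<Rightarrow> ell2_op"
  where "geo_mean A t B =
    op_powr A (1/2) * op_powr (op_powr A (-1/2) * B * op_powr A (-1/2)) t * op_powr A (1/2)"

text \<open>
  A \<open>p\<close>-tuple is a function on \<^typ>\<open>nat\<close> of which only the values at \<open>1, \<dots>, p\<close> matter;
  \<open>omit i\<close> deletes the \<open>i\<close>-th entry.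
\<close>

definition omit :: "nat \<Rightarrow> (nat \<Rightarrow> 'a) \<Rightarrow> nat \<Rightarrow> 'a"
  where "omit i x = (\<lambda>j. if j < i then x j else x (Suc j))"

text \<open>\<open>M\<close> stands for the weighted mean of \<open>p - 1\<close> operators.\<close>

primrec mean_iter ::
  "((nat \<Rightarrow> real) \<Rightarrow> (nat \<Rightarrow> ell2_op) \<Rightarrow> ell2_op) \<Rightarrow>
    (nat \<Rightarrow> real) \<Rightarrow> (nat \<Rightarrow> ell2_op) \<Rightarrow> nat \<Rightarrow> nat \<Rightarrow> ell2_op"
  where
    "mean_iter M w A 0 = A"
  | "mean_iter M w A (Suc k) = (\<lambda>i. geo_mean (mean_iter M w A k i) (1 - w i)
        (M (\<lambda>j. omit i w j / (1 - w i)) (omit i (mean_iter M w A k))))"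

text \<open>The first argument is the number of operators; only values of at least 2 are meaningful.\<close>

fun weighted_mean :: "nat \<Rightarrow> (nat \<Rightarrow> real) \<Rightarrow> (nat \<Rightarrow> ell2_op) \<Rightarrow> ell2_op"
  where
    "weighted_mean (Suc (Suc 0)) w A = geo_mean (A 1) (w 2) (A 2)"
  | "weighted_mean (Suc (Suc (Suc n))) w A =
      (THE L. positive_definite L \<and>
        (\<forall>i\<in>{1..n + 3}.
          (\<lambda>k. mean_iter (\<lambda>w' A'. weighted_mean (Suc (Suc n)) w' A') w A k i) \<longlonglongrightarrow> L))"

definition mean_seq ::
  "nat \<Rightarrow> (nat \<Rightarrow> real) \<Rightarrow> (nat \<Rightarrow> ell2_op) \<Rightarrow> nat \<Rightarrow> nat \<Rightarrow> ell2_op"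
  where "mean_seq p w A k i = mean_iter (weighted_mean (p - 1)) w A k i"


section \<open>Quasi-Toeplitz operators\<close>

definition C_2pi :: "(real \<Rightarrow> complex) set"
  where "C_2pi = {a. continuous_on {0..2*pi} a \<and> a 0 = a (2*pi)}"

definition fourier_coeff :: "(real \<Rightarrow> complex) \<Rightarrow> int \<Rightarrow> complex"
  where "fourier_coeff a k =
    integral {0..2*pi} (\<lambda>t. a t * exp (- \<i> * of_int k * of_real t)) / of_real (2*pi)"

text \<open>The \<open>(i, j)\<close> matrix entry of an operator \<open>T\<close> is the \<open>i\<close>-th coordinate of \<open>T e\<^sub>j\<close>.\<close>

definition toeplitz :: "(real \<Rightarrow> complex) \<Rightarrow> ell2_op"
  where "toeplitz a =
    (THE T. \<forall>i j. ell2_nth (T $$ ell2_basis j) i = fourier_coeff a (int j - int i))"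

definition quasi_toeplitz :: "ell2_op set"
  where "quasi_toeplitz = {toeplitz a + K | a K. a \<in> C_2pi \<and> compact_op K}"

end

theory Submission
  imports Defs "HOL-Computational_Algebra.Fundamental_Theorem_Algebra"
begin

text \<open>
  Let \<open>d\<close> be the Thompson metric.  The Loewner-Heinz inequality and \<open>A #\<^sub>t B = B #\<^sub>1\<^sub>-\<^sub>t A\<close> make the
  two-variable mean jointly nonexpansive, so by induction on \<open>p\<close> the mean \<open>G\<^sub>w\<close> satisfies
  \<open>d(G\<^sub>w(A), G\<^sub>w(B)) \<le> \<Sum>\<^sub>j w\<^sub>j d(A\<^sub>j, B\<^sub>j)\<close> and fixes constant tuples.  Hence one step of the
  iteration shrinks the diameter of the tuple by the factor \<open>1 - \<Sum>\<^sub>j w\<^sub>j\<^sup>2\<close>, and the sequences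
  converge in norm to a common positive definite limit.  On the other hand, modulo compact operators
  \<open>a \<mapsto> T(a)\<close> is multiplicative, so the functional calculus of a positive definite quasi-Toeplitz
  operator acts on its (positive) symbol; since symbols are scalar functions, every iterate from the
  first one on has symbol \<open>g\<close>.  Compact operators are norm closed, so the limit has symbol \<open>g\<close> too.
\<close>

section \<open>Bounded operators and their quadratic forms\<close>

text \<open>The spectral input is a single fact: for self-adjoint \<open>A\<close> and a real
  polynomial q, the norm of q(A) equals abs (q x) at some real spectral point x. It comes from
  factoring q^2 - c, with c the squared norm of q(A), over the reals, and yields the functional
  calculus by uniform approximation on an interval enclosing the spectrum. The exchange rule for the
  two-variable mean enters because Loewner-Heinz controls only the argument under the power. The
  mean of p + 1 operators is a \<open>THE\<close> over iterates of the mean of p operators. So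
  positivity, contraction and the fixing of constant tuples travel together in one induction
  hypothesis. Thompson estimates alone give no limit operator; spectral bounds uniform along the
  iteration convert them into norm estimates, where completeness is at hand. That the symbol is
  positive is read off the matrix: a compact perturbation fades along the diagonal, so the diagonal
  entries of a positive operator tend to the mean of its symbol, and compression by T(sqrt h)
  localizes this mean.\<close>

lemma cinner_scale_right: "cinner x (c *\<^sub>C y) = c * cinner x y"
  unfolding cinner_def using suminf_mult[OF summable_cinner[of x y], of c]
  by (simp add: algebra_simps)

lemma cinner_commute: "cinner y x = cnj (cinner x y)"
  unfolding cinner_def
  using bounded_linear.suminf[OF bounded_linear_cnj summable_cinner[of x y]]
  by (simp add: mult.commute)

lemma Re_cinner: "Re (cinner x y) = inner x y"
  by (simp add: inner_ell2_def)

lemma Im_cinner: "Im (cinner x y) = - inner x (\<i> *\<^sub>C y)"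
  by (simp add: inner_ell2_def cinner_scale_right)

lemma op_apply_linear [simp]:
  "A $$ (x + y) = A $$ x + A $$ y" "A $$ (x - y) = A $$ x - A $$ y" "A $$ (- x) = - (A $$ x)"
  "A $$ (r *\<^sub>R x) = r *\<^sub>R (A $$ x)" "A $$ 0 = 0"
  by (simp_all add: bounded_bilinear.add_right[OF bounded_bilinear_op_apply]
      bounded_bilinear.diff_right[OF bounded_bilinear_op_apply]
      bounded_bilinear.minus_right[OF bounded_bilinear_op_apply]
      bounded_bilinear.scaleR_right[OF bounded_bilinear_op_apply]
      bounded_bilinear.zero_right[OF bounded_bilinear_op_apply])

lemma norm_op_apply: "norm (A $$ x) \<le> norm A * norm x"
  by (simp add: op_apply.rep_eq norm_ell2_op.rep_eq norm_blinfun)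

lemma norm_op_le:
  assumes "\<And>x. norm (A $$ x) \<le> k * norm x" "0 \<le> k"
  shows "norm A \<le> k"
  using assms by (simp add: op_apply.rep_eq norm_ell2_op.rep_eq norm_blinfun_bound)

lemma norm_op_le_unit:
  assumes "\<And>x. norm x = 1 \<Longrightarrow> norm (A $$ x) \<le> k" "0 \<le> k"
  shows "norm A \<le> k"
proof (rule norm_op_le)
  fix x
  show "norm (A $$ x) \<le> k * norm x"
  proof (cases "x = 0")
    case False
    then have "norm (A $$ ((1 / norm x) *\<^sub>R x)) \<le> k"
      by (intro assms) simp
    with False show ?thesis by (simp add: field_simps)
  qed simp
qed fact

text \<open>Adjointness as a relation, so that products, sums and limits are handled without
  constructing adjoints. The real inner product is enough because operators commute with the
  imaginary unit, which recovers the imaginary part of \<open>cinner\<close>.\<close>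

definition adjoint_pair :: "ell2_op \<Rightarrow> ell2_op \<Rightarrow> bool"
  where "adjoint_pair X Y \<longleftrightarrow> (\<forall>x y. inner (X $$ x) y = inner x (Y $$ y))"

lemma adjoint_pairD: "adjoint_pair X Y \<Longrightarrow> inner (X $$ x) y = inner x (Y $$ y)"
  by (simp add: adjoint_pair_def)

lemma self_adjoint_iff: "self_adjoint A \<longleftrightarrow> adjoint_pair A A"
proof
  assume "self_adjoint A"
  then show "adjoint_pair A A"
    by (auto simp: adjoint_pair_def self_adjoint_def inner_ell2_def)
next
  assume A: "adjoint_pair A A"
  show "self_adjoint A"
    unfolding self_adjoint_def
  proof (intro allI complex_eqI)
    fix x y
    show "Re (cinner (A $$ x) y) = Re (cinner x (A $$ y))"
      using A by (simp add: Re_cinner adjoint_pair_def)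
    have "inner (A $$ x) (\<i> *\<^sub>C y) = inner x (A $$ (\<i> *\<^sub>C y))"
      using A by (simp only: adjoint_pair_def)
    then show "Im (cinner (A $$ x) y) = Im (cinner x (A $$ y))"
      by (simp add: Im_cinner)
  qed
qed

lemma self_adjointD: "self_adjoint A \<Longrightarrow> inner (A $$ x) y = inner x (A $$ y)"
  by (simp add: self_adjoint_iff adjoint_pair_def)

lemma adjoint_pair_mult: "adjoint_pair X X' \<Longrightarrow> adjoint_pair Y Y' \<Longrightarrow> adjoint_pair (X * Y) (Y' * X')"
  by (simp add: adjoint_pair_def)

lemma adjoint_pair_add: "adjoint_pair X X' \<Longrightarrow> adjoint_pair Y Y' \<Longrightarrow> adjoint_pair (X + Y) (X' + Y')"
  by (simp add: adjoint_pair_def inner_add_left inner_add_right)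

lemma adjoint_pair_scaleR: "adjoint_pair X X' \<Longrightarrow> adjoint_pair (r *\<^sub>R X) (r *\<^sub>R X')"
  by (simp add: adjoint_pair_def)

lemma self_adjoint_one [simp]: "self_adjoint 1"
  by (simp add: self_adjoint_iff adjoint_pair_def)

lemma self_adjoint_zero [simp]: "self_adjoint 0"
  by (simp add: self_adjoint_iff adjoint_pair_def)

lemma self_adjoint_add: "self_adjoint A \<Longrightarrow> self_adjoint B \<Longrightarrow> self_adjoint (A + B)"
  by (simp add: self_adjoint_iff adjoint_pair_add)

lemma self_adjoint_scaleR: "self_adjoint A \<Longrightarrow> self_adjoint (r *\<^sub>R A)"
  by (simp add: self_adjoint_iff adjoint_pair_scaleR)

lemma self_adjoint_diff: "self_adjoint A \<Longrightarrow> self_adjoint B \<Longrightarrow> self_adjoint (A - B)"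
  using self_adjoint_add[of A "(-1) *\<^sub>R B"] self_adjoint_scaleR[of B "-1"] by simp

lemma self_adjoint_congruence:
  "self_adjoint S \<Longrightarrow> self_adjoint A \<Longrightarrow> self_adjoint (S * A * S)"
  unfolding self_adjoint_iff using adjoint_pair_mult[of S S A A] adjoint_pair_mult[of "S * A" "A * S" S S]
  by (simp add: mult.assoc)

lemma tendsto_op_apply:
  assumes "(X \<longlongrightarrow> A) F"
  shows "((\<lambda>n. X n $$ x) \<longlongrightarrow> A $$ x) F"
  by (rule bounded_bilinear.tendsto[OF bounded_bilinear_op_apply assms tendsto_const])

lemma adjoint_pair_limit:
  assumes "X \<longlonglongrightarrow> A" "Y \<longlonglongrightarrow> B" "\<And>n. adjoint_pair (X n) (Y n)"
  shows "adjoint_pair A B"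
  unfolding adjoint_pair_def
proof (intro allI)
  fix x y
  have "(\<lambda>n. inner (X n $$ x) y) \<longlonglongrightarrow> inner (A $$ x) y"
    by (intro tendsto_intros tendsto_op_apply assms)
  moreover have "(\<lambda>n. inner (X n $$ x) y) \<longlonglongrightarrow> inner x (B $$ y)"
    unfolding adjoint_pairD[OF assms(3)] by (intro tendsto_intros tendsto_op_apply assms)
  ultimately show "inner (A $$ x) y = inner x (B $$ y)"
    by (rule LIMSEQ_unique)
qed

lemma self_adjoint_limit:
  "X \<longlonglongrightarrow> A \<Longrightarrow> (\<And>n. self_adjoint (X n)) \<Longrightarrow> self_adjoint A"
  unfolding self_adjoint_iff by (rule adjoint_pair_limit)

lemma norm_adjoint_le:
  assumes "adjoint_pair X Y"
  shows "norm Y \<le> norm X"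
proof (rule norm_op_le)
  fix x
  have "norm (Y $$ x) * norm (Y $$ x) = inner (Y $$ x) (Y $$ x)"
    by (simp add: power2_norm_eq_inner flip: power2_eq_square)
  also have "\<dots> = inner (X $$ Y $$ x) x"
    using assms by (simp add: adjoint_pair_def)
  also have "\<dots> \<le> norm (X $$ Y $$ x) * norm x"
    by (rule norm_cauchy_schwarz)
  also have "\<dots> \<le> norm X * norm (Y $$ x) * norm x"
    by (intro mult_right_mono norm_op_apply) simp
  finally show "norm (Y $$ x) \<le> norm X * norm x"
    by (cases "norm (Y $$ x) = 0") (auto simp: mult.commute mult.left_commute)
qed simp

text \<open>For a unit vector x and its normalized image y, norm (A x) is <y, A x>. Polarization
  writes this as a difference of two values of the quadratic form, and the parallelogram law bounds
  it by k.\<close>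

lemma norm_self_adjoint_le:
  assumes A: "self_adjoint A" and k: "\<And>x. \<bar>inner x (A $$ x)\<bar> \<le> k * (norm x)\<^sup>2"
  shows "norm A \<le> k"
proof (rule norm_op_le_unit)
  have "0 \<le> \<bar>inner (ell2_basis 0) (A $$ ell2_basis 0)\<bar>" by simp
  also have "\<dots> \<le> k" using k[of "ell2_basis 0"] by simp
  finally show "0 \<le> k" .
  fix x :: ell2 assume x: "norm x = 1"
  show "norm (A $$ x) \<le> k"
  proof (cases "A $$ x = 0")
    case False
    define y where "y = (1 / norm (A $$ x)) *\<^sub>R (A $$ x)"
    have y: "norm y = 1" using False by (simp add: y_def)
    have "inner (A $$ x) (A $$ x) = norm (A $$ x) * norm (A $$ x)"
      by (simp add: power2_norm_eq_inner flip: power2_eq_square)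
    then have *: "inner y (A $$ x) = norm (A $$ x)"
      using False by (simp add: y_def)
    have sym: "inner x (A $$ y) = inner y (A $$ x)"
      using self_adjointD[OF A, of x y] by (simp add: inner_commute)
    have "4 * inner y (A $$ x) = inner (x + y) (A $$ (x + y)) - inner (x - y) (A $$ (x - y))"
      by (simp add: inner_add_left inner_add_right inner_diff_left inner_diff_right sym)
    also have "\<dots> \<le> k * (norm (x + y))\<^sup>2 + k * (norm (x - y))\<^sup>2"
      using k[of "x + y"] k[of "x - y"] by linarith
    also have "\<dots> = k * (2 * (norm x)\<^sup>2 + 2 * (norm y)\<^sup>2)"
      by (simp add: power2_norm_eq_inner inner_add_left inner_add_right inner_diff_left
          inner_diff_right algebra_simps)
    finally show ?thesis using x y * by simp
  qed (use \<open>0 \<le> k\<close> in simp)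
qed

section \<open>Loewner order and spectral enclosures\<close>

definition op_le :: "ell2_op \<Rightarrow> ell2_op \<Rightarrow> bool"  (infix \<open>\<preceq>\<close> 50)
  where "A \<preceq> B \<longleftrightarrow> (\<forall>x. inner x (A $$ x) \<le> inner x (B $$ x))"

lemma op_le_refl [simp]: "A \<preceq> A"
  by (simp add: op_le_def)

lemma op_le_trans: "A \<preceq> B \<Longrightarrow> B \<preceq> C \<Longrightarrow> A \<preceq> C"
  unfolding op_le_def by (meson order_trans)

lemma op_le_scaleR: "A \<preceq> B \<Longrightarrow> 0 \<le> r \<Longrightarrow> r *\<^sub>R A \<preceq> r *\<^sub>R B"
  by (simp add: op_le_def mult_left_mono)

lemma op_le_congruence:
  assumes "self_adjoint S" "A \<preceq> B"
  shows "S * A * S \<preceq> S * B * S"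
  using assms by (simp add: op_le_def flip: self_adjointD)

lemma op_le_limit:
  assumes "X \<longlonglongrightarrow> A" "Y \<longlonglongrightarrow> B" "\<And>n. X n \<preceq> Y n"
  shows "A \<preceq> B"
  unfolding op_le_def
proof
  fix x
  show "inner x (A $$ x) \<le> inner x (B $$ x)"
    by (rule LIMSEQ_le[of "\<lambda>n. inner x (X n $$ x)" _ "\<lambda>n. inner x (Y n $$ x)"])
      (use assms in \<open>auto intro!: tendsto_intros tendsto_op_apply simp: op_le_def\<close>)
qed

text \<open>An interval enclosing the numerical range. It stands in for the spectrum: functions are
  approximated on [c, d], and positive definiteness means that c can be chosen positive.\<close>

definition op_between :: "real \<Rightarrow> real \<Rightarrow> ell2_op \<Rightarrow> bool"
  where "op_between c d A \<longleftrightarrow>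
    self_adjoint A \<and> (\<forall>x. c * (norm x)\<^sup>2 \<le> inner x (A $$ x) \<and> inner x (A $$ x) \<le> d * (norm x)\<^sup>2)"

lemma op_between_le: "op_between c d A \<Longrightarrow> c \<le> d"
  using order_trans[of c "inner (ell2_basis 0) (A $$ ell2_basis 0)" d]
  by (auto simp: op_between_def dest!: spec[of _ "ell2_basis 0"])

lemma op_between_mono: "op_between c d A \<Longrightarrow> c' \<le> c \<Longrightarrow> d \<le> d' \<Longrightarrow> op_between c' d' A"
  unfolding op_between_def by (meson mult_right_mono order_trans zero_le_power2)

text \<open>Subtracting the centre m makes the form bound symmetric, where it amounts to a norm
  bound. This translates between forms and norms in inversion and in the functional
  calculus.\<close>

lemma op_between_iff_norm:
  assumes "self_adjoint A"
  shows "op_between (m - r) (m + r) A \<longleftrightarrow> norm (A - m *\<^sub>R 1) \<le> r"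
proof
  have sa: "self_adjoint (A - m *\<^sub>R 1)"
    by (intro self_adjoint_diff self_adjoint_scaleR assms self_adjoint_one)
  have eq: "inner x ((A - m *\<^sub>R 1) $$ x) = inner x (A $$ x) - m * (norm x)\<^sup>2" for x
    by (simp add: inner_diff_right power2_norm_eq_inner)
  show "norm (A - m *\<^sub>R 1) \<le> r" if "op_between (m - r) (m + r) A"
  proof (rule norm_self_adjoint_le[OF sa])
    fix x
    show "\<bar>inner x ((A - m *\<^sub>R 1) $$ x)\<bar> \<le> r * (norm x)\<^sup>2"
      using that unfolding op_between_def eq
      by (auto dest!: spec[of _ x] simp: algebra_simps abs_le_iff)
  qed
  show "op_between (m - r) (m + r) A" if r: "norm (A - m *\<^sub>R 1) \<le> r"
    unfolding op_between_def
  proof (intro conjI allI assms)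
    fix x
    have "\<bar>inner x ((A - m *\<^sub>R 1) $$ x)\<bar> \<le> norm x * norm ((A - m *\<^sub>R 1) $$ x)"
      by (rule Cauchy_Schwarz_ineq2)
    also have "\<dots> \<le> norm x * (r * norm x)"
      using r by (intro mult_left_mono order_trans[OF norm_op_apply] mult_right_mono) auto
    finally have "\<bar>inner x (A $$ x) - m * (norm x)\<^sup>2\<bar> \<le> r * (norm x)\<^sup>2"
      unfolding eq by (simp add: power2_eq_square mult_ac)
    then show "(m - r) * (norm x)\<^sup>2 \<le> inner x (A $$ x)" "inner x (A $$ x) \<le> (m + r) * (norm x)\<^sup>2"
      unfolding abs_le_iff by (simp_all add: algebra_simps)
  qed
qed

lemma positive_definite_iff_between: "positive_definite A \<longleftrightarrow> (\<exists>c d. 0 < c \<and> op_between c d A)"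
proof
  assume "positive_definite A"
  then obtain c where A: "self_adjoint A" and c: "c > 0" "\<And>v. inner v (A $$ v) \<ge> c * (norm v)\<^sup>2"
    unfolding positive_definite_def Re_cinner by blast
  \<comment> \<open>Centre 0 and radius norm A: boundedness supplies the upper end of the
    enclosure.\<close>
  have "op_between (0 - norm A) (0 + norm A) A"
    by (subst op_between_iff_norm[OF A]) simp
  then have "op_between c (norm A) A"
    using c A by (auto simp: op_between_def)
  with c show "\<exists>c d. 0 < c \<and> op_between c d A" by blast
next
  assume "\<exists>c d. 0 < c \<and> op_between c d A"
  then show "positive_definite A"
    by (auto simp: positive_definite_def Re_cinner op_between_def)
qed

lemma positive_definite_self_adjoint: "positive_definite A \<Longrightarrow> self_adjoint A"
  by (simp add: positive_definite_def)

section \<open>Invertibility and the real spectrum\<close>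

definition op_invertible :: "ell2_op \<Rightarrow> bool"
  where "op_invertible A \<longleftrightarrow> (\<exists>B. A * B = 1 \<and> B * A = 1)"

lemma op_invertibleI: "A * B = 1 \<Longrightarrow> B * A = 1 \<Longrightarrow> op_invertible A"
  by (auto simp: op_invertible_def)

lemma op_invertible_mult:
  assumes "op_invertible A" "op_invertible B"
  shows "op_invertible (A * B)"
proof -
  obtain A' B' where "A * A' = 1" "A' * A = 1" "B * B' = 1" "B' * B = 1"
    using assms by (auto simp: op_invertible_def)
  then have "A * (B * B') * A' = 1" "B' * (A' * A) * B = 1" by simp_all
  then show ?thesis
    by (intro op_invertibleI[of _ "B' * A'"]) (simp_all add: mult.assoc)
qed

lemma op_invertible_scaleR:
  assumes "op_invertible A" "r \<noteq> 0"
  shows "op_invertible (r *\<^sub>R A)"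
proof -
  obtain B where "A * B = 1" "B * A = 1" using assms by (auto simp: op_invertible_def)
  then show ?thesis using assms(2) by (intro op_invertibleI[of _ "(1 / r) *\<^sub>R B"]) simp_all
qed

lemma op_invertible_one [simp]: "op_invertible 1"
  by (rule op_invertibleI[of _ 1]) simp_all

lemma Neumann_invertible:
  assumes "norm (1 - A) < 1"
  shows "op_invertible A"
proof -
  define D where "D = 1 - A"
  have sm: "summable (\<lambda>n. D ^ n)"
    using assms by (simp add: D_def complete_algebra_summable_geometric)
  have eq: "(\<Sum>n. D ^ n) = 1 + (\<Sum>n. D ^ Suc n)"
    using suminf_split_head[OF sm] by simp
  have "(\<Sum>n. D ^ Suc n) = D * (\<Sum>n. D ^ n)"
    using suminf_mult[OF sm, of D] by simp
  moreover have "(\<Sum>n. D ^ Suc n) = (\<Sum>n. D ^ n) * D"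
    using suminf_mult2[OF sm, of D] by (simp add: power_commutes)
  ultimately have "(1 - D) * (\<Sum>n. D ^ n) = 1" "(\<Sum>n. D ^ n) * (1 - D) = 1"
    using eq by (simp_all add: algebra_simps)
  then show ?thesis by (intro op_invertibleI) (simp_all add: D_def)
qed

text \<open>Divided by the midpoint m of [c, d], A is at distance at most r / m < 1 from the
  identity, and the Neumann series applies.\<close>

lemma op_between_invertible:
  assumes "op_between c d A" "0 < c"
  shows "op_invertible A"
proof -
  define m r where "m = (c + d) / 2" and "r = (d - c) / 2"
  have A: "self_adjoint A" using assms by (simp add: op_between_def)
  have cd: "c \<le> d" by (rule op_between_le) fact
  then have m: "m > 0" and "r < m" using assms(2) by (auto simp: m_def r_def field_simps)
  have "m - r = c" "m + r = d" by (simp_all add: m_def r_def field_simps)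
  then have "norm (A - m *\<^sub>R 1) \<le> r"
    using op_between_iff_norm[OF A, of m r] assms by simp
  then have "norm ((1 / m) *\<^sub>R (A - m *\<^sub>R 1)) < 1"
    unfolding norm_scaleR using m \<open>r < m\<close> by (simp add: field_simps)
  then have "norm (1 - (1 / m) *\<^sub>R A) < 1"
    using m by (simp add: scaleR_right_diff_distrib norm_minus_commute)
  then have "op_invertible (m *\<^sub>R (1 / m) *\<^sub>R A)"
    using m by (intro op_invertible_scaleR Neumann_invertible) auto
  then show ?thesis using m by simp
qed

lemma positive_definite_invertible: "positive_definite A \<Longrightarrow> op_invertible A"
  using op_between_invertible by (auto simp: positive_definite_iff_between)

lemma self_adjoint_square_inner:
  assumes "self_adjoint A"
  shows "inner x ((A * A) $$ x) = (norm (A $$ x))\<^sup>2"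
  using assms by (simp add: power2_norm_eq_inner flip: self_adjointD)

lemma self_adjoint_square: "self_adjoint A \<Longrightarrow> self_adjoint (A * A)"
  unfolding self_adjoint_iff by (rule adjoint_pair_mult)

text \<open>Takes care of the nonreal roots of a real polynomial: a conjugate pair x + iy, x - iy
  contributes (A - x)^2 + y^2, whose form is bounded below by y^2.\<close>

lemma op_invertible_quadratic:
  assumes "self_adjoint A" "y \<noteq> 0"
  shows "op_invertible (A * A + (y\<^sup>2) *\<^sub>R 1)"
proof (rule positive_definite_invertible)
  have "y\<^sup>2 * (norm v)\<^sup>2 \<le> inner v ((A * A + y\<^sup>2 *\<^sub>R 1) $$ v)" for v
    using self_adjoint_square_inner[OF assms(1), of v]
    by (simp add: inner_add_right power2_norm_eq_inner)
  then show "positive_definite (A * A + (y\<^sup>2) *\<^sub>R 1)"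
    unfolding positive_definite_def Re_cinner
    using assms by (auto intro!: self_adjoint_add self_adjoint_square self_adjoint_scaleR exI[of _ "y\<^sup>2"])
qed

lemma op_spectrum_of_real: "complex_of_real x \<in> op_spectrum A \<longleftrightarrow> \<not> op_invertible (A - x *\<^sub>R 1)"
proof -
  have "scalar_op (complex_of_real x) = x *\<^sub>R 1"
    by (rule op_eqI, rule ell2_eqI) (simp, simp add: scaleR_conv_of_real)
  then show ?thesis by (simp add: op_spectrum_def op_invertible_def)
qed

lemma op_spectrum_between:
  assumes "op_between c d A" "complex_of_real x \<in> op_spectrum A"
  shows "x \<in> {c..d}"
proof (rule ccontr)
  assume "x \<notin> {c..d}"
  then consider "x < c" | "d < x" by force
  then have "op_invertible (A - x *\<^sub>R 1)"
  proof cases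
    case 1
    have "op_between (c - x) (d - x) (A - x *\<^sub>R 1)"
      using assms(1) unfolding op_between_def
      by (auto intro!: self_adjoint_diff self_adjoint_scaleR
          simp: inner_diff_right algebra_simps power2_norm_eq_inner)
    then show ?thesis using 1 by (auto intro: op_between_invertible)
  next
    case 2
    have "op_between (x - d) (x - c) (x *\<^sub>R 1 - A)"
      using assms(1) unfolding op_between_def
      by (auto intro!: self_adjoint_diff self_adjoint_scaleR
          simp: inner_diff_right algebra_simps power2_norm_eq_inner)
    then have "op_invertible ((-1) *\<^sub>R (x *\<^sub>R 1 - A))"
      using 2 by (intro op_invertible_scaleR) (auto intro: op_between_invertible)
    then show ?thesis by simp
  qed
  with assms(2) show False by (simp add: op_spectrum_of_real)
qed

section \<open>Polynomials of an operator\<close>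

lemma op_poly_eq_sum:
  assumes "degree q \<le> n"
  shows "op_poly q A = (\<Sum>i\<le>n. coeff q i *\<^sub>R A ^ i)"
  unfolding op_poly_def
  by (rule sum.mono_neutral_left) (use assms in \<open>auto simp: coeff_eq_0\<close>)

lemma op_poly_0 [simp]: "op_poly 0 A = 0"
  by (simp add: op_poly_def)

lemma op_poly_pCons [simp]: "op_poly (pCons c q) A = c *\<^sub>R 1 + A * op_poly q A"
proof -
  have "op_poly (pCons c q) A = (\<Sum>i\<le>Suc (degree q). coeff (pCons c q) i *\<^sub>R A ^ i)"
    by (rule op_poly_eq_sum) (rule degree_pCons_le)
  also have "\<dots> = c *\<^sub>R 1 + (\<Sum>i\<le>degree q. coeff q i *\<^sub>R A ^ Suc i)"
    by (subst sum.atMost_Suc_shift) simp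
  finally show ?thesis by (simp add: op_poly_def sum_distrib_left)
qed

lemma op_poly_add: "op_poly (p + q) A = op_poly p A + op_poly q A"
  by (induction p q rule: poly_induct2) (simp_all add: algebra_simps)

lemma op_poly_smult: "op_poly (smult c p) A = c *\<^sub>R op_poly p A"
  by (induction p) (simp_all add: algebra_simps)

lemma op_poly_diff: "op_poly (p - q) A = op_poly p A - op_poly q A"
  using op_poly_add[of p "smult (-1) q" A] op_poly_smult[of "-1" q A] by simp

lemma op_poly_mult: "op_poly (p * q) A = op_poly p A * op_poly q A"
  by (induction p) (simp_all add: algebra_simps op_poly_add op_poly_smult)

lemma op_poly_commute: "A * op_poly q A = op_poly q A * A"
  using op_poly_mult[of "[:0, 1:]" q A] op_poly_mult[of q "[:0, 1:]" A] by (simp add: mult.commute)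

lemma op_poly_intertwine:
  assumes "X * Y = Z * X"
  shows "X * op_poly q Y = op_poly q Z * X"
proof (induction q)
  case (pCons c q)
  have "X * (Y * op_poly q Y) = Z * (X * op_poly q Y)"
    by (metis assms mult.assoc)
  with pCons show ?case by (simp add: algebra_simps)
qed simp

lemma self_adjoint_op_poly:
  assumes "self_adjoint A"
  shows "self_adjoint (op_poly q A)"
proof (induction q)
  case (pCons c q)
  then have "adjoint_pair (A * op_poly q A) (op_poly q A * A)"
    using assms by (intro adjoint_pair_mult) (simp_all add: self_adjoint_iff)
  then have "self_adjoint (A * op_poly q A)"
    by (simp add: self_adjoint_iff op_poly_commute)
  then show ?case
    by (simp add: self_adjoint_add self_adjoint_scaleR)
qed simp

section \<open>Factoring real polynomials through complex roots\<close>

lemma poly_map_of_real: "poly (map_poly complex_of_real p) (of_real x) = of_real (poly p x)"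
  by (induction p) (auto simp: map_poly_pCons)

lemma poly_map_of_real_add:
  "poly (map_poly complex_of_real (p + q)) z =
    poly (map_poly complex_of_real p) z + poly (map_poly complex_of_real q) z"
  by (induction p q rule: poly_induct2) (auto simp: map_poly_pCons algebra_simps)

lemma poly_map_of_real_smult:
  "poly (map_poly complex_of_real (smult c p)) z = of_real c * poly (map_poly complex_of_real p) z"
  by (induction p) (auto simp: map_poly_pCons algebra_simps)

lemma poly_map_of_real_mult:
  "poly (map_poly complex_of_real (p * q)) z =
    poly (map_poly complex_of_real p) z * poly (map_poly complex_of_real q) z"
  by (induction p)
    (auto simp: map_poly_pCons poly_map_of_real_add poly_map_of_real_smult algebra_simps)

lemma cmod_mult_self: "cmod z * cmod z = Re z * Re z + Im z * Im z"
  using cmod_power2[of z] by (simp add: power2_eq_square)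

text \<open>The quadratic has roots z and its conjugate. The remainder of p modulo it is at most
  linear and vanishes at the nonreal z; the imaginary part of this equation kills the slope, the
  real part then the constant.\<close>

lemma quadratic_factor_dvd:
  fixes p :: "real poly"
  assumes "poly (map_poly complex_of_real p) z = 0" "Im z \<noteq> 0"
  shows "[:(cmod z)\<^sup>2, - 2 * Re z, 1:] dvd p"
proof -
  define m where "m = [:(cmod z)\<^sup>2, - 2 * Re z, 1:]"
  define r where "r = p mod m"
  have "degree m = 2" by (simp add: m_def)
  then have "degree r < 2 \<or> r = 0"
    using degree_mod_less[of m p] by (auto simp: r_def m_def)
  then have "degree r \<le> 1" by auto
  then obtain a b where r: "r = [:a, b:]"
    by (metis One_nat_def degree_eq_zeroE le_Suc_eq le_zero_eq degree_pCons_eq_if pCons_cases nat.inject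
        One_nat_def pCons_0_0)
  have mz: "poly (map_poly complex_of_real m) z = 0"
    by (auto simp: m_def map_poly_pCons complex_eq_iff cmod_mult_self power2_eq_square algebra_simps)
  have "p = p div m * m + r" by (simp add: r_def)
  then have "poly (map_poly complex_of_real r) z = 0"
    using assms(1) mz poly_map_of_real_add[of "p div m * m" r z] by (simp add: poly_map_of_real_mult)
  then have "of_real a + of_real b * z = 0" by (simp add: r map_poly_pCons mult.commute)
  then have "Re (of_real a + of_real b * z) = 0" "Im (of_real a + of_real b * z) = 0"
    by simp_all
  then have "r = 0" using assms(2) by (simp add: r)
  then show ?thesis unfolding r_def m_def by (simp add: mod_eq_0_iff_dvd)
qed

text \<open>The half of spectral mapping that is used: a non-invertible p(A) forces a real root of p
  in the spectrum. Each step splits off one factor, either a real root, invertible by hypothesis, or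
  a conjugate pair, invertible for every self-adjoint A.\<close>

lemma op_poly_invertible:
  assumes A: "self_adjoint A" and "p \<noteq> 0"
    and "\<And>x. poly p x = 0 \<Longrightarrow> op_invertible (A - x *\<^sub>R 1)"
  shows "op_invertible (op_poly p A)"
  using assms(2,3)
proof (induction "degree p" arbitrary: p rule: less_induct)
  case less
  show ?case
  proof (cases "degree p = 0")
    case True
    then obtain c where "p = [:c:]" "c \<noteq> 0" using less.prems by (auto elim: degree_eq_zeroE)
    then show ?thesis by (simp add: op_invertible_scaleR)
  next
    case False
    then have "degree (map_poly complex_of_real p) \<noteq> 0" by (simp add: degree_map_poly)
    then have "\<not> constant (poly (map_poly complex_of_real p))"
      by (simp add: constant_degree)
    then obtain z where z: "poly (map_poly complex_of_real p) z = 0"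
      using fundamental_theorem_of_algebra by blast
    have "\<exists>m q. p = m * q \<and> degree m > 0 \<and> op_invertible (op_poly m A)"
    proof (cases "Im z = 0")
      case True
      then have "z = of_real (Re z)" by (simp add: complex_eq_iff)
      then have root: "poly p (Re z) = 0" using z poly_map_of_real[of p "Re z"] by simp
      then obtain q where "p = [:- Re z, 1:] * q"
        by (metis poly_eq_0_iff_dvd dvdE)
      moreover have "op_invertible (op_poly [:- Re z, 1:] A)"
        using less.prems(2)[OF root] by simp
      ultimately show ?thesis by (intro exI[of _ "[:- Re z, 1:]"] exI[of _ q]) simp
    next
      case False
      define m where "m = [:(cmod z)\<^sup>2, - 2 * Re z, 1:]"
      obtain q where q: "p = m * q"
        using quadratic_factor_dvd[OF z False] by (auto simp: m_def)
      \<comment> \<open>Completing the square: the quadratic factor is (X - Re z)^2 + (Im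
        z)^2.\<close>
      define B where "B = A - Re z *\<^sub>R 1"
      have "op_invertible (B * B + ((Im z)\<^sup>2) *\<^sub>R 1)"
        unfolding B_def using False A
        by (intro op_invertible_quadratic self_adjoint_diff self_adjoint_scaleR self_adjoint_one) auto
      also have "B * B + ((Im z)\<^sup>2) *\<^sub>R 1 = op_poly m A"
        by (simp add: m_def B_def cmod_mult_self power2_eq_square algebra_simps flip: scaleR_2)
      finally show ?thesis using q by (intro exI[of _ m] exI[of _ q]) (simp add: m_def)
    qed
    then obtain m q where p: "p = m * q" and m: "degree m > 0" "op_invertible (op_poly m A)" by blast
    have "q \<noteq> 0" "m \<noteq> 0" using p less.prems(1) by auto
    then have "degree q < degree p" using m p by (simp add: degree_mult_eq)
    then have "op_invertible (op_poly q A)"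
      using less.prems(2) p \<open>q \<noteq> 0\<close> by (intro less.hyps) auto
    then show ?thesis using m by (simp add: p op_poly_mult op_invertible_mult)
  qed
qed

text \<open>A self-adjoint \<open>B\<close> has approximate eigenvectors for \<open>\<bar>B\<bar>\<close> at the value \<open>norm B\<close>.\<close>

lemma not_invertible_square_minus_norm:
  assumes B: "self_adjoint B"
  shows "\<not> op_invertible (B * B - ((norm B)\<^sup>2) *\<^sub>R 1)"
proof
  define l where "l = norm B"
  assume "op_invertible (B * B - ((norm B)\<^sup>2) *\<^sub>R 1)"
  then obtain C where C: "C * (B * B - (l\<^sup>2) *\<^sub>R 1) = 1"
    by (auto simp: op_invertible_def l_def)
  have l: "0 \<le> l" by (simp add: l_def)
  \<comment> \<open>Expanding the square of norm y, with y = (B^2 - l^2) x, bounds it by l^2 (l^2 -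
    norm (B x)^2) on unit vectors. A left inverse C keeps this away from 0, so norm (B x) cannot
    come close to l.\<close>
  have main: "1 \<le> (norm C)\<^sup>2 * (l\<^sup>2 * (l\<^sup>2 - (norm (B $$ x))\<^sup>2))" if x: "norm x = 1" for x
  proof -
    define y where "y = (B * B - (l\<^sup>2) *\<^sub>R 1) $$ x"
    have "x = (C * (B * B - (l\<^sup>2) *\<^sub>R 1)) $$ x" by (simp only: C op_apply_simps)
    then have "x = C $$ y" by (simp add: y_def del: op_apply_linear)
    then have "1 \<le> norm C * norm y" using norm_op_apply[of C y] x by simp
    then have "1 \<le> (norm C * norm y)\<^sup>2" by (simp add: one_le_power)
    also have "\<dots> = (norm C)\<^sup>2 * (norm y)\<^sup>2" by (simp add: power_mult_distrib)
    also have "\<dots> \<le> (norm C)\<^sup>2 * (l\<^sup>2 * (l\<^sup>2 - (norm (B $$ x))\<^sup>2))"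
    proof (rule mult_left_mono)
      have "norm (B $$ B $$ x) \<le> l * norm (B $$ x)" by (simp add: l_def norm_op_apply)
      then have "(norm (B $$ B $$ x))\<^sup>2 \<le> l\<^sup>2 * (norm (B $$ x))\<^sup>2"
        using power_mono[of _ _ 2] by (fastforce simp: power_mult_distrib)
      moreover have "inner x (B $$ B $$ x) = (norm (B $$ x))\<^sup>2"
        using self_adjoint_square_inner[OF B] by simp
      then have "(norm y)\<^sup>2 = (norm (B $$ B $$ x))\<^sup>2 - 2 * l\<^sup>2 * (norm (B $$ x))\<^sup>2 + l\<^sup>2 * l\<^sup>2"
        using x by (simp add: y_def power2_norm_eq_inner inner_diff_left inner_diff_right
            inner_commute algebra_simps norm_eq_1)
      ultimately show "(norm y)\<^sup>2 \<le> l\<^sup>2 * (l\<^sup>2 - (norm (B $$ x))\<^sup>2)"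
        by (simp add: algebra_simps)
    qed simp
    finally show ?thesis .
  qed
  have pos: "0 < (norm C)\<^sup>2 * l\<^sup>2"
  proof (rule ccontr)
    assume "\<not> 0 < (norm C)\<^sup>2 * l\<^sup>2"
    then have "(norm C)\<^sup>2 * l\<^sup>2 = 0" by (metis linorder_not_less nless_le zero_le_mult_iff zero_le_power2)
    then show False using main[of "ell2_basis 0"] by (auto simp flip: mult.assoc)
  qed
  \<comment> \<open>A gap uniform over unit vectors: l^2 - norm (B x)^2 is at least
    \<open>d\<close>, although l is the operator norm of B.\<close>
  define d where "d = 1 / ((norm C)\<^sup>2 * l\<^sup>2)"
  have d: "d > 0" using pos by (simp add: d_def)
  have bound: "(norm (B $$ x))\<^sup>2 \<le> l\<^sup>2 - d" if "norm x = 1" for x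
  proof -
    have "1 \<le> ((norm C)\<^sup>2 * l\<^sup>2) * (l\<^sup>2 - (norm (B $$ x))\<^sup>2)"
      using main[OF that] by (simp add: mult.assoc)
    then have "d \<le> l\<^sup>2 - (norm (B $$ x))\<^sup>2"
      unfolding d_def using pos by (simp only: divide_le_eq mult.commute) simp
    then show ?thesis by simp
  qed
  have "0 \<le> l\<^sup>2 - d" using bound[of "ell2_basis 0"] by (meson norm_ell2_basis order_trans zero_le_power2)
  then have "l \<le> sqrt (l\<^sup>2 - d)"
    unfolding l_def
    by (intro norm_op_le_unit) (use bound in \<open>auto simp: l_def intro: real_le_rsqrt\<close>)
  then have "l\<^sup>2 \<le> l\<^sup>2 - d"
    using l \<open>0 \<le> l\<^sup>2 - d\<close> by (metis power_mono real_sqrt_pow2)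
  then show False using d by simp
qed

text \<open>As q(A) is self-adjoint, q(A)^2 minus its squared norm is not invertible. Being a
  polynomial in A, it has a real root x in the spectrum, and there abs (q x) is the norm.\<close>

lemma op_spectrum_poly_norm:
  assumes A: "self_adjoint A"
  shows "\<exists>x. complex_of_real x \<in> op_spectrum A \<and> norm (op_poly q A) = \<bar>poly q x\<bar>"
proof -
  have *: "\<exists>x. complex_of_real x \<in> op_spectrum A \<and> (poly q x)\<^sup>2 = (norm (op_poly q A))\<^sup>2"
    if nz: "q * q - [:(norm (op_poly q A))\<^sup>2:] \<noteq> 0" for q
  proof -
    let ?l = "norm (op_poly q A)"
    have "op_poly (q * q - [:?l\<^sup>2:]) A = op_poly q A * op_poly q A - ?l\<^sup>2 *\<^sub>R 1"
      by (simp add: op_poly_diff op_poly_mult)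
    then have "\<not> op_invertible (op_poly (q * q - [:?l\<^sup>2:]) A)"
      using not_invertible_square_minus_norm[OF self_adjoint_op_poly[OF A, of q]] by simp
    then obtain x where "poly (q * q - [:?l\<^sup>2:]) x = 0" "\<not> op_invertible (A - x *\<^sub>R 1)"
      using op_poly_invertible[OF A nz] by auto
    then show ?thesis by (auto simp: op_spectrum_of_real power2_eq_square)
  qed
  have "\<exists>x. complex_of_real x \<in> op_spectrum A \<and> (poly q x)\<^sup>2 = (norm (op_poly q A))\<^sup>2"
  proof (cases "q * q - [:(norm (op_poly q A))\<^sup>2:] = 0")
    case True
    have "poly (q * q - [:(norm (op_poly q A))\<^sup>2:]) x = 0" for x
      by (simp only: True poly_0)
    then have all: "(poly q x)\<^sup>2 = (norm (op_poly q A))\<^sup>2" for x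
      by (simp add: power2_eq_square)
    \<comment> \<open>If q^2 is constant, every real point has the right value and only a spectral
      point is missing. The identity polynomial provides one, since its square is not
      constant.\<close>
    have "[:0, 1:] * [:0, 1:] - [:c:] \<noteq> 0" for c :: real by simp
    then show ?thesis using *[of "[:0, 1:]"] all by blast
  qed (rule *)
  then show ?thesis by (metis abs_norm_cancel power2_eq_iff abs_minus_cancel)
qed

lemma op_poly_norm_le:
  assumes "op_between c d A" "\<And>x. x \<in> {c..d} \<Longrightarrow> \<bar>poly q x\<bar> \<le> m"
  shows "norm (op_poly q A) \<le> m"
proof -
  have "self_adjoint A" using assms by (simp add: op_between_def)
  then obtain x where "complex_of_real x \<in> op_spectrum A" "norm (op_poly q A) = \<bar>poly q x\<bar>"
    using op_spectrum_poly_norm by blast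
  then show ?thesis using assms op_spectrum_between by metis
qed

section \<open>Continuous functional calculus\<close>

lemma uniform_polynomial_approximation:
  fixes f :: "real \<Rightarrow> real"
  assumes "continuous_on {c..d} f"
  obtains q :: "nat \<Rightarrow> real poly" where "uniform_limit {c..d} (\<lambda>n x. poly (q n) x) f sequentially"
proof -
  have "\<exists>q. \<forall>x\<in>{c..d}. \<bar>poly q x - f x\<bar> < 1 / Suc n" for n
  proof -
    have "0 < 1 / real (Suc n)" by simp
    then obtain g where g: "real_polynomial_function g"
      and fg: "\<And>x. x \<in> {c..d} \<Longrightarrow> \<bar>f x - g x\<bar> < 1 / Suc n"
      using Stone_Weierstrass_real_polynomial_function[OF compact_Icc assms] by metis
    from g obtain a N where "g = (\<lambda>x. \<Sum>i\<le>N. a i * x^i)"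
      using real_polynomial_function_iff_sum by auto
    then have "poly (\<Sum>i\<le>N. monom (a i) i) x = g x" for x
      by (simp add: poly_sum poly_monom)
    then show ?thesis
      using fg by (intro exI[of _ "\<Sum>i\<le>N. monom (a i) i"]) (simp add: abs_minus_commute)
  qed
  then obtain q where q: "\<And>n x. x \<in> {c..d} \<Longrightarrow> \<bar>poly (q n) x - f x\<bar> < 1 / Suc n" by metis
  show ?thesis
  proof (rule that[of q], rule uniform_limitI)
    fix e :: real assume "e > 0"
    then have "\<forall>\<^sub>F n in sequentially. 1 / Suc n < e"
      using order_tendstoD(2)[OF LIMSEQ_inverse_real_of_nat] by (simp add: inverse_eq_divide)
    then show "\<forall>\<^sub>F n in sequentially. \<forall>x\<in>{c..d}. dist (poly (q n) x) (f x) < e"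
    proof eventually_elim
      case (elim n)
      then show ?case using q[of _ n] by (fastforce simp: dist_real_def)
    qed
  qed
qed

text \<open>Makes the limit in \<open>op_fun\<close> independent of the approximating polynomials:
  the norm of the difference is attained at one spectral point, where both polynomials are close to
  f.\<close>

lemma op_poly_diff_tendsto_0:
  assumes "self_adjoint A"
    and q: "uniform_limit {x. complex_of_real x \<in> op_spectrum A} (\<lambda>n x. poly (q n) x) f sequentially"
    and r: "uniform_limit {x. complex_of_real x \<in> op_spectrum A} (\<lambda>n x. poly (r n) x) f sequentially"
  shows "(\<lambda>n. op_poly (q n) A - op_poly (r n) A) \<longlonglongrightarrow> 0"
proof (rule metric_LIMSEQ_I)
  fix e :: real assume "e > 0"
  let ?S = "{x. complex_of_real x \<in> op_spectrum A}"
  have "\<forall>\<^sub>F n in sequentially. (\<forall>x\<in>?S. dist (poly (q n) x) (f x) < e / 2) \<and>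
      (\<forall>x\<in>?S. dist (poly (r n) x) (f x) < e / 2)"
    using \<open>e > 0\<close> by (intro eventually_conj uniform_limitD[OF q] uniform_limitD[OF r]) simp_all
  then obtain N where N: "\<And>n x. n \<ge> N \<Longrightarrow> x \<in> ?S \<Longrightarrow>
      dist (poly (q n) x) (f x) < e / 2 \<and> dist (poly (r n) x) (f x) < e / 2"
    unfolding eventually_sequentially by blast
  have "dist (op_poly (q n) A - op_poly (r n) A) 0 < e" if "n \<ge> N" for n
  proof -
    obtain x where "x \<in> ?S" "norm (op_poly (q n - r n) A) = \<bar>poly (q n - r n) x\<bar>"
      using op_spectrum_poly_norm[OF assms(1)] by blast
    moreover from this have "dist (poly (q n) x) (f x) < e / 2" "dist (poly (r n) x) (f x) < e / 2"
      using N[OF that] by blast+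
    ultimately show ?thesis
      unfolding op_poly_diff dist_real_def poly_diff dist_norm diff_zero by linarith
  qed
  then show "\<exists>N. \<forall>n\<ge>N. dist (op_poly (q n) A - op_poly (r n) A) 0 < e" by blast
qed

lemma op_poly_convergent:
  assumes A: "op_between c d A" and q: "uniform_limit {c..d} (\<lambda>n x. poly (q n) x) f sequentially"
  shows "convergent (\<lambda>n. op_poly (q n) A)"
proof (rule Cauchy_convergent, rule metric_CauchyI)
  fix e :: real assume "e > 0"
  then have "\<forall>\<^sub>F n in sequentially. \<forall>x\<in>{c..d}. dist (poly (q n) x) (f x) < e / 3"
    by (intro uniform_limitD[OF q]) simp
  then obtain N where N: "\<And>n x. n \<ge> N \<Longrightarrow> x \<in> {c..d} \<Longrightarrow> dist (poly (q n) x) (f x) < e / 3"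
    unfolding eventually_sequentially by blast
  have "dist (op_poly (q m) A) (op_poly (q n) A) < e" if "m \<ge> N" "n \<ge> N" for m n
  proof -
    have "norm (op_poly (q m - q n) A) \<le> e / 3 + e / 3"
    proof (rule op_poly_norm_le[OF A])
      fix x assume "x \<in> {c..d}"
      then show "\<bar>poly (q m - q n) x\<bar> \<le> e / 3 + e / 3"
        using N[OF that(1), of x] N[OF that(2), of x] unfolding dist_real_def poly_diff by linarith
    qed
    then show ?thesis using \<open>e > 0\<close> by (simp add: dist_norm op_poly_diff)
  qed
  then show "\<exists>M. \<forall>m\<ge>M. \<forall>n\<ge>M. dist (op_poly (q m) A) (op_poly (q n) A) < e" by blast
qed

text \<open>\<open>op_fun\<close> approximates on the spectrum, all later work on an enclosing
  interval. Convergence of the given sequence yields existence for the \<open>THE\<close>, and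
  \<open>op_poly_diff_tendsto_0\<close> yields uniqueness.\<close>

lemma op_fun_LIMSEQ:
  assumes A: "op_between c d A" and q: "uniform_limit {c..d} (\<lambda>n x. poly (q n) x) f sequentially"
  shows "(\<lambda>n. op_poly (q n) A) \<longlonglongrightarrow> op_fun f A"
proof -
  let ?S = "{x. complex_of_real x \<in> op_spectrum A}"
  have "?S \<subseteq> {c..d}" using op_spectrum_between[OF A] by blast
  then have qS: "uniform_limit ?S (\<lambda>n x. poly (q n) x) f sequentially"
    using q by (rule uniform_limit_on_subset[rotated])
  obtain B where B: "(\<lambda>n. op_poly (q n) A) \<longlonglongrightarrow> B"
    using op_poly_convergent[OF A q] by (auto simp: convergent_def)
  have "op_fun f A = B"
    unfolding op_fun_def
  proof (rule the_equality)
    show "\<exists>q. uniform_limit ?S (\<lambda>n. poly (q n)) f sequentially \<and> (\<lambda>n. op_poly (q n) A) \<longlonglongrightarrow> B"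
      using qS B by blast
  next
    fix C assume "\<exists>q. uniform_limit ?S (\<lambda>n. poly (q n)) f sequentially \<and> (\<lambda>n. op_poly (q n) A) \<longlonglongrightarrow> C"
    then obtain r where r: "uniform_limit ?S (\<lambda>n. poly (r n)) f sequentially"
        "(\<lambda>n. op_poly (r n) A) \<longlonglongrightarrow> C" by blast
    have "(\<lambda>n. op_poly (r n) A - op_poly (q n) A) \<longlonglongrightarrow> C - B"
      by (intro tendsto_diff r B)
    moreover have "(\<lambda>n. op_poly (r n) A - op_poly (q n) A) \<longlonglongrightarrow> 0"
      using A by (intro op_poly_diff_tendsto_0[OF _ r(1) qS]) (simp add: op_between_def)
    ultimately have "C - B = 0" by (rule LIMSEQ_unique)
    then show "C = B" by simp
  qed
  with B show ?thesis by simp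
qed

lemma op_fun_norm_le:
  assumes A: "op_between c d A" and f: "continuous_on {c..d} f"
    and m: "\<And>x. x \<in> {c..d} \<Longrightarrow> \<bar>f x\<bar> \<le> m"
  shows "norm (op_fun f A) \<le> m"
proof (rule field_le_epsilon)
  fix e :: real assume "e > 0"
  obtain q where q: "uniform_limit {c..d} (\<lambda>n x. poly (q n) x) f sequentially"
    using uniform_polynomial_approximation[OF f] .
  show "norm (op_fun f A) \<le> m + e"
  proof (rule tendsto_upperbound)
    show "(\<lambda>n. norm (op_poly (q n) A)) \<longlonglongrightarrow> norm (op_fun f A)"
      by (intro tendsto_norm op_fun_LIMSEQ[OF A q])
    have "\<forall>\<^sub>F n in sequentially. \<forall>x\<in>{c..d}. dist (poly (q n) x) (f x) < e"
      using uniform_limitD[OF q \<open>e > 0\<close>] .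
    then show "\<forall>\<^sub>F n in sequentially. norm (op_poly (q n) A) \<le> m + e"
    proof eventually_elim
      case (elim n)
      show ?case
      proof (rule op_poly_norm_le[OF A])
        fix x assume "x \<in> {c..d}"
        with elim m[of x] show "\<bar>poly (q n) x\<bar> \<le> m + e" by (fastforce simp: dist_real_def)
      qed
    qed
  qed simp
qed

lemma self_adjoint_op_fun:
  assumes A: "op_between c d A" and f: "continuous_on {c..d} f"
  shows "self_adjoint (op_fun f A)"
proof -
  obtain q where q: "uniform_limit {c..d} (\<lambda>n x. poly (q n) x) f sequentially"
    using uniform_polynomial_approximation[OF f] .
  show ?thesis
    by (rule self_adjoint_limit[OF op_fun_LIMSEQ[OF A q]])
      (use A in \<open>auto intro: self_adjoint_op_poly simp: op_between_def\<close>)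
qed

lemma op_fun_poly:
  assumes A: "op_between c d A"
  shows "op_fun (\<lambda>x. poly q x) A = op_poly q A"
  using op_fun_LIMSEQ[OF A uniform_limit_const, of q] by (simp add: LIMSEQ_const_iff)

lemma op_fun_add:
  assumes A: "op_between c d A" and f: "continuous_on {c..d} f" and g: "continuous_on {c..d} g"
  shows "op_fun (\<lambda>x. f x + g x) A = op_fun f A + op_fun g A"
proof -
  obtain q where q: "uniform_limit {c..d} (\<lambda>n x. poly (q n) x) f sequentially"
    using uniform_polynomial_approximation[OF f] .
  obtain r where r: "uniform_limit {c..d} (\<lambda>n x. poly (r n) x) g sequentially"
    using uniform_polynomial_approximation[OF g] .
  have "uniform_limit {c..d} (\<lambda>n x. poly (q n + r n) x) (\<lambda>x. f x + g x) sequentially"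
    using uniform_limit_add[OF q r] by simp
  from op_fun_LIMSEQ[OF A this] show ?thesis
    unfolding op_poly_add
    using tendsto_add[OF op_fun_LIMSEQ[OF A q] op_fun_LIMSEQ[OF A r]] LIMSEQ_unique by blast
qed

lemma op_fun_mult:
  assumes A: "op_between c d A" and f: "continuous_on {c..d} f" and g: "continuous_on {c..d} g"
  shows "op_fun (\<lambda>x. f x * g x) A = op_fun f A * op_fun g A"
proof -
  obtain q where q: "uniform_limit {c..d} (\<lambda>n x. poly (q n) x) f sequentially"
    using uniform_polynomial_approximation[OF f] .
  obtain r where r: "uniform_limit {c..d} (\<lambda>n x. poly (r n) x) g sequentially"
    using uniform_polynomial_approximation[OF g] .
  have "uniform_limit {c..d} (\<lambda>n x. poly (q n * r n) x) (\<lambda>x. f x * g x) sequentially"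
    unfolding poly_mult
    by (rule uniform_lim_mult[OF q r])
      (auto intro!: compact_imp_bounded compact_continuous_image f g)
  from op_fun_LIMSEQ[OF A this] show ?thesis
    unfolding op_poly_mult
    using tendsto_mult[OF op_fun_LIMSEQ[OF A q] op_fun_LIMSEQ[OF A r]] LIMSEQ_unique by blast
qed

lemma op_fun_cong:
  assumes A: "op_between c d A" and f: "continuous_on {c..d} f"
    and eq: "\<And>x. x \<in> {c..d} \<Longrightarrow> f x = g x"
  shows "op_fun f A = op_fun g A"
proof -
  obtain q where q: "uniform_limit {c..d} (\<lambda>n x. poly (q n) x) f sequentially"
    using uniform_polynomial_approximation[OF f] .
  then have "uniform_limit {c..d} (\<lambda>n x. poly (q n) x) g sequentially"
    using eq by (subst uniform_limit_cong'[of _ _ "\<lambda>n x. poly (q n) x" g f]) auto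
  from LIMSEQ_unique[OF op_fun_LIMSEQ[OF A q] op_fun_LIMSEQ[OF A this]] show ?thesis .
qed

lemma op_fun_const: "op_between c d A \<Longrightarrow> op_fun (\<lambda>x. k) A = k *\<^sub>R 1"
  using op_fun_poly[of c d A "[:k:]"] by simp

lemma op_fun_ident: "op_between c d A \<Longrightarrow> op_fun (\<lambda>x. x) A = A"
  using op_fun_poly[of c d A "[:0, 1:]"] by simp

lemma op_fun_scaleR:
  assumes "op_between c d A" "continuous_on {c..d} f"
  shows "op_fun (\<lambda>x. k * f x) A = k *\<^sub>R op_fun f A"
  using op_fun_mult[OF assms(1) continuous_on_const assms(2), of k] op_fun_const[OF assms(1), of k]
  by simp

lemma op_fun_intertwine:
  assumes Y: "op_between c d Y" and Z: "op_between c d Z" and "X * Y = Z * X"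
    and f: "continuous_on {c..d} f"
  shows "X * op_fun f Y = op_fun f Z * X"
proof -
  obtain q where q: "uniform_limit {c..d} (\<lambda>n x. poly (q n) x) f sequentially"
    using uniform_polynomial_approximation[OF f] .
  have "(\<lambda>n. X * op_poly (q n) Y) \<longlonglongrightarrow> X * op_fun f Y"
    by (intro tendsto_intros op_fun_LIMSEQ[OF Y q])
  moreover have "(\<lambda>n. op_poly (q n) Z * X) \<longlonglongrightarrow> op_fun f Z * X"
    by (intro tendsto_intros op_fun_LIMSEQ[OF Z q])
  ultimately show ?thesis
    unfolding op_poly_intertwine[OF assms(3)] by (rule LIMSEQ_unique)
qed

text \<open>With m the midpoint and r half the length of [c', d'], f - m is bounded by r on [c, d],
  hence f(A) - m has norm at most r.\<close>

lemma op_between_op_fun: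
  assumes A: "op_between c d A" and f: "continuous_on {c..d} f"
    and cd': "\<And>x. x \<in> {c..d} \<Longrightarrow> f x \<in> {c'..d'}"
  shows "op_between c' d' (op_fun f A)"
proof -
  define m r where "m = (c' + d') / 2" and "r = (d' - c') / 2"
  have mr: "m - r = c'" "m + r = d'" by (simp_all add: m_def r_def field_simps)
  have "op_fun (\<lambda>x. f x + (- m)) A = op_fun f A - m *\<^sub>R 1"
    using op_fun_add[OF A f continuous_on_const, of "- m"] op_fun_const[OF A, of "- m"] by simp
  moreover have "norm (op_fun (\<lambda>x. f x + (- m)) A) \<le> r"
  proof (rule op_fun_norm_le[OF A])
    show "continuous_on {c..d} (\<lambda>x. f x + - m)" by (intro continuous_intros f)
    fix x assume "x \<in> {c..d}"
    from cd'[OF this] show "\<bar>f x + - m\<bar> \<le> r" by (auto simp: m_def r_def abs_le_iff field_simps)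
  qed
  ultimately show ?thesis
    using op_between_iff_norm[OF self_adjoint_op_fun[OF A f], of m r] by (simp add: mr)
qed

lemma op_poly_op_fun:
  assumes A: "op_between c d A" and f: "continuous_on {c..d} f"
  shows "op_poly q (op_fun f A) = op_fun (\<lambda>x. poly q (f x)) A"
proof (induction q)
  case 0
  then show ?case using op_fun_const[OF A, of 0] by simp
next
  case (pCons k q)
  have "op_fun (\<lambda>x. k + f x * poly q (f x)) A = op_fun (\<lambda>x. k) A + op_fun (\<lambda>x. f x * poly q (f x)) A"
    by (intro op_fun_add[OF A] continuous_intros f)
  also have "op_fun (\<lambda>x. f x * poly q (f x)) A = op_fun f A * op_fun (\<lambda>x. poly q (f x)) A"
    by (intro op_fun_mult[OF A] continuous_intros f)
  finally show ?case by (simp add: pCons op_fun_const[OF A])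
qed

text \<open>Approximating g by polynomials on [c', d'] reduces the claim to a polynomial of f(A),
  which is algebra; both sides are limits of the same operators.\<close>

lemma op_fun_compose:
  assumes A: "op_between c d A" and f: "continuous_on {c..d} f"
    and cd': "\<And>x. x \<in> {c..d} \<Longrightarrow> f x \<in> {c'..d'}" and g: "continuous_on {c'..d'} g"
  shows "op_fun g (op_fun f A) = op_fun (\<lambda>x. g (f x)) A"
proof -
  have cont: "continuous_on {c..d} (\<lambda>x. g (f x))"
    using continuous_on_compose2[OF g f] cd' by blast
  obtain q where q: "uniform_limit {c'..d'} (\<lambda>n x. poly (q n) x) g sequentially"
    using uniform_polynomial_approximation[OF g] .
  have "(\<lambda>n. op_fun (\<lambda>x. poly (q n) (f x)) A) \<longlonglongrightarrow> op_fun (\<lambda>x. g (f x)) A"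
  proof (rule metric_LIMSEQ_I)
    fix e :: real assume "e > 0"
    then have "\<forall>\<^sub>F n in sequentially. \<forall>x\<in>{c'..d'}. dist (poly (q n) x) (g x) < e / 2"
      by (intro uniform_limitD[OF q]) simp
    then obtain N where N: "\<And>n x. n \<ge> N \<Longrightarrow> x \<in> {c'..d'} \<Longrightarrow> dist (poly (q n) x) (g x) < e / 2"
      unfolding eventually_sequentially by blast
    have "dist (op_fun (\<lambda>x. poly (q n) (f x)) A) (op_fun (\<lambda>x. g (f x)) A) < e" if "n \<ge> N" for n
    proof -
      have "op_fun (\<lambda>x. poly (q n) (f x) + (- 1) * g (f x)) A
          = op_fun (\<lambda>x. poly (q n) (f x)) A + op_fun (\<lambda>x. (-1) * g (f x)) A"
        by (intro op_fun_add[OF A] continuous_intros f cont)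
      also have "op_fun (\<lambda>x. (-1) * g (f x)) A = - op_fun (\<lambda>x. g (f x)) A"
        using op_fun_scaleR[OF A cont, of "-1"] by simp
      finally have "dist (op_fun (\<lambda>x. poly (q n) (f x)) A) (op_fun (\<lambda>x. g (f x)) A)
          = norm (op_fun (\<lambda>x. poly (q n) (f x) + (- 1) * g (f x)) A)"
        by (simp add: dist_norm)
      also have "\<dots> \<le> e / 2"
      proof (rule op_fun_norm_le[OF A])
        show "continuous_on {c..d} (\<lambda>x. poly (q n) (f x) + (- 1) * g (f x))"
          by (intro continuous_intros f cont)
        fix x assume "x \<in> {c..d}"
        then show "\<bar>poly (q n) (f x) + - 1 * g (f x)\<bar> \<le> e / 2"
          using N[OF that cd'[of x]] by (simp add: dist_real_def)
      qed
      finally show ?thesis using \<open>e > 0\<close> by simp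
    qed
    then show "\<exists>N. \<forall>n\<ge>N. dist (op_fun (\<lambda>x. poly (q n) (f x)) A) (op_fun (\<lambda>x. g (f x)) A) < e"
      by blast
  qed
  moreover have "(\<lambda>n. op_fun (\<lambda>x. poly (q n) (f x)) A) \<longlonglongrightarrow> op_fun g (op_fun f A)"
    using op_fun_LIMSEQ[OF op_between_op_fun[OF A f cd'] q] by (simp add: op_poly_op_fun[OF A f])
  ultimately show ?thesis using LIMSEQ_unique by blast
qed

section \<open>Real powers of positive definite operators\<close>

lemma positive_definite_between:
  assumes "positive_definite A"
  obtains c d where "0 < c" "c \<le> d" "op_between c d A"
  using assms op_between_le by (auto simp: positive_definite_iff_between)

lemma continuous_on_powr_pos: "0 < c \<Longrightarrow> continuous_on {c..d} (\<lambda>x::real. x powr t)"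
  by (intro continuous_intros) auto

lemma powr_in_interval:
  fixes c :: real
  assumes "0 < c" "x \<in> {c..d}"
  shows "x powr t \<in> {min (c powr t) (d powr t)..max (c powr t) (d powr t)}"
proof (cases "0 \<le> t")
  case True
  then have "c powr t \<le> x powr t" "x powr t \<le> d powr t" using assms powr_mono2[of t c x] powr_mono2[of t x d] by auto
  then show ?thesis by auto
next
  case False
  then have "x powr t \<le> c powr t" "d powr t \<le> x powr t" using assms by (auto intro!: powr_mono2')
  then show ?thesis by auto
qed

lemma positive_definite_op_powr:
  assumes "positive_definite A"
  shows "positive_definite (op_powr A t)"
proof -
  obtain c d where cd: "0 < c" "c \<le> d" "op_between c d A" using positive_definite_between[OF assms] .
  have "op_between (min (c powr t) (d powr t)) (max (c powr t) (d powr t)) (op_powr A t)"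
    unfolding op_powr_def
    by (rule op_between_op_fun[OF cd(3) continuous_on_powr_pos[OF cd(1)] powr_in_interval[OF cd(1)]])
  moreover have "0 < min (c powr t) (d powr t)" using cd by simp
  ultimately show ?thesis unfolding positive_definite_iff_between by blast
qed

lemma self_adjoint_op_powr: "positive_definite A \<Longrightarrow> self_adjoint (op_powr A t)"
  by (intro positive_definite_self_adjoint positive_definite_op_powr)

lemma op_powr_add:
  assumes "positive_definite A"
  shows "op_powr A s * op_powr A t = op_powr A (s + t)"
proof -
  obtain c d where cd: "0 < c" "c \<le> d" "op_between c d A" using positive_definite_between[OF assms] .
  show ?thesis
    unfolding op_powr_def powr_add
    by (rule op_fun_mult[symmetric]) (use cd in \<open>auto intro: continuous_on_powr_pos\<close>)
qed

lemma op_powr_0 [simp]: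
  assumes "positive_definite A"
  shows "op_powr A 0 = 1"
proof -
  obtain c d where cd: "0 < c" "c \<le> d" "op_between c d A" using positive_definite_between[OF assms] .
  have "op_fun (\<lambda>x. x powr 0) A = op_fun (\<lambda>x. 1) A"
    by (rule op_fun_cong[OF cd(3) continuous_on_powr_pos[OF cd(1)]]) (use cd in auto)
  then show ?thesis by (simp add: op_powr_def op_fun_const[OF cd(3)])
qed

lemma op_powr_1 [simp]:
  assumes "positive_definite A"
  shows "op_powr A 1 = A"
proof -
  obtain c d where cd: "0 < c" "c \<le> d" "op_between c d A" using positive_definite_between[OF assms] .
  have "op_fun (\<lambda>x. x powr 1) A = op_fun (\<lambda>x. x) A"
    by (rule op_fun_cong[OF cd(3) continuous_on_powr_pos[OF cd(1)]]) (use cd in auto)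
  then show ?thesis by (simp add: op_powr_def op_fun_ident[OF cd(3)])
qed

lemma op_powr_powr:
  assumes "positive_definite A"
  shows "op_powr (op_powr A s) t = op_powr A (s * t)"
proof -
  obtain c d where cd: "0 < c" "c \<le> d" "op_between c d A" using positive_definite_between[OF assms] .
  show ?thesis
    unfolding op_powr_def powr_powr[symmetric]
    by (rule op_fun_compose[OF cd(3) continuous_on_powr_pos[OF cd(1)] powr_in_interval[OF cd(1)]])
      (use cd in \<open>auto intro: continuous_on_powr_pos\<close>)
qed

lemma op_powr_scaleR:
  assumes "positive_definite A" "0 < r"
  shows "op_powr (r *\<^sub>R A) t = r powr t *\<^sub>R op_powr A t"
proof -
  obtain c d where cd: "0 < c" "c \<le> d" "op_between c d A" using positive_definite_between[OF assms(1)] .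
  have "op_fun (\<lambda>x. r * x) A = r *\<^sub>R A"
    using op_fun_scaleR[OF cd(3) continuous_on_id, of r] op_fun_ident[OF cd(3)] by simp
  then have "op_powr (r *\<^sub>R A) t = op_fun (\<lambda>x. x powr t) (op_fun (\<lambda>x. r * x) A)"
    by (simp add: op_powr_def)
  also have "\<dots> = op_fun (\<lambda>x. (r * x) powr t) A"
    by (rule op_fun_compose[OF cd(3), where c' = "r * c" and d' = "r * d"])
      (use cd assms(2) in \<open>auto intro!: continuous_on_powr_pos continuous_intros\<close>)
  also have "\<dots> = op_fun (\<lambda>x. r powr t * x powr t) A"
    by (rule op_fun_cong[OF cd(3)])
      (use cd assms(2) in \<open>auto intro!: continuous_intros simp: powr_mult\<close>)
  also have "\<dots> = r powr t *\<^sub>R op_powr A t"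
    unfolding op_powr_def by (rule op_fun_scaleR[OF cd(3) continuous_on_powr_pos[OF cd(1)]])
  finally show ?thesis .
qed

lemma op_powr_intertwine:
  assumes "positive_definite Y" "positive_definite Z" "X * Y = Z * X"
  shows "X * op_powr Y t = op_powr Z t * X"
proof -
  obtain c d where cd: "0 < c" "c \<le> d" "op_between c d Y" using positive_definite_between[OF assms(1)] .
  obtain c' d' where cd': "0 < c'" "c' \<le> d'" "op_between c' d' Z" using positive_definite_between[OF assms(2)] .
  \<comment> \<open>The same polynomials must approximate for both operators, so the two enclosures
    are merged into one.\<close>
  have "op_between (min c c') (max d d') Y" "op_between (min c c') (max d d') Z"
    by (rule op_between_mono[OF cd(3)] op_between_mono[OF cd'(3)]; simp)+
  then show ?thesis
    unfolding op_powr_def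
    by (rule op_fun_intertwine) (use assms cd cd' in \<open>auto intro: continuous_on_powr_pos\<close>)
qed

text \<open>Carries Loewner-Heinz from dyadic to arbitrary exponents. On the compact rectangle
  [c, d] times [t - 1, t + 1] the power function is uniformly continuous, so the powers converge
  uniformly on [c, d].\<close>

lemma op_powr_tendsto:
  assumes "positive_definite A" "s \<longlonglongrightarrow> t"
  shows "(\<lambda>n. op_powr A (s n)) \<longlonglongrightarrow> op_powr A t"
proof -
  obtain c d where cd: "0 < c" "c \<le> d" "op_between c d A" using positive_definite_between[OF assms(1)] .
  define S where "S = {c..d} \<times> {t - 1..t + 1}"
  have "continuous_on S (\<lambda>z. fst z powr snd z)"
    using cd by (intro continuous_intros) (auto simp: S_def)
  then have uc: "uniformly_continuous_on S (\<lambda>z. fst z powr snd z)"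
    by (rule compact_uniformly_continuous) (auto simp: S_def intro: compact_Times)
  show ?thesis
  proof (rule metric_LIMSEQ_I)
    fix e :: real assume "e > 0"
    then obtain d' where d': "d' > 0"
      "\<And>z z'. z \<in> S \<Longrightarrow> z' \<in> S \<Longrightarrow> dist z' z < d' \<Longrightarrow> dist (fst z' powr snd z') (fst z powr snd z) < e / 2"
      using uniformly_continuous_onE[OF uc, of "e / 2"] by (metis half_gt_zero)
    obtain N where N: "\<And>n. n \<ge> N \<Longrightarrow> dist (s n) t < min 1 d'"
      using metric_LIMSEQ_D[OF assms(2), of "min 1 d'"] d'(1) by auto
    have "dist (op_powr A (s n)) (op_powr A t) < e" if "n \<ge> N" for n
    proof -
      note cont = continuous_on_powr_pos[OF cd(1)]
      have "op_fun (\<lambda>x. x powr s n + (- 1) * x powr t) A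
          = op_fun (\<lambda>x. x powr s n) A + op_fun (\<lambda>x. (-1) * x powr t) A"
        by (intro op_fun_add[OF cd(3)] continuous_intros cont) (use cd in auto)
      also have "op_fun (\<lambda>x. (-1) * x powr t) A = - op_fun (\<lambda>x. x powr t) A"
        using op_fun_scaleR[OF cd(3) cont, of "-1"] by simp
      finally have "dist (op_powr A (s n)) (op_powr A t)
          = norm (op_fun (\<lambda>x. x powr s n + (- 1) * x powr t) A)"
        by (simp add: dist_norm op_powr_def)
      also have "\<dots> \<le> e / 2"
      proof (rule op_fun_norm_le[OF cd(3)])
        show "continuous_on {c..d} (\<lambda>x. x powr s n + (- 1) * x powr t)"
          using cd by (intro continuous_intros) auto
        fix x assume x: "x \<in> {c..d}"
        have "dist (x, s n) (x, t) < d'" using N[OF that] by (simp add: dist_Pair_Pair)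
        moreover have "(x, s n) \<in> S" "(x, t) \<in> S"
          using x N[OF that] by (auto simp: S_def dist_real_def)
        ultimately show "\<bar>x powr s n + - 1 * x powr t\<bar> \<le> e / 2"
          using d'(2)[of "(x, t)" "(x, s n)"] by (simp add: dist_real_def)
      qed
      finally show ?thesis using \<open>e > 0\<close> by simp
    qed
    then show "\<exists>N. \<forall>n\<ge>N. dist (op_powr A (s n)) (op_powr A t) < e" by blast
  qed
qed

section \<open>The Loewner-Heinz inequality\<close>

lemma op_powr_cancel:
  assumes "positive_definite A"
  shows "op_powr A t * op_powr A (- t) = 1" "op_powr A (- t) * op_powr A t = 1"
  using op_powr_add[OF assms, of t "- t"] op_powr_add[OF assms, of "- t" t] assms by simp_all

lemma op_powr_half_mult:
  assumes "positive_definite A"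
  shows "op_powr A (t / 2) * op_powr A (t / 2) = op_powr A t"
  using op_powr_add[OF assms, of "t / 2" "t / 2"] by simp

lemma norm_op_powr_half_sq:
  assumes "positive_definite A"
  shows "(norm (op_powr A (t / 2) $$ x))\<^sup>2 = inner x (op_powr A t $$ x)"
  using self_adjoint_square_inner[OF self_adjoint_op_powr[OF assms], of x "t / 2"]
  by (simp only: op_powr_half_mult[OF assms])

text \<open>Substituting x = B^(t/2) y turns the claim into the comparison of the forms of A^t and
  B^t at y. The order becomes a norm bound, which products preserve.\<close>

lemma norm_op_powr_quotient_le:
  assumes A: "positive_definite A" and B: "positive_definite B"
    and le: "op_powr A t \<preceq> op_powr B t"
  shows "norm (op_powr A (t / 2) * op_powr B (- (t / 2))) \<le> 1"
proof (rule norm_op_le)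
  fix x
  define y where "y = op_powr B (- (t / 2)) $$ x"
  have x: "op_powr B (t / 2) $$ y = x"
    unfolding y_def using op_powr_cancel(1)[OF B, of "t / 2"] by (metis op_apply_simps(2,7))
  have "(norm (op_powr A (t / 2) $$ y))\<^sup>2 \<le> (norm (op_powr B (t / 2) $$ y))\<^sup>2"
    unfolding norm_op_powr_half_sq[OF A] norm_op_powr_half_sq[OF B]
    using le by (simp add: op_le_def)
  then show "norm ((op_powr A (t / 2) * op_powr B (- (t / 2))) $$ x) \<le> 1 * norm x"
    using x by (simp add: y_def)
qed simp

text \<open>
  The self-adjoint operator \<open>S = B\<^bsup>-\<tau>/2\<^esup> A\<^bsup>\<tau>\<^esup> B\<^bsup>-\<tau>/2\<^esup>\<close> with \<open>\<tau> = (\<alpha> + \<beta>) / 2\<close> is similar to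
  the contraction \<open>Y = B\<^bsup>-\<alpha>/2\<^esup> A\<^bsup>\<alpha>/2\<^esup> A\<^bsup>\<beta>/2\<^esup> B\<^bsup>-\<beta>/2\<^esup>\<close>, so its norm, which is attained
  on its spectrum, is at most 1.
\<close>

lemma op_powr_le_midpoint:
  assumes A: "positive_definite A" and B: "positive_definite B"
    and a: "op_powr A \<alpha> \<preceq> op_powr B \<alpha>" and b: "op_powr A \<beta> \<preceq> op_powr B \<beta>"
  shows "op_powr A ((\<alpha> + \<beta>) / 2) \<preceq> op_powr B ((\<alpha> + \<beta>) / 2)"
proof -
  define \<tau> where "\<tau> = (\<alpha> + \<beta>) / 2"
  define S where "S = op_powr B (- (\<tau> / 2)) * op_powr A \<tau> * op_powr B (- (\<tau> / 2))"
  define U where "U = op_powr B (- (\<alpha> / 2)) * op_powr A (\<alpha> / 2)"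
  define V where "V = op_powr A (\<beta> / 2) * op_powr B (- (\<beta> / 2))"
  define Y where "Y = U * V"
  \<comment> \<open>The exponent is chosen such that P B^(-\<alpha>/2) = B^(-\<tau>/2). On the other
    side B^(-\<beta>/2) P' is the same power because \<alpha> + \<beta> = 2 \<tau>.\<close>
  define P P' where "P = op_powr B ((\<alpha> - \<tau>) / 2)" and "P' = op_powr B (- ((\<alpha> - \<tau>) / 2))"
  have S: "self_adjoint S"
    unfolding S_def by (intro self_adjoint_congruence self_adjoint_op_powr A B)
  \<comment> \<open>U is the adjoint of a quotient of the form just bounded, hence a contraction as
    well.\<close>
  have "adjoint_pair (op_powr A (\<alpha> / 2) * op_powr B (- (\<alpha> / 2))) U"
    unfolding U_def
    by (intro adjoint_pair_mult) (simp_all add: self_adjoint_op_powr A B flip: self_adjoint_iff)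
  then have "norm U \<le> 1"
    using norm_adjoint_le norm_op_powr_quotient_le[OF A B a] order_trans by blast
  moreover have "norm V \<le> 1"
    unfolding V_def by (rule norm_op_powr_quotient_le[OF A B b])
  ultimately have Y: "norm Y \<le> 1"
    unfolding Y_def by (meson mult_le_one norm_ge_zero norm_mult_ineq order_trans)
  have PP': "P * P' = 1" "P' * P = 1"
    unfolding P_def P'_def using op_powr_cancel[OF B] by blast+
  have "P * op_powr B (- (\<alpha> / 2)) = op_powr B (- (\<tau> / 2))"
    unfolding P_def op_powr_add[OF B] by (simp add: field_simps)
  moreover have "op_powr B (- (\<beta> / 2)) * P' = op_powr B (- (\<tau> / 2))"
    unfolding P'_def op_powr_add[OF B]
    by (rule arg_cong[where f = "op_powr B"]) (simp add: \<tau>_def field_simps)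
  moreover have "op_powr A (\<alpha> / 2) * op_powr A (\<beta> / 2) = op_powr A \<tau>"
    unfolding op_powr_add[OF A] by (simp add: \<tau>_def field_simps)
  ultimately have "S = P * Y * P'"
    unfolding S_def Y_def U_def V_def by (metis mult.assoc)
  have "norm S \<le> 1"
  proof (rule ccontr)
    assume "\<not> norm S \<le> 1"
    obtain x where "complex_of_real x \<in> op_spectrum S" and "norm (op_poly [:0, 1:] S) = \<bar>poly [:0, 1:] x\<bar>"
      using op_spectrum_poly_norm[OF S] by blast
    with \<open>\<not> norm S \<le> 1\<close> have x: "\<not> op_invertible (S - x *\<^sub>R 1)" "1 < \<bar>x\<bar>"
      by (simp_all add: op_spectrum_of_real)
    \<comment> \<open>Here abs x is the norm of S. As it exceeds 1 while Y is a contraction, Y - x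
      is invertible by the Neumann series, and so is its conjugate S - x.\<close>
    have "norm (1 - (1 - (1 / x) *\<^sub>R Y)) < 1" using x Y by (simp add: field_simps)
    then have "op_invertible ((- x) *\<^sub>R (1 - (1 / x) *\<^sub>R Y))"
      using x by (intro op_invertible_scaleR Neumann_invertible) auto
    also have "(- x) *\<^sub>R (1 - (1 / x) *\<^sub>R Y) = Y - x *\<^sub>R 1"
      using x by (auto simp: scaleR_right_diff_distrib)
    finally have "op_invertible (P * (Y - x *\<^sub>R 1) * P')"
      using PP' by (intro op_invertible_mult op_invertibleI[of P P'] op_invertibleI[of P' P])
    also have "P * (Y - x *\<^sub>R 1) * P' = S - x *\<^sub>R 1"
      unfolding \<open>S = P * Y * P'\<close> using PP' by (simp add: algebra_simps)
    finally show False using x by simp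
  qed
  have "op_powr A \<tau> \<preceq> op_powr B \<tau>"
    unfolding op_le_def
  proof
    fix x
    define y where "y = op_powr B (\<tau> / 2) $$ x"
    have x: "op_powr B (- (\<tau> / 2)) $$ y = x"
      unfolding y_def using op_powr_cancel(2)[OF B, of "\<tau> / 2"] by (metis op_apply_simps(2,7))
    have "inner x (op_powr A \<tau> $$ x) = inner y (S $$ y)"
      unfolding S_def op_apply_simps using x self_adjointD[OF self_adjoint_op_powr[OF B]]
      by (metis inner_commute)
    also have "\<dots> \<le> norm y * norm (S $$ y)" by (rule norm_cauchy_schwarz)
    also have "\<dots> \<le> norm y * (1 * norm y)"
      using \<open>norm S \<le> 1\<close> by (intro mult_left_mono order_trans[OF norm_op_apply] mult_right_mono) auto
    also have "\<dots> = inner x (op_powr B \<tau> $$ x)"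
      using norm_op_powr_half_sq[OF B, of \<tau> x] by (simp add: y_def power2_eq_square)
    finally show "inner x (op_powr A \<tau> $$ x) \<le> inner x (op_powr B \<tau> $$ x)" .
  qed
  then show ?thesis by (simp add: \<tau>_def)
qed

text \<open>Exponents 0 and 1 are immediate, and k / 2^(n+1) is the midpoint of i / 2^n and (k - i)
  / 2^n for i = k div 2.\<close>

lemma op_powr_le_dyadic:
  assumes A: "positive_definite A" and B: "positive_definite B" and "A \<preceq> B"
  shows "k \<le> 2 ^ n \<Longrightarrow> op_powr A (real k / 2 ^ n) \<preceq> op_powr B (real k / 2 ^ n)"
proof (induction n arbitrary: k)
  case 0
  then have "k = 0 \<or> k = 1" by auto
  then show ?case using assms by auto
next
  case (Suc n)
  define i where "i = k div 2"
  have "k = i + (k - i)" and i: "i \<le> 2 ^ n" "k - i \<le> 2 ^ n"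
    using Suc.prems by (auto simp: i_def)
  then have "real k / 2 ^ Suc n = (real i / 2 ^ n + real (k - i) / 2 ^ n) / 2"
    by (metis add_divide_distrib divide_divide_eq_left of_nat_add power_Suc2)
  then show ?case
    using op_powr_le_midpoint[OF A B Suc.IH[OF i(1)] Suc.IH[OF i(2)]] by metis
qed

theorem op_powr_mono:
  assumes A: "positive_definite A" and B: "positive_definite B" and "A \<preceq> B" and t: "t \<in> {0..1}"
  shows "op_powr A t \<preceq> op_powr B t"
proof -
  \<comment> \<open>Dyadic approximation of t from below, with error less than 2^(-n).\<close>
  define k where "k n = nat \<lfloor>t * 2 ^ n\<rfloor>" for n :: nat
  have k: "real (k n) \<le> t * 2 ^ n" "t * 2 ^ n < real (k n) + 1" for n
    using t by (simp_all add: k_def)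
  have "k n \<le> 2 ^ n" for n
  proof -
    have "t * 2 ^ n \<le> 2 ^ n" using t by (simp add: mult_left_le_one_le)
    then have "real (k n) \<le> real (2 ^ n)"
      unfolding of_nat_power of_nat_numeral using k(1)[of n] by linarith
    then show ?thesis by (simp only: of_nat_le_iff)
  qed
  then have le: "op_powr A (real (k n) / 2 ^ n) \<preceq> op_powr B (real (k n) / 2 ^ n)" for n
    by (rule op_powr_le_dyadic[OF A B \<open>A \<preceq> B\<close>])
  have "(\<lambda>n. real (k n) / 2 ^ n) \<longlonglongrightarrow> t"
  proof (rule tendsto_sandwich)
    have "(\<lambda>n. t - (1 / 2) ^ n) \<longlonglongrightarrow> t - 0"
      by (intro tendsto_intros LIMSEQ_power_zero) simp
    then show "(\<lambda>n. t - (1 / 2) ^ n) \<longlonglongrightarrow> t" by simp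
    have "t - (1 / 2) ^ n \<le> real (k n) / 2 ^ n" for n
    proof -
      have "t \<le> (real (k n) + 1) / 2 ^ n" using k(2)[of n] by (simp add: pos_le_divide_eq)
      then show ?thesis by (simp add: add_divide_distrib power_one_over)
    qed
    then show "\<forall>\<^sub>F n in sequentially. t - (1 / 2) ^ n \<le> real (k n) / 2 ^ n" by simp
    show "\<forall>\<^sub>F n in sequentially. real (k n) / 2 ^ n \<le> t"
      using k(1) by (intro always_eventually allI) (simp add: field_simps)
  qed (rule tendsto_const)
  then show ?thesis
    by (intro op_le_limit[OF _ _ le] op_powr_tendsto A B)
qed

section \<open>Weighted geometric means of two operators\<close>

lemma positive_definite_scaleR:
  assumes "positive_definite A" "0 < r"
  shows "positive_definite (r *\<^sub>R A)"
proof -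
  obtain c where "self_adjoint A" "c > 0" "\<And>v. inner v (A $$ v) \<ge> c * (norm v)\<^sup>2"
    using assms unfolding positive_definite_def Re_cinner by blast
  then show ?thesis
    using assms(2) unfolding positive_definite_def Re_cinner
    by (auto intro!: self_adjoint_scaleR exI[of _ "r * c"] simp: mult.assoc)
qed

lemma positive_definite_bounded_below:
  assumes "positive_definite S"
  obtains d where "d > 0" "\<And>x. d * norm x \<le> norm (S $$ x)"
proof -
  obtain d where d: "d > 0" "\<And>v. inner v (S $$ v) \<ge> d * (norm v)\<^sup>2"
    using assms unfolding positive_definite_def Re_cinner by blast
  have "d * norm x \<le> norm (S $$ x)" for x
  proof (cases "x = 0")
    case False
    have "norm x * (d * norm x) \<le> norm x * norm (S $$ x)"
      using order_trans[OF d(2) norm_cauchy_schwarz, of x] by (simp add: power2_eq_square mult_ac)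
    then show ?thesis using False by (simp add: mult_le_cancel_left)
  qed simp
  with d(1) show ?thesis by (rule that)
qed

lemma positive_definite_congruence:
  assumes S: "positive_definite S" and A: "positive_definite A"
  shows "positive_definite (S * A * S)"
proof -
  obtain d where d: "d > 0" "\<And>x. d * norm x \<le> norm (S $$ x)"
    using positive_definite_bounded_below[OF S] by blast
  obtain c where c: "c > 0" "\<And>v. inner v (A $$ v) \<ge> c * (norm v)\<^sup>2"
    using A unfolding positive_definite_def Re_cinner by blast
  have "c * d\<^sup>2 * (norm x)\<^sup>2 \<le> inner x ((S * A * S) $$ x)" for x
  proof -
    have "(d * norm x)\<^sup>2 \<le> (norm (S $$ x))\<^sup>2"
      using d by (intro power_mono) (simp_all add: less_imp_le)
    then have "c * (d * norm x)\<^sup>2 \<le> c * (norm (S $$ x))\<^sup>2" using c(1) by simp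
    also have "\<dots> \<le> inner (S $$ x) (A $$ S $$ x)" by (rule c(2))
    also have "\<dots> = inner x ((S * A * S) $$ x)"
      using S by (simp add: positive_definite_self_adjoint self_adjointD)
    finally show ?thesis by (simp add: power_mult_distrib mult.assoc)
  qed
  then show ?thesis
    using c d S A unfolding positive_definite_def Re_cinner
    by (intro conjI self_adjoint_congruence exI[of _ "c * d\<^sup>2"]) auto
qed

lemma positive_definite_geo_mean:
  assumes "positive_definite A" "positive_definite B"
  shows "positive_definite (geo_mean A t B)"
  unfolding geo_mean_def
  by (intro positive_definite_congruence positive_definite_op_powr assms)

lemma positive_definite_one [simp]: "positive_definite 1"
  unfolding positive_definite_def Re_cinner
  by (auto intro!: exI[of _ 1] simp: power2_norm_eq_inner)

lemma op_powr_one [simp]: "op_powr 1 t = 1"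
proof -
  have "op_between 1 1 1" by (simp add: op_between_def power2_norm_eq_inner)
  then have "op_fun (\<lambda>x. x powr t) 1 = op_fun (\<lambda>x. 1) 1"
    by (rule op_fun_cong) (auto intro: continuous_on_powr_pos)
  then show ?thesis using op_fun_const[OF \<open>op_between 1 1 1\<close>, of 1] by (simp add: op_powr_def)
qed

text \<open>The equations with a trailing factor Z cancel inside right-nested products.\<close>

lemma op_powr_halves:
  assumes "positive_definite A"
  shows "op_powr A (1/2) * op_powr A (-1/2) = 1" "op_powr A (-1/2) * op_powr A (1/2) = 1"
    "op_powr A (1/2) * op_powr A (1/2) = A"
    "op_powr A (1/2) * (op_powr A (-1/2) * Z) = Z" "op_powr A (-1/2) * (op_powr A (1/2) * Z) = Z"
    "op_powr A (1/2) * (op_powr A (1/2) * Z) = A * Z"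
  using op_powr_cancel[OF assms, of "1/2"] op_powr_half_mult[OF assms, of 1] assms
  by (simp_all flip: mult.assoc)

lemma geo_mean_same:
  assumes "positive_definite A"
  shows "geo_mean A t A = A"
proof -
  have "op_powr A (-1/2) * A * op_powr A (-1/2)
      = op_powr A (-1/2) * (op_powr A (1/2) * op_powr A (1/2)) * op_powr A (-1/2)"
    by (simp only: op_powr_halves[OF assms])
  also have "\<dots> = 1"
    by (simp only: mult.assoc op_powr_halves(1,2,4,5)[OF assms])
  finally show ?thesis
    by (simp add: geo_mean_def op_powr_halves[OF assms])
qed

text \<open>X = A^(-1/2) B^(1/2) has right inverse Y and intertwines N with M, so M^t = X N^t Y. The
  outer factors collapse to B^(1/2) N^t B^(-1/2) A, where B^(-1/2) A = L B^(1/2). Since L is the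
  inverse of N, N^t L is L^(1-t).\<close>

lemma geo_mean_swap:
  assumes A: "positive_definite A" and B: "positive_definite B"
  shows "geo_mean A t B = geo_mean B (1 - t) A"
proof -
  define X where "X = op_powr A (-1/2) * op_powr B (1/2)"
  define Y where "Y = op_powr B (-1/2) * op_powr A (1/2)"
  define M where "M = op_powr A (-1/2) * B * op_powr A (-1/2)"
  define L where "L = op_powr B (-1/2) * A * op_powr B (-1/2)"
  define N where "N = op_powr B (1/2) * op_powr A (- 1) * op_powr B (1/2)"
  note hA = op_powr_halves[OF A] and hB = op_powr_halves[OF B]
  have pd: "positive_definite M" "positive_definite N"
    unfolding M_def N_def by (intro positive_definite_congruence positive_definite_op_powr A B)+
  have inv: "op_powr A (- 1) = op_powr A (-1/2) * op_powr A (-1/2)"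
    using op_powr_half_mult[OF A, of "-1"] by simp
  have AinvA: "op_powr A (- 1) * (A * Z) = Z" for Z
    using op_powr_cancel[OF A, of 1] A by (simp flip: mult.assoc)
  have XY: "X * Y = 1" unfolding X_def Y_def by (simp only: mult.assoc hA hB)
  have "X * N = op_powr A (-1/2) * (op_powr B (1/2) * op_powr B (1/2)) * op_powr A (- 1) * op_powr B (1/2)"
    by (simp add: X_def N_def mult.assoc)
  also have "\<dots> = M * X" unfolding M_def X_def hB inv by (simp add: mult.assoc)
  finally have "X * op_powr N t = op_powr M t * X"
    by (intro op_powr_intertwine pd)
  then have Mt: "op_powr M t = X * op_powr N t * Y"
    using XY by (metis mult.assoc mult.right_neutral)
  have "N * L = 1"
    unfolding N_def L_def by (simp only: mult.assoc hB AinvA)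
  then have L: "L = op_powr N (- 1)"
    using op_powr_cancel(2)[OF pd(2), of 1] pd(2) by (metis mult.assoc mult.left_neutral mult.right_neutral op_powr_1)
  have "geo_mean A t B = op_powr A (1/2) * (X * op_powr N t * Y) * op_powr A (1/2)"
    unfolding geo_mean_def Mt[unfolded M_def] ..
  also have "\<dots> = op_powr B (1/2) * op_powr N t * (op_powr B (-1/2) * A)"
    unfolding X_def Y_def by (simp only: mult.assoc hA)
  also have "op_powr B (-1/2) * A = L * op_powr B (1/2)"
    unfolding L_def by (simp only: mult.assoc hB mult_1_right)
  also have "op_powr B (1/2) * op_powr N t * (L * op_powr B (1/2))
      = op_powr B (1/2) * (op_powr N t * op_powr N (- 1)) * op_powr B (1/2)"
    by (simp add: L mult.assoc)
  also have "op_powr N t * op_powr N (- 1) = op_powr L (1 - t)"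
    unfolding L op_powr_add[OF pd(2)] op_powr_powr[OF pd(2)] by simp
  finally show ?thesis by (simp add: geo_mean_def L_def)
qed

lemma geo_mean_mono_right:
  assumes A: "positive_definite A" and B: "positive_definite B" and D: "positive_definite D"
    and "B \<preceq> D" "t \<in> {0..1}"
  shows "geo_mean A t B \<preceq> geo_mean A t D"
  unfolding geo_mean_def
  by (intro op_le_congruence op_powr_mono positive_definite_congruence positive_definite_op_powr
      self_adjoint_op_powr assms)

lemma geo_mean_scaleR_right:
  assumes A: "positive_definite A" and B: "positive_definite B" and "0 < r"
  shows "geo_mean A t (r *\<^sub>R B) = r powr t *\<^sub>R geo_mean A t B"
  unfolding geo_mean_def
  by (simp add: op_powr_scaleR positive_definite_congruence positive_definite_op_powr assms)

text \<open>
  \<open>near r A B\<close> says that the Thompson distance of \<open>A\<close> and \<open>B\<close> is at most \<open>r\<close>.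
\<close>

definition near :: "real \<Rightarrow> ell2_op \<Rightarrow> ell2_op \<Rightarrow> bool"
  where "near r A B \<longleftrightarrow> A \<preceq> exp r *\<^sub>R B \<and> B \<preceq> exp r *\<^sub>R A"

lemma near_refl: "near 0 A A"
  by (simp add: near_def)

lemma near_sym: "near r A B \<Longrightarrow> near r B A"
  by (simp add: near_def)

lemma near_trans:
  assumes "near r A B" "near s B C"
  shows "near (r + s) A C"
proof -
  have "A \<preceq> exp r *\<^sub>R exp s *\<^sub>R C" "C \<preceq> exp s *\<^sub>R exp r *\<^sub>R A"
    using assms unfolding near_def
    by (meson op_le_trans op_le_scaleR exp_ge_zero)+
  then show ?thesis by (simp add: near_def exp_add mult.commute)
qed

lemma near_mono:
  assumes "near r A B" "r \<le> s" "positive_definite A" "positive_definite B"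
  shows "near s A B"
proof -
  have *: "X \<preceq> exp s *\<^sub>R Y" if "X \<preceq> exp r *\<^sub>R Y" "positive_definite Y" for X Y
    unfolding op_le_def
  proof
    fix x
    have "0 \<le> inner x (Y $$ x)"
      using that(2) unfolding positive_definite_def Re_cinner
      by (meson mult_nonneg_nonneg order_trans less_imp_le zero_le_power2)
    then have "exp r * inner x (Y $$ x) \<le> exp s * inner x (Y $$ x)"
      using assms(2) by (intro mult_right_mono) auto
    with that(1) show "inner x (X $$ x) \<le> inner x ((exp s *\<^sub>R Y) $$ x)"
      by (auto simp: op_le_def dest!: spec[of _ x])
  qed
  show ?thesis using assms * by (simp add: near_def)
qed

lemma near_exists:
  assumes "positive_definite A" "positive_definite B"
  shows "\<exists>r\<ge>0. near r A B"
proof -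
  obtain c d where A: "0 < c" "c \<le> d" "op_between c d A" using positive_definite_between[OF assms(1)] .
  obtain c' d' where B: "0 < c'" "c' \<le> d'" "op_between c' d' B" using positive_definite_between[OF assms(2)] .
  have *: "X \<preceq> exp s *\<^sub>R Y"
    if "op_between a b X" "op_between a' b' Y" "0 < a'" "0 < a" "a \<le> b" "b / a' \<le> exp s" for a b a' b' X Y s
    unfolding op_le_def
  proof
    fix x
    have "inner x (X $$ x) \<le> b * (norm x)\<^sup>2" using that(1) by (simp add: op_between_def)
    also have "\<dots> \<le> exp s * a' * (norm x)\<^sup>2"
      using that by (intro mult_right_mono) (simp_all add: field_simps)
    also have "\<dots> \<le> exp s * inner x (Y $$ x)" using that(2) by (simp add: op_between_def mult.assoc)
    finally show "inner x (X $$ x) \<le> inner x ((exp s *\<^sub>R Y) $$ x)" by simp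
  qed
  \<comment> \<open>exp r dominates both quotients of extreme bounds; the outer maximum keeps the
    radius nonnegative.\<close>
  define r where "r = max 0 (max (ln (d / c')) (ln (d' / c)))"
  have "d / c' = exp (ln (d / c'))" "d' / c = exp (ln (d' / c))" using A B by simp_all
  then have "d / c' \<le> exp r" "d' / c \<le> exp r"
    unfolding r_def by (metis exp_le_cancel_iff max.cobounded1 max.cobounded2 order_trans)+
  then have "near r A B" unfolding near_def using A B by (auto intro: *)
  then show ?thesis by (intro exI[of _ r]) (simp add: r_def)
qed

lemma near_limit:
  assumes "X \<longlonglongrightarrow> A" "Y \<longlonglongrightarrow> B" "\<And>n. near r (X n) (Y n)"
  shows "near r A B"
  using assms unfolding near_def
  by (auto intro: op_le_limit[of X A "\<lambda>n. exp r *\<^sub>R Y n"] op_le_limit[of Y B "\<lambda>n. exp r *\<^sub>R X n"]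
      intro!: tendsto_intros)

text \<open>Monotonicity and homogeneity are known in the right argument only: B is replaced first,
  then the mean is swapped and A is replaced. The scalars exp s and exp r come out with the powers t
  and 1 - t.\<close>

lemma geo_mean_le:
  assumes pd: "positive_definite A" "positive_definite B" "positive_definite C" "positive_definite D"
    and t: "t \<in> {0..1}" and le: "A \<preceq> exp r *\<^sub>R C" "B \<preceq> exp s *\<^sub>R D"
  shows "geo_mean A t B \<preceq> exp ((1 - t) * r + t * s) *\<^sub>R geo_mean C t D"
proof -
  have "geo_mean A t B \<preceq> geo_mean A t (exp s *\<^sub>R D)"
    by (intro geo_mean_mono_right positive_definite_scaleR pd t le) simp
  moreover have "geo_mean A t (exp s *\<^sub>R D) = exp (t * s) *\<^sub>R geo_mean D (1 - t) A"
    by (simp add: geo_mean_scaleR_right pd exp_powr_real mult.commute geo_mean_swap[of A D])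
  moreover have "geo_mean D (1 - t) A \<preceq> geo_mean D (1 - t) (exp r *\<^sub>R C)"
    using t by (intro geo_mean_mono_right positive_definite_scaleR pd le) auto
  then have "exp (t * s) *\<^sub>R geo_mean D (1 - t) A
      \<preceq> exp (t * s) *\<^sub>R geo_mean D (1 - t) (exp r *\<^sub>R C)"
    by (rule op_le_scaleR) simp
  moreover have "geo_mean D (1 - t) (exp r *\<^sub>R C) = exp ((1 - t) * r) *\<^sub>R geo_mean C t D"
    by (simp add: geo_mean_scaleR_right pd exp_powr_real mult.commute geo_mean_swap[of C D])
  ultimately show ?thesis
    using op_le_trans by (simp add: exp_add mult.commute)
qed

lemma near_geo_mean:
  assumes "positive_definite A" "positive_definite B" "positive_definite C" "positive_definite D"
    and "t \<in> {0..1}" "near r A C" "near s B D"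
  shows "near ((1 - t) * r + t * s) (geo_mean A t B) (geo_mean C t D)"
  using assms geo_mean_le unfolding near_def by blast

text \<open>A - B lies between -(exp r - 1) A and (exp r - 1) B, and both forms are bounded by
  d.\<close>

lemma near_norm_le:
  assumes A: "op_between c d A" and B: "op_between c d B" and "0 < c" "0 \<le> r" and near: "near r A B"
  shows "norm (A - B) \<le> (exp r - 1) * d"
proof (rule norm_self_adjoint_le)
  show "self_adjoint (A - B)" using A B by (intro self_adjoint_diff) (auto simp: op_between_def)
  fix x
  have bounds: "0 \<le> inner x (X $$ x) \<and> inner x (X $$ x) \<le> d * (norm x)\<^sup>2" if "op_between c d X" for X
    using that \<open>0 < c\<close> unfolding op_between_def
    by (meson mult_nonneg_nonneg less_imp_le order_trans zero_le_power2)
  have le: "inner x (A $$ x) \<le> exp r * inner x (B $$ x)" "inner x (B $$ x) \<le> exp r * inner x (A $$ x)"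
    using near by (simp_all add: near_def op_le_def)
  have "(exp r - 1) * inner x (X $$ x) \<le> (exp r - 1) * (d * (norm x)\<^sup>2)" if "op_between c d X" for X
    using bounds[OF that] \<open>0 \<le> r\<close> by (intro mult_left_mono) auto
  from this[OF A] this[OF B] le show "\<bar>inner x ((A - B) $$ x)\<bar> \<le> (exp r - 1) * d * (norm x)\<^sup>2"
    by (simp add: inner_diff_right abs_le_iff algebra_simps)
qed

section \<open>Weighted means of several operators\<close>

lemma op_between_limit:
  assumes "X \<longlonglongrightarrow> A" "\<And>n. op_between c d (X n)"
  shows "op_between c d A"
  unfolding op_between_def
proof (intro conjI allI)
  show "self_adjoint A"
    by (rule self_adjoint_limit[OF assms(1)]) (use assms(2) in \<open>simp add: op_between_def\<close>)
  fix x
  have lim: "(\<lambda>n. inner x (X n $$ x)) \<longlonglongrightarrow> inner x (A $$ x)"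
    by (intro tendsto_intros tendsto_op_apply assms)
  show "c * (norm x)\<^sup>2 \<le> inner x (A $$ x)"
    by (rule LIMSEQ_le_const[OF lim]) (use assms(2) in \<open>auto simp: op_between_def\<close>)
  show "inner x (A $$ x) \<le> d * (norm x)\<^sup>2"
    by (rule LIMSEQ_le_const2[OF lim]) (use assms(2) in \<open>auto simp: op_between_def\<close>)
qed

lemma op_between_near:
  assumes A: "op_between c d A" and X: "self_adjoint X" and near: "near r X A"
  shows "op_between (c / exp r) (d * exp r) X"
  unfolding op_between_def
proof (intro conjI allI X)
  fix x
  have le: "inner x (X $$ x) \<le> exp r * inner x (A $$ x)" "inner x (A $$ x) \<le> exp r * inner x (X $$ x)"
    using near by (simp_all add: near_def op_le_def)
  have "c * (norm x)\<^sup>2 \<le> exp r * inner x (X $$ x)"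
    using A le(2) unfolding op_between_def by (meson order_trans)
  then show "c / exp r * (norm x)\<^sup>2 \<le> inner x (X $$ x)"
    by (simp add: pos_divide_le_eq mult.commute)
  have "exp r * inner x (A $$ x) \<le> exp r * (d * (norm x)\<^sup>2)"
    using A by (intro mult_left_mono) (auto simp: op_between_def)
  from order_trans[OF le(1) this] show "inner x (X $$ x) \<le> d * exp r * (norm x)\<^sup>2"
    by (simp only: mult_ac)
qed

section \<open>Probability vectors and tuples with one entry removed\<close>

definition prob_weights :: "nat \<Rightarrow> (nat \<Rightarrow> real) \<Rightarrow> bool"
  where "prob_weights p w \<longleftrightarrow> (\<forall>i\<in>{1..p}. 0 < w i) \<and> (\<Sum>i\<in>{1..p}. w i) = 1"

definition positive_tuple :: "nat \<Rightarrow> (nat \<Rightarrow> ell2_op) \<Rightarrow> bool"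
  where "positive_tuple p A \<longleftrightarrow> (\<forall>i\<in>{1..p}. positive_definite (A i))"

text \<open>The increasing enumeration of the indices other than i: \<open>omit i\<close> is
  composition with it, and sums over the shortened tuple become reindexings.\<close>

definition skip :: "nat \<Rightarrow> nat \<Rightarrow> nat"
  where "skip i j = (if j < i then j else Suc j)"

lemma omit_eq: "omit i x j = x (skip i j)"
  by (simp add: omit_def skip_def)

lemma bij_betw_skip: "i \<in> {1..Suc p} \<Longrightarrow> bij_betw (skip i) {1..p} ({1..Suc p} - {i})"
  by (rule bij_betw_byWitness[of _ "\<lambda>j. if j < i then j else j - 1"]) (auto simp: skip_def)

lemma skip_in: "i \<in> {1..Suc p} \<Longrightarrow> j \<in> {1..p} \<Longrightarrow> skip i j \<in> {1..Suc p}"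
  by (auto simp: skip_def)

lemma sum_omit:
  fixes f :: "nat \<Rightarrow> 'a::comm_monoid_add"
  assumes "i \<in> {1..Suc p}"
  shows "f i + (\<Sum>j\<in>{1..p}. f (skip i j)) = (\<Sum>j\<in>{1..Suc p}. f j)"
  using sum.reindex_bij_betw[OF bij_betw_skip[OF assms], of f] sum.remove[of "{1..Suc p}" i f] assms
  by simp

lemma prod_omit:
  fixes f :: "nat \<Rightarrow> 'a::comm_monoid_mult"
  assumes "i \<in> {1..Suc p}"
  shows "f i * (\<Prod>j\<in>{1..p}. f (skip i j)) = (\<Prod>j\<in>{1..Suc p}. f j)"
  using prod.reindex_bij_betw[OF bij_betw_skip[OF assms], of f] prod.remove[of "{1..Suc p}" i f] assms
  by simp

lemma prob_weights_less_1:
  assumes "prob_weights (Suc p) w" "1 \<le> p" "i \<in> {1..Suc p}"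
  shows "0 < w i" "w i < 1"
proof -
  show "0 < w i" using assms by (simp add: prob_weights_def)
  have "0 < (\<Sum>j\<in>{1..p}. w (skip i j))"
    using assms skip_in[OF assms(3)] by (intro sum_pos) (auto simp: prob_weights_def)
  then show "w i < 1"
    using sum_omit[OF assms(3), of w] assms(1) by (simp add: prob_weights_def)
qed

lemma prob_weights_omit:
  assumes "prob_weights (Suc p) w" "1 \<le> p" "i \<in> {1..Suc p}"
  shows "prob_weights p (\<lambda>j. omit i w j / (1 - w i))"
proof -
  have "w i < 1" using prob_weights_less_1[OF assms] by simp
  moreover have "(\<Sum>j\<in>{1..p}. w (skip i j)) = 1 - w i"
    using sum_omit[OF assms(3), of w] assms(1) by (simp add: prob_weights_def)
  ultimately show ?thesis
    using assms skip_in[OF assms(3)]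
    by (auto simp: prob_weights_def omit_eq simp flip: sum_divide_distrib)
qed

lemma positive_tuple_omit:
  "positive_tuple (Suc p) A \<Longrightarrow> i \<in> {1..Suc p} \<Longrightarrow> positive_tuple p (omit i A)"
  using skip_in[of i p] by (auto simp: positive_tuple_def omit_eq)

text \<open>The invariant that the limit construction passes from p to p + 1 operators: positivity,
  weighted contraction in the Thompson metric, and idempotence. It speaks of probability weights and
  positive tuples only, where the \<open>THE\<close> in \<open>weighted_mean\<close> is shown to
  describe an operator.\<close>

definition good_mean :: "nat \<Rightarrow> ((nat \<Rightarrow> real) \<Rightarrow> (nat \<Rightarrow> ell2_op) \<Rightarrow> ell2_op) \<Rightarrow> bool"
  where "good_mean p M \<longleftrightarrow>
    (\<forall>w A. prob_weights p w \<longrightarrow> positive_tuple p A \<longrightarrow> positive_definite (M w A)) \<and>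
    (\<forall>w A B r. prob_weights p w \<longrightarrow> positive_tuple p A \<longrightarrow> positive_tuple p B \<longrightarrow>
      (\<forall>i\<in>{1..p}. near (r i) (A i) (B i)) \<longrightarrow> near (\<Sum>i\<in>{1..p}. w i * r i) (M w A) (M w B)) \<and>
    (\<forall>w A X. prob_weights p w \<longrightarrow> positive_definite X \<longrightarrow> (\<forall>i\<in>{1..p}. A i = X) \<longrightarrow> M w A = X)"

definition mean_step ::
  "((nat \<Rightarrow> real) \<Rightarrow> (nat \<Rightarrow> ell2_op) \<Rightarrow> ell2_op) \<Rightarrow> (nat \<Rightarrow> real) \<Rightarrow> (nat \<Rightarrow> ell2_op) \<Rightarrow> nat \<Rightarrow> ell2_op"
  where "mean_step M w A i =
    geo_mean (A i) (1 - w i) (M (\<lambda>j. omit i w j / (1 - w i)) (omit i A))"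

lemma mean_iter_Suc: "mean_iter M w A (Suc k) = mean_step M w (mean_iter M w A k)"
  by (simp add: mean_step_def fun_eq_iff)

text \<open>One level of the recursion: M is an abstract mean of p operators and the tuples have
  length p + 1. With p at least 1 each weight is less than 1, so the normalized weights make
  sense.\<close>

locale mean_iteration =
  fixes p :: nat and M and w :: "nat \<Rightarrow> real"
  assumes good: "good_mean p M" and p: "1 \<le> p" and w: "prob_weights (Suc p) w"
begin

lemma w_pos: "i \<in> {1..Suc p} \<Longrightarrow> 0 < w i" and w_less_1: "i \<in> {1..Suc p} \<Longrightarrow> w i < 1"
  using prob_weights_less_1[OF w p] by blast+

lemma sum_w: "(\<Sum>i\<in>{1..Suc p}. w i) = 1"
  using w by (simp add: prob_weights_def)

lemma positive_mean_omit:
  assumes "positive_tuple (Suc p) A" "i \<in> {1..Suc p}"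
  shows "positive_definite (M (\<lambda>j. omit i w j / (1 - w i)) (omit i A))"
  using good prob_weights_omit[OF w p assms(2)] positive_tuple_omit[OF assms]
  unfolding good_mean_def by blast

lemma positive_mean_step:
  "positive_tuple (Suc p) A \<Longrightarrow> positive_tuple (Suc p) (mean_step M w A)"
  unfolding positive_tuple_def[of _ "mean_step M w A"] mean_step_def
  by (auto intro!: positive_definite_geo_mean positive_mean_omit) (simp add: positive_tuple_def)

text \<open>The factor 1 - w i of the outer mean cancels the normalization of the inner weights, so
  every component i obeys the same bound.\<close>

lemma near_mean_step:
  assumes A: "positive_tuple (Suc p) A" and B: "positive_tuple (Suc p) B"
    and near: "\<And>i. i \<in> {1..Suc p} \<Longrightarrow> near (r i) (A i) (B i)" and i: "i \<in> {1..Suc p}"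
  shows "near (\<Sum>j\<in>{1..Suc p}. w j * r j) (mean_step M w A i) (mean_step M w B i)"
proof -
  let ?w = "\<lambda>j. omit i w j / (1 - w i)"
  have "\<forall>j\<in>{1..p}. near (omit i r j) (omit i A j) (omit i B j)"
    using near skip_in[OF i] by (simp add: omit_eq)
  then have "near (\<Sum>j\<in>{1..p}. ?w j * omit i r j) (M ?w (omit i A)) (M ?w (omit i B))"
    using good prob_weights_omit[OF w p i] positive_tuple_omit[OF A i] positive_tuple_omit[OF B i]
    unfolding good_mean_def by blast
  then have "near ((1 - (1 - w i)) * r i + (1 - w i) * (\<Sum>j\<in>{1..p}. ?w j * omit i r j))
      (mean_step M w A i) (mean_step M w B i)"
    unfolding mean_step_def using A B i w_pos[OF i] w_less_1[OF i]
    by (intro near_geo_mean positive_mean_omit near) (auto simp: positive_tuple_def)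
  also have "(1 - (1 - w i)) * r i + (1 - w i) * (\<Sum>j\<in>{1..p}. ?w j * omit i r j)
      = w i * r i + (\<Sum>j\<in>{1..p}. w (skip i j) * r (skip i j))"
    using w_less_1[OF i] by (simp add: sum_distrib_left omit_eq)
  finally show ?thesis by (simp only: sum_omit[OF i, of "\<lambda>j. w j * r j"])
qed

lemma mean_step_const:
  assumes "positive_definite X" "\<And>i. i \<in> {1..Suc p} \<Longrightarrow> A i = X" "i \<in> {1..Suc p}"
  shows "mean_step M w A i = X"
proof -
  have "\<forall>j\<in>{1..p}. omit i A j = X" using assms skip_in[OF assms(3)] by (simp add: omit_eq)
  then have "M (\<lambda>j. omit i w j / (1 - w i)) (omit i A) = X"
    using good prob_weights_omit[OF w p assms(3)] assms(1) unfolding good_mean_def by blast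
  then show ?thesis using assms by (simp add: mean_step_def geo_mean_same)
qed

text \<open>X is regarded as a constant tuple, which a step leaves fixed.\<close>

lemma near_mean_step_const:
  assumes A: "positive_tuple (Suc p) A" and X: "positive_definite X"
    and near: "\<And>j. j \<in> {1..Suc p} \<Longrightarrow> near (r j) X (A j)" and i: "i \<in> {1..Suc p}"
  shows "near (\<Sum>j\<in>{1..Suc p}. w j * r j) X (mean_step M w A i)"
  using near_mean_step[of "\<lambda>_. X" A r i] mean_step_const[OF X, of "\<lambda>_. X" i] assms
  by (simp add: positive_tuple_def)

definition rate :: real
  where "rate = (\<Sum>j\<in>{1..Suc p}. w j * (1 - w j))"

lemma rate_bounds: "0 \<le> rate" "rate < 1"
proof -
  show "0 \<le> rate"
    unfolding rate_def
    using w_pos w_less_1 by (intro sum_nonneg mult_nonneg_nonneg) (auto simp: less_imp_le)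
  have "rate < (\<Sum>j\<in>{1..Suc p}. w j)"
    unfolding rate_def by (rule sum_strict_mono) (use w_pos in \<open>auto simp: algebra_simps\<close>)
  then show "rate < 1" by (simp only: sum_w)
qed

lemma near_step_old:
  assumes A: "positive_tuple (Suc p) A"
    and near: "\<And>i j. i \<in> {1..Suc p} \<Longrightarrow> j \<in> {1..Suc p} \<Longrightarrow> near r (A i) (A j)"
    and i: "i \<in> {1..Suc p}" and j: "j \<in> {1..Suc p}"
  shows "near ((1 - w j) * r) (A j) (mean_step M w A i)"
proof -
  \<comment> \<open>A j has distance 0 from itself, which saves the summand w j r.\<close>
  define s where "s l = (if l = j then 0 else r)" for l
  have "near (s l) (A j) (A l)" if "l \<in> {1..Suc p}" for l
    using near[OF j that] near_refl by (auto simp: s_def)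
  then have "near (\<Sum>l\<in>{1..Suc p}. w l * s l) (A j) (mean_step M w A i)"
    using A i j by (intro near_mean_step_const) (auto simp: positive_tuple_def)
  also have "(\<Sum>l\<in>{1..Suc p}. w l * s l) = (\<Sum>l\<in>{1..Suc p}. w l * r - (if l = j then w l * r else 0))"
    by (rule sum.cong) (auto simp: s_def)
  also have "\<dots> = (\<Sum>l\<in>{1..Suc p}. w l) * r - w j * r"
    using j by (simp only: sum_subtractf sum_distrib_right sum.delta finite_atLeastAtMost if_True)
  also have "\<dots> = (1 - w j) * r" by (simp only: sum_w left_diff_distrib)
  finally show ?thesis .
qed

text \<open>
  With \<open>d\<close> the Thompson metric, \<open>d(X, A\<^sub>i') \<le> \<Sum>\<^sub>j w\<^sub>j d(X, A\<^sub>j)\<close> for every \<open>X\<close>; applying this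
  to \<open>X = A\<^sub>k'\<close> and once more to \<open>X = A\<^sub>j\<close> shrinks the diameter of the tuple by the factor
  \<open>\<Sum>\<^sub>j w\<^sub>j (1 - w\<^sub>j)\<close>.
\<close>

lemma near_step_step:
  assumes A: "positive_tuple (Suc p) A"
    and near: "\<And>i j. i \<in> {1..Suc p} \<Longrightarrow> j \<in> {1..Suc p} \<Longrightarrow> near r (A i) (A j)"
    and i: "i \<in> {1..Suc p}" and k: "k \<in> {1..Suc p}"
  shows "near (rate * r) (mean_step M w A k) (mean_step M w A i)"
proof -
  have "near ((1 - w j) * r) (mean_step M w A k) (A j)" if "j \<in> {1..Suc p}" for j
    using near_step_old[OF A near k that] by (rule near_sym)
  then have "near (\<Sum>j\<in>{1..Suc p}. w j * ((1 - w j) * r)) (mean_step M w A k) (mean_step M w A i)"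
    using positive_mean_step[OF A] k
    by (intro near_mean_step_const A i) (auto simp: positive_tuple_def)
  then show ?thesis by (simp only: rate_def sum_distrib_right mult.assoc)
qed

context
  fixes A :: "nat \<Rightarrow> ell2_op"
  assumes A: "positive_tuple (Suc p) A"
begin

lemma positive_mean_iter: "positive_tuple (Suc p) (mean_iter M w A k)"
  by (induction k) (simp add: A, simp only: mean_iter_Suc positive_mean_step)

lemma diameter_exists:
  "\<exists>r\<ge>0. \<forall>i\<in>{1..Suc p}. \<forall>j\<in>{1..Suc p}. near r (A i) (A j)"
proof -
  have "\<forall>z\<in>{1..Suc p} \<times> {1..Suc p}. \<exists>r\<ge>0. near r (A (fst z)) (A (snd z))"
    using A by (auto intro!: near_exists simp: positive_tuple_def)
  then obtain r where r: "\<And>z. z \<in> {1..Suc p} \<times> {1..Suc p} \<Longrightarrow> 0 \<le> r z \<and> near (r z) (A (fst z)) (A (snd z))"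
    by metis
  define R where "R = (\<Sum>z\<in>{1..Suc p} \<times> {1..Suc p}. r z)"
  have "0 \<le> R" unfolding R_def using r by (intro sum_nonneg) auto
  moreover have "near R (A i) (A j)" if "i \<in> {1..Suc p}" "j \<in> {1..Suc p}" for i j
  proof (rule near_mono)
    show "near (r (i, j)) (A i) (A j)" using r[of "(i, j)"] that by simp
    show "r (i, j) \<le> R" unfolding R_def using that r by (intro member_le_sum) auto
  qed (use A that in \<open>auto simp: positive_tuple_def\<close>)
  ultimately show ?thesis by blast
qed

lemma near_iter:
  assumes "\<And>i j. i \<in> {1..Suc p} \<Longrightarrow> j \<in> {1..Suc p} \<Longrightarrow> near r (A i) (A j)"
    and "i \<in> {1..Suc p}" "j \<in> {1..Suc p}"
  shows "near (rate ^ k * r) (mean_iter M w A k i) (mean_iter M w A k j)"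
  using assms(2,3)
proof (induction k arbitrary: i j)
  case (Suc k)
  show ?case
    unfolding mean_iter_Suc power_Suc mult.assoc
    using Suc by (intro near_step_step positive_mean_iter) auto
qed (use assms(1) in simp)

lemma near_iter_Suc:
  assumes "\<And>i j. i \<in> {1..Suc p} \<Longrightarrow> j \<in> {1..Suc p} \<Longrightarrow> near r (A i) (A j)" "0 \<le> r" "i \<in> {1..Suc p}"
  shows "near (rate ^ k * r) (mean_iter M w A k i) (mean_iter M w A (Suc k) i)"
proof (rule near_mono)
  show "near ((1 - w i) * (rate ^ k * r)) (mean_iter M w A k i) (mean_iter M w A (Suc k) i)"
    unfolding mean_iter_Suc
    using assms by (intro near_step_old positive_mean_iter near_iter) auto
  show "(1 - w i) * (rate ^ k * r) \<le> rate ^ k * r"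
    using w_pos[OF assms(3)] w_less_1[OF assms(3)] rate_bounds assms(2)
    by (intro mult_left_le_one_le) auto
qed (use positive_mean_iter assms(3) in \<open>auto simp: positive_tuple_def simp del: mean_iter.simps\<close>)

lemma near_iter_0:
  assumes "\<And>i j. i \<in> {1..Suc p} \<Longrightarrow> j \<in> {1..Suc p} \<Longrightarrow> near r (A i) (A j)" "0 \<le> r" "i \<in> {1..Suc p}"
  shows "near (\<Sum>m<k. rate ^ m * r) (A i) (mean_iter M w A k i)"
proof (induction k)
  case (Suc k)
  then show ?case
    using near_trans[OF Suc near_iter_Suc[OF assms]] by (simp del: mean_iter.simps)
qed (simp add: near_refl)

text \<open>The total drift from A i is at most the geometric sum R = r / (1 - rate), so all
  iterates keep the enclosure of A i up to a factor exp R.\<close>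

lemma mean_iter_uniform_bounds:
  assumes i: "i \<in> {1..Suc p}"
  obtains c d where "0 < c" "\<And>k. op_between c d (mean_iter M w A k i)"
proof -
  obtain r where r: "0 \<le> r" "\<And>i j. i \<in> {1..Suc p} \<Longrightarrow> j \<in> {1..Suc p} \<Longrightarrow> near r (A i) (A j)"
    using diameter_exists by blast
  have pd: "positive_definite (A i)" using A i by (simp add: positive_tuple_def)
  then obtain c d where cd: "0 < c" "c \<le> d" "op_between c d (A i)"
    using positive_definite_between by blast
  define R where "R = r / (1 - rate)"
  have sums: "(\<lambda>m. rate ^ m * r) sums R"
    using sums_mult2[OF geometric_sums[of rate], of r] rate_bounds by (simp add: R_def)
  have "op_between (c / exp R) (d * exp R) (mean_iter M w A k i)" for k
  proof -
    have pdk: "positive_definite (mean_iter M w A k i)"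
      using positive_mean_iter i by (auto simp: positive_tuple_def)
    have "(\<Sum>m<k. rate ^ m * r) \<le> R"
      using sum_le_suminf[OF sums_summable[OF sums], of "{..<k}"] sums_unique[OF sums] rate_bounds r
      by simp
    with near_iter_0[OF r(2,1) i] have "near R (A i) (mean_iter M w A k i)"
      using pd pdk by (rule near_mono)
    then show ?thesis
      by (rule op_between_near[OF cd(3) positive_definite_self_adjoint[OF pdk] near_sym])
  qed
  then show ?thesis using cd by (intro that[of "c / exp R"]) auto
qed

text \<open>With uniform bounds, consecutive iterates differ in norm by a multiple of rate^k, so the
  first component converges. The other components follow because the diameter of the tuple shrinks
  at the same rate.\<close>

theorem mean_iter_converges:
  "\<exists>L. positive_definite L \<and> (\<forall>i\<in>{1..Suc p}. (\<lambda>k. mean_iter M w A k i) \<longlonglongrightarrow> L)"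
proof -
  obtain r where r: "0 \<le> r" "\<And>i j. i \<in> {1..Suc p} \<Longrightarrow> j \<in> {1..Suc p} \<Longrightarrow> near r (A i) (A j)"
    using diameter_exists by blast
  have "\<forall>i. \<exists>c d. i \<in> {1..Suc p} \<longrightarrow> 0 < c \<and> (\<forall>k. op_between c d (mean_iter M w A k i))"
    using mean_iter_uniform_bounds by metis
  then obtain c d where cd: "\<And>i. i \<in> {1..Suc p} \<Longrightarrow> 0 < c i"
      "\<And>i k. i \<in> {1..Suc p} \<Longrightarrow> op_between (c i) (d i) (mean_iter M w A k i)"
    by metis
  \<comment> \<open>Bounds common to all components and all k, so that one constant serves every
    norm estimate.\<close>
  define C D where "C = Min (c ` {1..Suc p})" and "D = Max (d ` {1..Suc p})"
  have "0 < C" unfolding C_def using cd(1) by (subst Min_gr_iff) auto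
  have bd: "op_between C D (mean_iter M w A k i)" if "i \<in> {1..Suc p}" for i k
    by (rule op_between_mono[OF cd(2)[OF that]]) (use that in \<open>auto simp: C_def D_def\<close>)
  have "0 \<le> D" using op_between_le[OF bd[of 1]] \<open>0 < C\<close> by simp
  \<comment> \<open>From 1 - u \<le> exp (- u) follows exp u - 1 \<le> u exp u; as u is at most r,
    the bound is linear in rate^k.\<close>
  have exp_bound: "exp (rate ^ k * r) - 1 \<le> rate ^ k * (r * exp r)" for k
  proof -
    define u where "u = rate ^ k * r"
    have "rate ^ k \<le> 1" using rate_bounds by (simp add: power_le_one)
    then have u: "0 \<le> u" "u \<le> r" unfolding u_def using rate_bounds r by (auto simp: mult_left_le_one_le)
    have "1 \<le> exp u * exp (- u)" by (simp flip: exp_add)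
    have "exp u * (1 - u) \<le> exp u * exp (- u)"
      using exp_ge_add_one_self[of "- u"] by (intro mult_left_mono) auto
    also have "\<dots> = 1" by (simp flip: exp_add)
    finally have "exp u - 1 \<le> u * exp u" by (simp add: algebra_simps)
    also have "\<dots> \<le> u * exp r" using u by (intro mult_left_mono) auto
    finally show ?thesis by (simp add: u_def mult.assoc)
  qed
  have norm_le: "norm (X - Y) \<le> rate ^ k * (r * exp r * D)"
    if "near (rate ^ k * r) X Y" "op_between C D X" "op_between C D Y" for X Y k
  proof -
    have "norm (X - Y) \<le> (exp (rate ^ k * r) - 1) * D"
      using that \<open>0 < C\<close> rate_bounds r by (intro near_norm_le) auto
    also have "\<dots> \<le> rate ^ k * (r * exp r) * D"
      by (intro mult_right_mono exp_bound) fact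
    finally show ?thesis by (simp add: mult.assoc)
  qed
  have null: "(\<lambda>k. rate ^ k * (r * exp r * D)) \<longlonglongrightarrow> 0"
    using tendsto_mult_right[OF LIMSEQ_power_zero[of rate]] rate_bounds by simp
  have "\<exists>L. (\<lambda>k. mean_iter M w A k 1) \<longlonglongrightarrow> L"
  proof -
    have "summable (\<lambda>k. mean_iter M w A (Suc k) 1 - mean_iter M w A k 1)"
    proof (rule summable_comparison_test')
      show "summable (\<lambda>k. rate ^ k * (r * exp r * D))"
        using rate_bounds by (intro summable_mult2 summable_geometric) simp
      fix k
      show "norm (mean_iter M w A (Suc k) 1 - mean_iter M w A k 1) \<le> rate ^ k * (r * exp r * D)"
        by (intro norm_le near_sym[OF near_iter_Suc] bd r) auto
    qed
    then obtain l where "(\<lambda>n. \<Sum>k<n. mean_iter M w A (Suc k) 1 - mean_iter M w A k 1) \<longlonglongrightarrow> l"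
      using summable_LIMSEQ by blast
    then have "(\<lambda>n. mean_iter M w A n 1 - A 1) \<longlonglongrightarrow> l"
      by (simp only: sum_lessThan_telescope[of "\<lambda>n. mean_iter M w A n 1"] mean_iter.simps(1))
    from tendsto_add[OF this tendsto_const[of "A 1"]] show ?thesis by auto
  qed
  then obtain L where L: "(\<lambda>k. mean_iter M w A k 1) \<longlonglongrightarrow> L" by blast
  have "(\<lambda>k. mean_iter M w A k i) \<longlonglongrightarrow> L" if i: "i \<in> {1..Suc p}" for i
  proof -
    have "(\<lambda>k. mean_iter M w A k i - mean_iter M w A k 1) \<longlonglongrightarrow> 0"
    proof (rule Lim_null_comparison[OF _ null], rule always_eventually, rule allI)
      fix k
      show "norm (mean_iter M w A k i - mean_iter M w A k 1) \<le> rate ^ k * (r * exp r * D)"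
        by (intro norm_le near_iter bd r i) auto
    qed
    from tendsto_add[OF this L] show ?thesis by simp
  qed
  moreover have "op_between C D L" by (rule op_between_limit[OF L]) (simp add: bd)
  then have "positive_definite L" using \<open>0 < C\<close> by (auto simp: positive_definite_iff_between)
  ultimately show ?thesis by blast
qed

end

text \<open>Copies the recursive clause of \<open>weighted_mean\<close> for an abstract M, so that
  both agree by unfolding.\<close>

definition limit_mean :: "(nat \<Rightarrow> ell2_op) \<Rightarrow> ell2_op"
  where "limit_mean A = (THE L. positive_definite L \<and>
    (\<forall>i\<in>{1..Suc p}. (\<lambda>k. mean_iter M w A k i) \<longlonglongrightarrow> L))"

lemma limit_mean_eq:
  assumes "positive_definite L" "\<And>i. i \<in> {1..Suc p} \<Longrightarrow> (\<lambda>k. mean_iter M w A k i) \<longlonglongrightarrow> L"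
  shows "limit_mean A = L"
  unfolding limit_mean_def
proof (rule the_equality)
  fix L' assume "positive_definite L' \<and> (\<forall>i\<in>{1..Suc p}. (\<lambda>k. mean_iter M w A k i) \<longlonglongrightarrow> L')"
  then have "(\<lambda>k. mean_iter M w A k 1) \<longlonglongrightarrow> L'" by auto
  moreover have "(\<lambda>k. mean_iter M w A k 1) \<longlonglongrightarrow> L" using assms by auto
  ultimately show "L' = L" by (rule LIMSEQ_unique)
qed (use assms in auto)

lemma limit_mean:
  assumes "positive_tuple (Suc p) A"
  shows "positive_definite (limit_mean A)"
    "i \<in> {1..Suc p} \<Longrightarrow> (\<lambda>k. mean_iter M w A k i) \<longlonglongrightarrow> limit_mean A"
  using mean_iter_converges[OF assms] limit_mean_eq by metis+

lemma near_limit_mean: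
  assumes A: "positive_tuple (Suc p) A" and B: "positive_tuple (Suc p) B"
    and near: "\<And>i. i \<in> {1..Suc p} \<Longrightarrow> near (r i) (A i) (B i)"
  shows "near (\<Sum>j\<in>{1..Suc p}. w j * r j) (limit_mean A) (limit_mean B)"
proof -
  let ?R = "\<Sum>j\<in>{1..Suc p}. w j * r j"
  \<comment> \<open>The first step gives all components the common distance ?R, and later steps keep
    it because the weights sum to 1. At index 0 the distances r i still differ.\<close>
  have *: "near ?R (mean_iter M w A (Suc k) i) (mean_iter M w B (Suc k) i)" if "i \<in> {1..Suc p}" for i k
    using that
  proof (induction k arbitrary: i)
    case 0
    then show ?case
      unfolding mean_iter_Suc mean_iter.simps(1) by (intro near_mean_step A B near)
  next
    case (Suc k)
    have "near (\<Sum>j\<in>{1..Suc p}. w j * ?R) (mean_iter M w A (Suc (Suc k)) i) (mean_iter M w B (Suc (Suc k)) i)"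
      unfolding mean_iter_Suc[of _ _ _ "Suc k"]
      by (intro near_mean_step positive_mean_iter A B Suc)
    also have "(\<Sum>j\<in>{1..Suc p}. w j * ?R) = (\<Sum>j\<in>{1..Suc p}. w j) * ?R"
      by (rule sum_distrib_right[symmetric])
    finally show ?case by (simp only: sum_w mult_1)
  qed
  show ?thesis
    by (rule near_limit[OF LIMSEQ_Suc[OF limit_mean(2)[OF A, of 1]] LIMSEQ_Suc[OF limit_mean(2)[OF B, of 1]] *])
      auto
qed

lemma limit_mean_const:
  assumes "positive_definite X" "\<And>i. i \<in> {1..Suc p} \<Longrightarrow> A i = X"
  shows "limit_mean A = X"
proof (rule limit_mean_eq)
  fix i assume "i \<in> {1..Suc p}"
  then have "mean_iter M w A k i = X" for k
  proof (induction k arbitrary: i)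
    case (Suc k)
    then show ?case
      unfolding mean_iter_Suc by (intro mean_step_const assms(1)) auto
  qed (use assms in simp)
  then show "(\<lambda>k. mean_iter M w A k i) \<longlonglongrightarrow> X" by simp
qed fact

end

lemma good_mean_limit:
  assumes "good_mean p M" "1 \<le> p"
  shows "good_mean (Suc p) (\<lambda>w A. mean_iteration.limit_mean p M w A)"
proof -
  have "mean_iteration p M w" if "prob_weights (Suc p) w" for w
    using assms that by (simp add: mean_iteration_def)
  then show ?thesis
    unfolding good_mean_def
    using mean_iteration.limit_mean(1) mean_iteration.near_limit_mean mean_iteration.limit_mean_const
    by (intro conjI allI impI) blast+
qed

lemma weighted_mean_Suc:
  assumes "2 \<le> p"
  shows "weighted_mean (Suc p) w A =
    (THE L. positive_definite L \<and>
      (\<forall>i\<in>{1..Suc p}. (\<lambda>k. mean_iter (weighted_mean p) w A k i) \<longlonglongrightarrow> L))"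
proof -
  obtain n where n: "p = Suc (Suc n)" using assms by (metis Suc_le_D numeral_2_eq_2 Suc_le_mono)
  show ?thesis unfolding n by (simp add: eval_nat_numeral)
qed

lemma good_mean_2: "good_mean 2 (weighted_mean 2)"
proof -
  have 12: "{1..2} = {1, 2::nat}" by auto
  have wm: "weighted_mean 2 w A = geo_mean (A 1) (w 2) (A 2)" for w A
    by (simp add: eval_nat_numeral)
  have w: "prob_weights 2 w \<longleftrightarrow> 0 < w 1 \<and> 0 < w 2 \<and> w 1 = 1 - w 2" for w
    unfolding prob_weights_def 12 by auto
  show ?thesis
    unfolding good_mean_def wm w positive_tuple_def 12
  proof (intro conjI allI impI)
    fix w r :: "nat \<Rightarrow> real" and A B
    assume "0 < w 1 \<and> 0 < w 2 \<and> w 1 = 1 - w 2" "\<forall>i\<in>{1, 2}. positive_definite (A i)"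
      "\<forall>i\<in>{1, 2}. positive_definite (B i)" "\<forall>i\<in>{1, 2}. near (r i) (A i) (B i)"
    then show "near (\<Sum>i\<in>{1, 2}. w i * r i) (geo_mean (A 1) (w 2) (A 2)) (geo_mean (B 1) (w 2) (B 2))"
      using near_geo_mean[of "A 1" "A 2" "B 1" "B 2" "w 2" "r 1" "r 2"] by simp
  qed (auto intro: positive_definite_geo_mean simp: geo_mean_same)
qed

lemma good_mean_weighted_mean: "2 \<le> p \<Longrightarrow> good_mean p (weighted_mean p)"
proof (induction p rule: dec_induct)
  case base
  show ?case by (rule good_mean_2)
next
  case (step p)
  then have lim: "good_mean (Suc p) (\<lambda>w A. mean_iteration.limit_mean p (weighted_mean p) w A)"
    by (intro good_mean_limit) auto
  have "weighted_mean (Suc p) w A = mean_iteration.limit_mean p (weighted_mean p) w A"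
    if "prob_weights (Suc p) w" for w A
  proof -
    interpret mean_iteration p "weighted_mean p" w
      using step that by unfold_locales auto
    show ?thesis using step by (simp only: weighted_mean_Suc limit_mean_def)
  qed
  with lim show ?case unfolding good_mean_def by simp
qed

section \<open>Compact operators and matrix entries\<close>

text \<open>A closed subset of \<open>ell2\<close> is complete, so compactness of the closure is
  total boundedness, and an e/2-net of the image is an e-net of its closure.\<close>

lemma compact_op_iff_totally_bounded:
  "compact_op K \<longleftrightarrow> (\<forall>e>0. \<exists>F. finite F \<and> op_apply K ` cball 0 1 \<subseteq> (\<Union>x\<in>F. ball x e))"
    (is "_ \<longleftrightarrow> ?R")
proof
  assume "compact_op K"
  then show ?R
    unfolding compact_op_def compact_eq_totally_bounded using closure_subset by (meson order_trans)
next
  assume R: ?R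
  show "compact_op K"
    unfolding compact_op_def compact_eq_totally_bounded
  proof (intro conjI allI impI)
    show "complete (closure (op_apply K ` cball 0 1))" by (simp add: complete_eq_closed)
    fix e :: real assume "e > 0"
    then obtain F where F: "finite F" "op_apply K ` cball 0 1 \<subseteq> (\<Union>x\<in>F. ball x (e / 2))"
      using R half_gt_zero by meson
    have "closure (op_apply K ` cball 0 1) \<subseteq> (\<Union>x\<in>F. ball x e)"
    proof
      fix y assume "y \<in> closure (op_apply K ` cball 0 1)"
      then obtain z where "z \<in> op_apply K ` cball 0 1" "dist z y < e / 2"
        using \<open>e > 0\<close> closure_approachable half_gt_zero by metis
      then obtain x where x: "x \<in> F" "dist x z < e / 2" using F(2) by auto
      with \<open>dist z y < e / 2\<close> have "dist x y < e"
        using dist_triangle[of x y z] by linarith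
      then show "y \<in> (\<Union>x\<in>F. ball x e)" using x by auto
    qed
    with F(1) show "\<exists>F. finite F \<and> closure (op_apply K ` cball 0 1) \<subseteq> (\<Union>x\<in>F. ball x e)" by blast
  qed
qed

lemma compact_opI:
  assumes "\<And>e. e > 0 \<Longrightarrow> \<exists>F. finite F \<and> (\<forall>x. norm x \<le> 1 \<longrightarrow> (\<exists>y\<in>F. dist y (K $$ x) < e))"
  shows "compact_op K"
  unfolding compact_op_iff_totally_bounded
proof (intro allI impI)
  fix e :: real assume "e > 0"
  then obtain F where F: "finite F" "\<And>x. norm x \<le> 1 \<Longrightarrow> \<exists>y\<in>F. dist y (K $$ x) < e"
    using assms by blast
  from F(2) have "op_apply K ` cball 0 1 \<subseteq> (\<Union>x\<in>F. ball x e)"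
    by (simp add: image_subset_iff)
  with F(1) show "\<exists>F. finite F \<and> op_apply K ` cball 0 1 \<subseteq> (\<Union>x\<in>F. ball x e)" by blast
qed

lemma compact_opE:
  assumes "compact_op K" "e > 0"
  obtains F where "finite F" "\<And>x. norm x \<le> 1 \<Longrightarrow> \<exists>y\<in>F. dist y (K $$ x) < e"
proof -
  obtain F where F: "finite F" "op_apply K ` cball 0 1 \<subseteq> (\<Union>x\<in>F. ball x e)"
    using assms unfolding compact_op_iff_totally_bounded by blast
  from F(2) have "\<exists>y\<in>F. dist y (K $$ x) < e" if x: "norm x \<le> 1" for x
    using x by (auto simp: image_subset_iff)
  with F(1) show ?thesis by (rule that)
qed

lemma compact_op_0 [simp]: "compact_op 0"
  by (rule compact_opI) (auto intro!: exI[of _ "{0}"])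

lemma compact_op_add:
  assumes "compact_op K" "compact_op L"
  shows "compact_op (K + L)"
proof (rule compact_opI)
  fix e :: real assume "e > 0"
  then have e: "e / 2 > 0" by simp
  obtain F where F: "finite F" "\<And>x. norm x \<le> 1 \<Longrightarrow> \<exists>y\<in>F. dist y (K $$ x) < e / 2"
    using compact_opE[OF assms(1) e] by blast
  obtain G where G: "finite G" "\<And>x. norm x \<le> 1 \<Longrightarrow> \<exists>y\<in>G. dist y (L $$ x) < e / 2"
    using compact_opE[OF assms(2) e] by blast
  have "\<exists>y\<in>(\<lambda>(a, b). a + b) ` (F \<times> G). dist y ((K + L) $$ x) < e" if x: "norm x \<le> 1" for x
  proof -
    obtain a b where "a \<in> F" "b \<in> G" "dist a (K $$ x) < e / 2" "dist b (L $$ x) < e / 2"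
      using F(2)[OF x] G(2)[OF x] by blast
    then show ?thesis
      using norm_triangle_ineq[of "a - K $$ x" "b - L $$ x"]
      by (intro bexI[of _ "a + b"]) (auto simp: dist_norm algebra_simps)
  qed
  then show "\<exists>F. finite F \<and> (\<forall>x. norm x \<le> 1 \<longrightarrow> (\<exists>y\<in>F. dist y ((K + L) $$ x) < e))"
    using F(1) G(1) by (intro exI[of _ "(\<lambda>(a, b). a + b) ` (F \<times> G)"]) auto
qed

lemma compact_op_mult_left:
  assumes "compact_op K"
  shows "compact_op (T * K)"
proof (rule compact_opI)
  fix e :: real assume "e > 0"
  then have e: "e / (norm T + 1) > 0" by (simp add: add_nonneg_pos)
  obtain F where F: "finite F" "\<And>x. norm x \<le> 1 \<Longrightarrow> \<exists>y\<in>F. dist y (K $$ x) < e / (norm T + 1)"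
    using compact_opE[OF assms e] by blast
  have "\<exists>y\<in>op_apply T ` F. dist y ((T * K) $$ x) < e" if x: "norm x \<le> 1" for x
  proof -
    obtain y where y: "y \<in> F" "dist y (K $$ x) < e / (norm T + 1)" using F(2)[OF x] by blast
    have "dist (T $$ y) (T $$ K $$ x) \<le> norm T * dist y (K $$ x)"
      using norm_op_apply[of T "y - K $$ x"] by (simp add: dist_norm)
    also have "\<dots> \<le> (norm T + 1) * dist y (K $$ x)" by (simp add: mult_right_mono)
    also have "\<dots> < e" using y(2) by (simp add: pos_less_divide_eq add_nonneg_pos mult.commute)
    finally show ?thesis using y(1) by auto
  qed
  then show "\<exists>F. finite F \<and> (\<forall>x. norm x \<le> 1 \<longrightarrow> (\<exists>y\<in>F. dist y ((T * K) $$ x) < e))"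
    using F(1) by (intro exI[of _ "op_apply T ` F"]) auto
qed

lemma compact_op_mult_right:
  assumes "compact_op K"
  shows "compact_op (K * T)"
proof (rule compact_opI)
  fix e :: real assume "e > 0"
  \<comment> \<open>Adding 1 keeps the scaling factor positive when T = 0.\<close>
  define r where "r = norm T + 1"
  have r: "r > 0" by (simp add: r_def add_nonneg_pos)
  then have e: "e / r > 0" using \<open>e > 0\<close> by simp
  obtain F where F: "finite F" "\<And>x. norm x \<le> 1 \<Longrightarrow> \<exists>y\<in>F. dist y (K $$ x) < e / r"
    using compact_opE[OF assms e] by blast
  have "\<exists>y\<in>scaleR r ` F. dist y ((K * T) $$ x) < e" if x: "norm x \<le> 1" for x
  proof -
    have "norm (T $$ x) \<le> norm T * 1"
      using norm_op_apply[of T x] mult_left_mono[OF x norm_ge_zero[of T]] by linarith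
    then have "norm ((1 / r) *\<^sub>R (T $$ x)) \<le> 1" using r by (simp add: r_def)
    then obtain y where y: "y \<in> F" "dist y (K $$ ((1 / r) *\<^sub>R (T $$ x))) < e / r" using F(2) by blast
    have "dist (r *\<^sub>R y) ((K * T) $$ x) = norm (r *\<^sub>R (y - K $$ ((1 / r) *\<^sub>R (T $$ x))))"
      using r by (simp add: dist_norm scaleR_right_diff_distrib)
    also have "\<dots> = r * dist y (K $$ ((1 / r) *\<^sub>R (T $$ x)))" using r by (simp only: norm_scaleR dist_norm abs_of_pos)
    also have "\<dots> < e" using y(2) r by (simp only: pos_less_divide_eq mult.commute)
    finally show ?thesis using y(1) by auto
  qed
  then show "\<exists>F. finite F \<and> (\<forall>x. norm x \<le> 1 \<longrightarrow> (\<exists>y\<in>F. dist y ((K * T) $$ x) < e))"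
    using F(1) by (intro exI[of _ "scaleR r ` F"]) auto
qed

lemma compact_op_scaleR: "compact_op K \<Longrightarrow> compact_op (r *\<^sub>R K)"
  using compact_op_mult_left[of K "r *\<^sub>R 1"] by simp

lemma compact_op_uminus: "compact_op K \<Longrightarrow> compact_op (- K)"
  using compact_op_scaleR[of K "-1"] by simp

lemma compact_op_diff: "compact_op K \<Longrightarrow> compact_op L \<Longrightarrow> compact_op (K - L)"
  using compact_op_add[of K "- L"] compact_op_uminus[of L] by simp

lemma compact_op_limit:
  assumes "X \<longlonglongrightarrow> K" "\<And>n. compact_op (X n)"
  shows "compact_op K"
proof (rule compact_opI)
  fix e :: real assume "e > 0"
  then obtain n where n: "norm (X n - K) < e / 2"
    using metric_LIMSEQ_D[OF assms(1), of "e / 2"] by (auto simp: dist_norm)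
  obtain F where F: "finite F" "\<And>x. norm x \<le> 1 \<Longrightarrow> \<exists>y\<in>F. dist y (X n $$ x) < e / 2"
    using compact_opE[OF assms(2)[of n], of "e / 2"] \<open>e > 0\<close> by auto
  have "\<exists>y\<in>F. dist y (K $$ x) < e" if x: "norm x \<le> 1" for x
  proof -
    obtain y where y: "y \<in> F" "dist y (X n $$ x) < e / 2" using F(2)[OF x] by blast
    have "dist (X n $$ x) (K $$ x) \<le> norm (X n - K) * norm x"
      using norm_op_apply[of "X n - K" x] by (simp add: dist_norm)
    also have "\<dots> \<le> norm (X n - K) * 1" using x by (intro mult_left_mono) auto
    finally have "dist y (K $$ x) < e"
      using dist_triangle[of y "K $$ x" "X n $$ x"] y(2) n by linarith
    with y(1) show ?thesis by blast
  qed
  with F(1) show "\<exists>F. finite F \<and> (\<forall>x. norm x \<le> 1 \<longrightarrow> (\<exists>y\<in>F. dist y (K $$ x) < e))" by blast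
qed

text \<open>The image of the unit ball lies in the continuous image of a closed disc of
  coefficients. This serves for the defect of the two shifts.\<close>

lemma compact_op_rank_one:
  assumes "\<And>x. K $$ x = f x *\<^sub>C v" "\<And>x. norm x \<le> 1 \<Longrightarrow> cmod (f x) \<le> r"
  shows "compact_op K"
  unfolding compact_op_iff_totally_bounded
proof (intro allI impI)
  fix e :: real assume "e > 0"
  have "compact ((\<lambda>c. c *\<^sub>C v) ` cball 0 r)"
  proof (intro compact_continuous_image compact_cball)
    have "bounded_linear (\<lambda>c. c *\<^sub>C v)"
    proof (rule bounded_linear_intro[of _ "norm v"])
      fix c d :: complex and s :: real
      show "(c + d) *\<^sub>C v = c *\<^sub>C v + d *\<^sub>C v" by (rule ell2_eqI) (simp add: algebra_simps)
      show "(s *\<^sub>R c) *\<^sub>C v = s *\<^sub>R (c *\<^sub>C v)" by (rule ell2_eqI) simp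
      show "norm (c *\<^sub>C v) \<le> norm c * norm v" by (simp add: norm_ell2_scale)
    qed
    then show "continuous_on (cball 0 r) (\<lambda>c. c *\<^sub>C v)" by (rule linear_continuous_on)
  qed
  then obtain F where F: "finite F" "(\<lambda>c. c *\<^sub>C v) ` cball 0 r \<subseteq> (\<Union>x\<in>F. ball x e)"
    unfolding compact_eq_totally_bounded using \<open>e > 0\<close> by blast
  have "op_apply K ` cball 0 1 \<subseteq> (\<lambda>c. c *\<^sub>C v) ` cball 0 r"
  proof
    fix y assume "y \<in> op_apply K ` cball 0 1"
    then obtain x where "y = K $$ x" "norm x \<le> 1" by auto
    then have "y = f x *\<^sub>C v" "norm x \<le> 1" by (simp_all only: assms(1))
    then show "y \<in> (\<lambda>c. c *\<^sub>C v) ` cball 0 r" using assms(2)[of x] by (intro image_eqI[of _ _ "f x"]) auto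
  qed
  from F(1) subset_trans[OF this F(2)]
  show "\<exists>F. finite F \<and> op_apply K ` cball 0 1 \<subseteq> (\<Union>x\<in>F. ball x e)" by (intro exI conjI)
qed

lemma ell2_nth_tendsto_0: "(\<lambda>m. ell2_nth x m) \<longlonglongrightarrow> 0"
proof -
  have "(\<lambda>m. sqrt ((cmod (ell2_nth x m))\<^sup>2)) \<longlonglongrightarrow> sqrt 0"
    by (intro tendsto_real_sqrt summable_LIMSEQ_zero summable_ell2_nth)
  then show ?thesis by (simp add: tendsto_norm_zero_iff)
qed

text \<open>Each K e_m is close to one of finitely many vectors, whose m-th coordinates all tend to
  0.\<close>

lemma compact_op_diagonal_tendsto_0:
  assumes "compact_op K"
  shows "(\<lambda>m. ell2_nth (K $$ ell2_basis m) m) \<longlonglongrightarrow> 0"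
proof (rule metric_LIMSEQ_I)
  fix e :: real assume "e > 0"
  then obtain F where F: "finite F" "\<And>x. norm x \<le> 1 \<Longrightarrow> \<exists>y\<in>F. dist y (K $$ x) < e / 2"
    using compact_opE[OF assms, of "e / 2"] by auto
  have "\<forall>\<^sub>F m in sequentially. \<forall>y\<in>F. dist (ell2_nth y m) 0 < e / 2"
    using F(1) \<open>e > 0\<close> by (intro eventually_ball_finite ballI tendstoD[OF ell2_nth_tendsto_0]) auto
  then obtain N where N: "\<And>m y. m \<ge> N \<Longrightarrow> y \<in> F \<Longrightarrow> cmod (ell2_nth y m) < e / 2"
    unfolding eventually_sequentially by auto
  have "dist (ell2_nth (K $$ ell2_basis m) m) 0 < e" if "m \<ge> N" for m
  proof -
    obtain y where y: "y \<in> F" "dist y (K $$ ell2_basis m) < e / 2" using F(2)[of "ell2_basis m"] by auto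
    have "cmod (ell2_nth y m - ell2_nth (K $$ ell2_basis m) m) < e / 2"
      using norm_ell2_nth_le[of "y - K $$ ell2_basis m" m] y(2) by (simp add: dist_norm)
    then show ?thesis
      using N[OF that y(1)] norm_triangle_ineq3[of "ell2_nth y m" "ell2_nth (K $$ ell2_basis m) m"]
      by (simp add: abs_le_iff)
  qed
  then show "\<exists>N. \<forall>m\<ge>N. dist (ell2_nth (K $$ ell2_basis m) m) 0 < e" by blast
qed

section \<open>Truncations and operators given by matrix entries\<close>

definition truncate :: "nat \<Rightarrow> ell2 \<Rightarrow> ell2"
  where "truncate N x = (\<Sum>j<N. ell2_nth x j *\<^sub>C ell2_basis j)"

lemma ell2_nth_sum: "ell2_nth (\<Sum>j\<in>S. f j) n = (\<Sum>j\<in>S. ell2_nth (f j) n)"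
  by (induction S rule: infinite_finite_induct) simp_all

lemma op_apply_sum: "A $$ (\<Sum>j\<in>S. f j) = (\<Sum>j\<in>S. A $$ f j)"
  by (induction S rule: infinite_finite_induct) simp_all

lemma ell2_nth_truncate: "ell2_nth (truncate N x) n = (if n < N then ell2_nth x n else 0)"
proof -
  have "ell2_nth (truncate N x) n = (\<Sum>j<N. if n = j then ell2_nth x j else 0)"
    unfolding truncate_def ell2_nth_sum by (rule sum.cong) auto
  then show ?thesis by simp
qed

lemma truncate_tendsto: "(\<lambda>N. truncate N x) \<longlonglongrightarrow> x"
proof -
  let ?f = "\<lambda>n. (cmod (ell2_nth x n))\<^sup>2"
  have "(norm (truncate N x - x))\<^sup>2 = suminf ?f - (\<Sum>n<N. ?f n)" for N
  proof -
    have "(\<Sum>n. (cmod (ell2_nth (truncate N x - x) n))\<^sup>2) = (\<Sum>n. ?f n - (if n \<in> {..<N} then ?f n else 0))"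
      by (rule suminf_cong) (simp add: ell2_nth_truncate)
    also have "\<dots> = suminf ?f - (\<Sum>n. if n \<in> {..<N} then ?f n else 0)"
      by (intro suminf_diff[symmetric] summable_ell2_nth) (rule summable_If_finite_set, simp)
    also have "(\<Sum>n. if n \<in> {..<N} then ?f n else 0) = (\<Sum>n<N. ?f n)"
      by (rule sums_unique[symmetric], rule sums_If_finite_set) simp
    finally show ?thesis
      by (simp add: norm_ell2_def suminf_nonneg summable_ell2_nth sum_le_suminf)
  qed
  moreover have "(\<lambda>N. suminf ?f - (\<Sum>n<N. ?f n)) \<longlonglongrightarrow> suminf ?f - suminf ?f"
    by (intro tendsto_diff tendsto_const summable_LIMSEQ summable_ell2_nth)
  ultimately have "(\<lambda>N. (norm (truncate N x - x))\<^sup>2) \<longlonglongrightarrow> 0" by simp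
  then have "(\<lambda>N. sqrt ((norm (truncate N x - x))\<^sup>2)) \<longlonglongrightarrow> sqrt 0" by (rule tendsto_real_sqrt)
  then show ?thesis by (simp add: tendsto_norm_zero_iff flip: LIM_zero_iff[of _ x])
qed

lemma tendsto_op_apply_right: "(f \<longlongrightarrow> x) F \<Longrightarrow> ((\<lambda>n. A $$ f n) \<longlongrightarrow> A $$ x) F"
  by (rule bounded_bilinear.tendsto[OF bounded_bilinear_op_apply tendsto_const])

lemma op_apply_truncate: "A $$ truncate N x = (\<Sum>j<N. ell2_nth x j *\<^sub>C (A $$ ell2_basis j))"
  by (simp add: truncate_def op_apply_sum)

lemma op_eq_basis:
  assumes "\<And>i j. ell2_nth (A $$ ell2_basis j) i = ell2_nth (B $$ ell2_basis j) i"
  shows "A = B"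
proof (rule op_eqI)
  fix x
  have "A $$ ell2_basis j = B $$ ell2_basis j" for j by (rule ell2_eqI) (rule assms)
  then have "A $$ truncate N x = B $$ truncate N x" for N by (simp add: op_apply_truncate)
  then have "(\<lambda>N. A $$ truncate N x) \<longlonglongrightarrow> B $$ x"
    by (simp only: tendsto_op_apply_right[OF truncate_tendsto])
  with tendsto_op_apply_right[OF truncate_tendsto] show "A $$ x = B $$ x"
    by (rule LIMSEQ_unique)
qed

lemma cinner_truncate: "cinner (truncate N y) z = (\<Sum>i<N. cnj (ell2_nth y i) * ell2_nth z i)"
proof -
  have "cinner (truncate N y) z = (\<Sum>n<N. cnj (ell2_nth (truncate N y) n) * ell2_nth z n)"
    unfolding cinner_def by (rule suminf_finite) (auto simp: ell2_nth_truncate)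
  also have "\<dots> = (\<Sum>i<N. cnj (ell2_nth y i) * ell2_nth z i)"
    by (rule sum.cong) (auto simp: ell2_nth_truncate)
  finally show ?thesis .
qed

lemma cinner_truncate_op:
  "cinner (truncate N y) (A $$ truncate N x) =
    (\<Sum>i<N. \<Sum>j<N. cnj (ell2_nth y i) * ell2_nth x j * ell2_nth (A $$ ell2_basis j) i)"
  by (simp add: cinner_truncate op_apply_truncate ell2_nth_sum sum_distrib_left mult.assoc)

lemma cinner_basis_left: "cinner (ell2_basis m) z = ell2_nth z m"
proof -
  have "cinner (ell2_basis m) z = (\<Sum>n\<in>{m}. cnj (ell2_nth (ell2_basis m) n) * ell2_nth z n)"
    unfolding cinner_def by (rule suminf_finite) auto
  then show ?thesis by simp
qed

lemma adjoint_pairI_basis: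
  assumes "\<And>i j. ell2_nth (X $$ ell2_basis j) i = cnj (ell2_nth (Y $$ ell2_basis i) j)"
  shows "adjoint_pair X Y"
  unfolding adjoint_pair_def
proof (intro allI)
  fix x y
  have eq: "inner (truncate N y) (X $$ truncate N x) = inner (truncate N x) (Y $$ truncate N y)" for N
  proof -
    have "cinner (truncate N y) (X $$ truncate N x) = cnj (cinner (truncate N x) (Y $$ truncate N y))"
      unfolding cinner_truncate_op assms
      by (subst sum.swap) (simp add: mult_ac)
    then show ?thesis by (simp add: inner_ell2_def)
  qed
  have "(\<lambda>N. inner (truncate N v) (Z $$ truncate N u)) \<longlonglongrightarrow> inner v (Z $$ u)" for Z u v
    by (intro tendsto_inner truncate_tendsto tendsto_op_apply_right)
  from this[of y X x] this[of x Y y] have "inner y (X $$ x) = inner x (Y $$ y)"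
    unfolding eq by (rule LIMSEQ_unique)
  then show "inner (X $$ x) y = inner x (Y $$ y)"
    by (simp add: inner_commute)
qed

section \<open>The backward and forward shift\<close>

lemma op_of_linear:
  assumes "\<And>x y. f (x + y) = f x + f y" "\<And>c x. f (c *\<^sub>C x) = c *\<^sub>C f x" "\<And>x. norm (f x) \<le> norm x"
  shows "\<exists>A. \<forall>x. A $$ x = f x"
proof -
  have sc: "r *\<^sub>R x = complex_of_real r *\<^sub>C x" for r x
    by (rule ell2_eqI) (simp add: scaleR_conv_of_real)
  have "bounded_linear f"
    by (rule bounded_linear_intro[of _ 1]) (simp_all add: assms sc)
  then have f: "blinfun_apply (Blinfun f) = f" by (rule bounded_linear_Blinfun_apply)
  then have "op_apply (Abs_ell2_op (Blinfun f)) = f"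
    unfolding op_apply.rep_eq using assms(2) by (subst Abs_ell2_op_inverse) auto
  then show ?thesis by metis
qed

lemma ex_backward_shift: "\<exists>U. \<forall>x n. ell2_nth (U $$ x) n = ell2_nth x (Suc n)"
proof -
  define f where "f x = Abs_ell2 (\<lambda>n. ell2_nth x (Suc n))" for x
  have sm: "summable (\<lambda>n. (cmod (ell2_nth x (Suc n)))\<^sup>2)" for x
    using summable_ell2_nth[of x] by (subst summable_Suc_iff)
  then have nth: "ell2_nth (f x) n = ell2_nth x (Suc n)" for x n
    unfolding f_def by (subst Abs_ell2_inverse) auto
  have "norm (f x) \<le> norm x" for x
    unfolding norm_ell2_def nth
    using suminf_split_head[OF summable_ell2_nth[of x]] by (intro real_sqrt_le_mono) simp
  then have "\<exists>U. \<forall>x. U $$ x = f x"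
    by (intro op_of_linear) (auto intro!: ell2_eqI simp: nth)
  then show ?thesis using nth by metis
qed

lemma ex_forward_shift:
  "\<exists>V. \<forall>x n. ell2_nth (V $$ x) n = (case n of 0 \<Rightarrow> 0 | Suc m \<Rightarrow> ell2_nth x m)"
proof -
  define f where "f x = Abs_ell2 (\<lambda>n. case n of 0 \<Rightarrow> 0 | Suc m \<Rightarrow> ell2_nth x m)" for x
  have sm: "summable (\<lambda>n. (cmod (case n of 0 \<Rightarrow> 0 | Suc m \<Rightarrow> ell2_nth x m))\<^sup>2)" for x
    using summable_ell2_nth[of x] by (subst summable_Suc_iff[symmetric]) simp
  then have nth: "ell2_nth (f x) n = (case n of 0 \<Rightarrow> 0 | Suc m \<Rightarrow> ell2_nth x m)" for x n
    unfolding f_def by (subst Abs_ell2_inverse) auto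
  have "norm (f x) \<le> norm x" for x
    unfolding norm_ell2_def nth using suminf_split_head[OF sm[of x]] by simp
  then have "\<exists>V. \<forall>x. V $$ x = f x"
    by (intro op_of_linear) (auto intro!: ell2_eqI simp: nth split: nat.split)
  then show ?thesis using nth by metis
qed

section \<open>Trigonometric approximation\<close>

lemma C_2pi_simps:
  "(\<lambda>_. c) \<in> C_2pi" "(\<lambda>t. cis t) \<in> C_2pi" "(\<lambda>t. cis (- t)) \<in> C_2pi"
  "a \<in> C_2pi \<Longrightarrow> b \<in> C_2pi \<Longrightarrow> (\<lambda>t. a t + b t) \<in> C_2pi"
  "a \<in> C_2pi \<Longrightarrow> b \<in> C_2pi \<Longrightarrow> (\<lambda>t. a t - b t) \<in> C_2pi"
  "a \<in> C_2pi \<Longrightarrow> b \<in> C_2pi \<Longrightarrow> (\<lambda>t. a t * b t) \<in> C_2pi"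
proof -
  have "cis (- (2 * pi)) = 1" by (metis cis_cnj cis_2pi complex_cnj_one)
  then show "(\<lambda>t. cis (- t)) \<in> C_2pi" by (auto simp: C_2pi_def intro!: continuous_intros)
qed (auto simp: C_2pi_def intro!: continuous_intros)

lemma C_2pi_on_circle:
  assumes "a \<in> C_2pi"
  obtains F where "continuous_on (sphere 0 1) F" "\<And>t. t \<in> {0..2*pi} \<Longrightarrow> F (cis t) = a t"
proof
  define p where "p s = a (2 * pi * s)" for s
  have a: "continuous_on {0..2*pi} a" "a 0 = a (2 * pi)" using assms by (auto simp: C_2pi_def)
  have "path p"
    unfolding path_def p_def
    by (rule continuous_on_compose2[OF a(1)]) (auto intro!: continuous_intros)
  moreover have "pathfinish p = pathstart p"
    using \<open>a 0 = a (2 * pi)\<close> by (simp add: p_def pathfinish_def pathstart_def)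
  \<comment> \<open>\<open>Arg2pi\<close> jumps at 1, where p takes equal end values. The constant
    homotopy of the loop p feeds the theorem on circle maps, which contains the continuity
    there.\<close>
  ultimately have "homotopic_loops UNIV p p" by (simp add: homotopic_loops_refl)
  from homotopic_loops_imp_homotopic_circlemaps[OF this]
  show "continuous_on (sphere 0 1) (p \<circ> (\<lambda>z. Arg2pi z / (2 * pi)))"
    using homotopic_with_imp_continuous by blast
  fix t assume t: "t \<in> {0..2*pi}"
  show "(p \<circ> (\<lambda>z. Arg2pi z / (2 * pi))) (cis t) = a t"
  proof (cases "t = 2 * pi")
    case True
    have "Arg2pi 1 = 0" by (rule Arg2pi_unique[of 1]) auto
    with True show ?thesis using \<open>a 0 = a (2 * pi)\<close> by (simp add: p_def)
  next
    case False
    then have "Arg2pi (cis t) = t" using t by (intro Arg2pi_unique[of 1]) (auto simp: cis_conv_exp)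
    then show ?thesis by (simp add: p_def)
  qed
qed

text \<open>Stone-Weierstrass as an induction rule: polynomials in the real and imaginary part of
  cis t are generated by constants, cis t and cis (- t), and are uniformly dense.\<close>

lemma C_2pi_induct [consumes 1, case_names const cis cis_minus add mult limit]:
  assumes "a \<in> C_2pi"
    and const: "\<And>c. P (\<lambda>_. c)" and cis: "P (\<lambda>t. cis t)" and cis': "P (\<lambda>t. cis (- t))"
    and add: "\<And>f g. P f \<Longrightarrow> P g \<Longrightarrow> P (\<lambda>t. f t + g t)"
    and mult: "\<And>f g. P f \<Longrightarrow> P g \<Longrightarrow> P (\<lambda>t. f t * g t)"
    and limit: "\<And>f g. (\<And>n. P (f n)) \<Longrightarrow> g \<in> C_2pi \<Longrightarrow>
      uniform_limit {0..2*pi} f g sequentially \<Longrightarrow> P g"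
  shows "P a"
proof -
  have real: "P (\<lambda>t. complex_of_real (q (cis t)))" if "real_polynomial_function q" for q :: "complex \<Rightarrow> real"
    using that
  proof induction
    case (linear f)
    \<comment> \<open>A real-linear f satisfies f (cis t) = cos t f(1) + sin t f(i), and Euler's
      formulas express cos and sin by cis t and cis (- t).\<close>
    have "complex_of_real (f (cis t)) =
        of_real (f 1) * ((1 / 2) * (cis t + cis (- t))) + of_real (f \<i>) * ((- \<i> / 2) * (cis t + (- 1) * cis (- t)))"
      for t
    proof -
      have "cis t = cos t *\<^sub>R 1 + sin t *\<^sub>R \<i>" by (simp add: complex_eq_iff)
      then have "f (cis t) = cos t * f 1 + sin t * f \<i>"
        using linear by (simp add: linear_simps real_scaleR_def)
      then show ?thesis by (simp add: complex_eq_iff)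
    qed
    then show ?case by (simp only:) (intro add mult const cis cis')
  next
    case (const c)
    show ?case by (rule assms(2))
  next
    case (add f g)
    then show ?case unfolding of_real_add by (intro assms(5))
  next
    case (mult f g)
    then show ?case unfolding of_real_mult by (intro assms(6))
  qed
  have poly: "P (\<lambda>t. g (cis t))" if "polynomial_function g" for g :: "complex \<Rightarrow> complex"
  proof -
    have "real_polynomial_function (Re \<circ> g)" "real_polynomial_function (Im \<circ> g)"
      using that by (simp_all add: polynomial_function_def bounded_linear_Re bounded_linear_Im)
    from this[THEN real] have "P (\<lambda>t. of_real (Re (g (cis t))) + \<i> * of_real (Im (g (cis t))))"
      by (intro add mult const) simp_all
    then show ?thesis by (simp flip: complex_eq)
  qed
  obtain F where F: "continuous_on (sphere 0 1) F" "\<And>t. t \<in> {0..2*pi} \<Longrightarrow> F (cis t) = a t"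
    using C_2pi_on_circle[OF assms(1)] by metis
  obtain G where G: "uniform_limit (sphere 0 1) G F sequentially" "\<And>n. polynomial_function (G n)"
    using Stone_Weierstrass_uniform_limit[OF compact_sphere F(1)] by blast
  have "uniform_limit {0..2*pi} (\<lambda>n t. G n (cis t)) a sequentially"
  proof (rule uniform_limitI)
    fix e :: real assume "e > 0"
    from uniform_limitD[OF G(1) this]
    show "\<forall>\<^sub>F n in sequentially. \<forall>t\<in>{0..2*pi}. dist (G n (cis t)) (a t) < e"
    proof eventually_elim
      case (elim n)
      show ?case
      proof
        fix t assume "t \<in> {0..2*pi}"
        then show "dist (G n (cis t)) (a t) < e"
          using bspec[OF elim, of "cis t"] F(2)[of t] by simp
      qed
    qed
  qed
  with poly[OF G(2)] assms(1) show ?thesis by (rule limit)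
qed

section \<open>Toeplitz operators\<close>

lemma C_2pi_continuous: "a \<in> C_2pi \<Longrightarrow> continuous_on {0..2*pi} a"
  by (simp add: C_2pi_def)

lemma integrable_fourier:
  "a \<in> C_2pi \<Longrightarrow> (\<lambda>t. a t * exp (- \<i> * of_int k * of_real t)) integrable_on {0..2*pi}"
  by (intro integrable_continuous_interval continuous_intros C_2pi_continuous)

lemma fourier_coeff_cong:
  "(\<And>t. t \<in> {0..2*pi} \<Longrightarrow> a t = b t) \<Longrightarrow> fourier_coeff a k = fourier_coeff b k"
  unfolding fourier_coeff_def by (intro arg_cong2[of _ _ _ _ "(/)"] integral_cong) auto

lemma fourier_coeff_add:
  assumes "a \<in> C_2pi" "b \<in> C_2pi"
  shows "fourier_coeff (\<lambda>t. a t + b t) k = fourier_coeff a k + fourier_coeff b k"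
  using integral_add[OF integrable_fourier[OF assms(1)] integrable_fourier[OF assms(2)], of k k]
  by (simp add: fourier_coeff_def distrib_right add_divide_distrib)

lemma fourier_coeff_cmult: "fourier_coeff (\<lambda>t. c * a t) k = c * fourier_coeff a k"
  by (simp add: fourier_coeff_def mult.assoc)

lemma fourier_coeff_diff:
  assumes "a \<in> C_2pi" "b \<in> C_2pi"
  shows "fourier_coeff (\<lambda>t. a t - b t) k = fourier_coeff a k - fourier_coeff b k"
  using integral_diff[OF integrable_fourier[OF assms(1)] integrable_fourier[OF assms(2)], of k k]
  by (simp add: fourier_coeff_def left_diff_distrib diff_divide_distrib)

lemma fourier_coeff_cis: "fourier_coeff (\<lambda>t. cis t * b t) k = fourier_coeff b (k - 1)"
proof -
  have "cis t * b t * exp (- \<i> * of_int k * of_real t) = b t * exp (- \<i> * of_int (k - 1) * of_real t)" for t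
    by (simp add: cis_conv_exp algebra_simps flip: exp_add)
  then show ?thesis unfolding fourier_coeff_def by (simp only:)
qed

lemma fourier_coeff_cis_minus: "fourier_coeff (\<lambda>t. cis (- t) * b t) k = fourier_coeff b (k + 1)"
proof -
  have "cis (- t) * b t * exp (- \<i> * of_int k * of_real t) = b t * exp (- \<i> * of_int (k + 1) * of_real t)" for t
    by (simp add: cis_conv_exp algebra_simps flip: exp_add)
  then show ?thesis unfolding fourier_coeff_def by (simp only:)
qed

lemma fourier_coeff_one: "fourier_coeff (\<lambda>_. 1) k = (if k = 0 then 1 else 0)"
proof (cases "k = 0")
  case False
  define c where "c = - \<i> * of_int k"
  have c: "c \<noteq> 0" using False by (simp add: c_def)
  have "((\<lambda>t. exp (c * of_real t)) has_integral
      (exp (c * of_real (2 * pi)) / c - exp (c * of_real 0) / c)) {0..2*pi}"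
  proof (rule fundamental_theorem_of_calculus)
    fix t :: real
    have "((\<lambda>z. exp (c * z) / c) has_field_derivative exp (c * of_real t)) (at (of_real t))"
      using c by (auto intro!: derivative_eq_intros)
    then show "((\<lambda>t. exp (c * of_real t) / c) has_vector_derivative exp (c * of_real t)) (at t within {0..2*pi})"
      using has_vector_derivative_real_field has_vector_derivative_at_within by blast
  qed simp
  moreover have "exp (c * of_real (2 * pi)) = 1"
    using exp_2pi_1_int[of "- k"] by (simp add: c_def algebra_simps)
  ultimately show ?thesis
    using False by (simp add: fourier_coeff_def c_def integral_unique)
qed (simp add: fourier_coeff_def scaleR_conv_of_real)

lemma fourier_coeff_const: "fourier_coeff (\<lambda>_. c) k = (if k = 0 then c else 0)"
  using fourier_coeff_cmult[of c "\<lambda>_. 1" k] by (simp add: fourier_coeff_one)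

lemma norm_fourier_coeff_le:
  assumes "a \<in> C_2pi" "\<And>t. t \<in> {0..2*pi} \<Longrightarrow> cmod (a t) \<le> M"
  shows "cmod (fourier_coeff a k) \<le> M"
proof -
  have "cmod (integral {0..2*pi} (\<lambda>t. a t * exp (- \<i> * of_int k * of_real t))) \<le> M * (2 * pi - 0)"
  proof (rule integral_bound)
    show "continuous_on {0..2*pi} (\<lambda>t. a t * exp (- \<i> * of_int k * of_real t))"
      by (intro continuous_intros C_2pi_continuous assms(1))
  qed (use assms(2) in \<open>auto simp: norm_mult\<close>)
  then show ?thesis by (simp add: fourier_coeff_def norm_divide field_simps)
qed

text \<open>The description inside \<open>toeplitz\<close> as a predicate, usable before the
  operator is known to exist.\<close>

definition toeplitz_matrix :: "ell2_op \<Rightarrow> (real \<Rightarrow> complex) \<Rightarrow> bool"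
  where "toeplitz_matrix T a \<longleftrightarrow>
    (\<forall>i j. ell2_nth (T $$ ell2_basis j) i = fourier_coeff a (int j - int i))"

lemma toeplitz_matrixD:
  "toeplitz_matrix T a \<Longrightarrow> ell2_nth (T $$ ell2_basis j) i = fourier_coeff a (int j - int i)"
  by (simp add: toeplitz_matrix_def)

lemma toeplitz_eqI:
  assumes "toeplitz_matrix T a"
  shows "toeplitz a = T"
  unfolding toeplitz_def
  by (rule the_equality) (use assms in \<open>auto intro!: op_eq_basis simp: toeplitz_matrix_def\<close>)

lemma toeplitz_matrix_diff:
  "a \<in> C_2pi \<Longrightarrow> b \<in> C_2pi \<Longrightarrow> toeplitz_matrix S a \<Longrightarrow> toeplitz_matrix T b \<Longrightarrow>
    toeplitz_matrix (S - T) (\<lambda>t. a t - b t)"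
  by (simp add: toeplitz_matrix_def fourier_coeff_diff)

lemma toeplitz_matrix_add:
  "a \<in> C_2pi \<Longrightarrow> b \<in> C_2pi \<Longrightarrow> toeplitz_matrix S a \<Longrightarrow> toeplitz_matrix T b \<Longrightarrow>
    toeplitz_matrix (S + T) (\<lambda>t. a t + b t)"
  by (simp add: toeplitz_matrix_def fourier_coeff_add)

text \<open>The negative frequencies match the entry convention a_(j-i): the product of the
  conjugate of frequency -i and of frequency -j is the kernel of that Fourier coefficient.\<close>

definition trig_sum :: "nat \<Rightarrow> ell2 \<Rightarrow> real \<Rightarrow> complex"
  where "trig_sum N x t = (\<Sum>j<N. ell2_nth x j * exp (- \<i> * of_nat j * of_real t))"

lemma continuous_on_trig_sum [continuous_intros]: "continuous_on S (trig_sum N x)"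
  unfolding trig_sum_def[abs_def] by (intro continuous_intros)

text \<open>T(a) is the compression of multiplication by a. On truncations both sides are the same
  finite double sum.\<close>

lemma toeplitz_form_integral:
  assumes a: "a \<in> C_2pi" and T: "toeplitz_matrix T a"
  shows "cinner (truncate N y) (T $$ truncate N x) =
    integral {0..2*pi} (\<lambda>t. a t * (cnj (trig_sum N y t) * trig_sum N x t)) / of_real (2*pi)"
proof -
  let ?e = "\<lambda>k t. a t * exp (- \<i> * of_int k * of_real t)"
  let ?c = "\<lambda>i j. cnj (ell2_nth y i) * ell2_nth x j"
  have cnj_exp: "cnj (exp (- \<i> * of_nat i * of_real t)) = exp (\<i> * of_nat i * of_real t)" for i :: nat and t
    by (simp add: exp_cnj)
  have "a t * (cnj (trig_sum N y t) * trig_sum N x t)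
      = (\<Sum>i<N. \<Sum>j<N. ?c i j * ?e (int j - int i) t)" for t
    unfolding trig_sum_def cnj_sum complex_cnj_mult cnj_exp sum_product
    unfolding sum_distrib_left
    by (intro sum.cong refl)
      (simp add: sum_distrib_left algebra_simps exp_diff exp_minus divide_inverse)
  moreover have "((\<lambda>t. \<Sum>i<N. \<Sum>j<N. ?c i j * ?e (int j - int i) t) has_integral
      (\<Sum>i<N. \<Sum>j<N. ?c i j * integral {0..2*pi} (?e (int j - int i)))) {0..2*pi}"
    by (intro has_integral_sum has_integral_mult_right integrable_integral integrable_fourier a) simp_all
  ultimately have "integral {0..2*pi} (\<lambda>t. a t * (cnj (trig_sum N y t) * trig_sum N x t))
      = (\<Sum>i<N. \<Sum>j<N. ?c i j * integral {0..2*pi} (?e (int j - int i)))"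
    by (simp add: integral_unique)
  then show ?thesis
    unfolding cinner_truncate_op toeplitz_matrixD[OF T] fourier_coeff_def
    by (simp add: sum_divide_distrib)
qed

lemma toeplitz_matrix_one: "toeplitz_matrix 1 (\<lambda>_. 1)"
  by (auto simp: toeplitz_matrix_def fourier_coeff_one)

text \<open>The previous formula for the symbol 1 and the identity operator.\<close>

lemma trig_sum_parseval:
  "integral {0..2*pi} (\<lambda>t. (cmod (trig_sum N x t))\<^sup>2) = 2 * pi * (norm (truncate N x))\<^sup>2"
proof -
  let ?f = "\<lambda>t. 1 * (cnj (trig_sum N x t) * trig_sum N x t)"
  have "cinner (truncate N x) (truncate N x) = integral {0..2*pi} ?f / of_real (2*pi)"
    using toeplitz_form_integral[OF C_2pi_simps(1) toeplitz_matrix_one, of N x x] by simp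
  then have "Re (integral {0..2*pi} ?f) = 2 * pi * Re (cinner (truncate N x) (truncate N x))"
    by simp
  moreover have "Re (integral {0..2*pi} ?f) = integral {0..2*pi} (Re \<circ> ?f)"
    by (intro integral_linear[symmetric] bounded_linear_Re integrable_continuous_interval continuous_intros)
  moreover have "Re \<circ> ?f = (\<lambda>t. (cmod (trig_sum N x t))\<^sup>2)"
    by (simp add: fun_eq_iff cmod_mult_self power2_eq_square)
  ultimately show ?thesis by (simp add: Re_cinner power2_norm_eq_inner)
qed

text \<open>The arithmetic mean of squares replaces the product of norms, since it is what
  integrates termwise against Parseval; on unit vectors the two agree.\<close>

lemma norm_le_of_form_bound:
  assumes "0 \<le> M" and form: "\<And>x y. \<bar>inner y (T $$ x)\<bar> \<le> M * ((norm y)\<^sup>2 + (norm x)\<^sup>2) / 2"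
  shows "norm T \<le> M"
proof (rule norm_op_le_unit)
  fix x :: ell2 assume x: "norm x = 1"
  show "norm (T $$ x) \<le> M"
  proof (cases "T $$ x = 0")
    case False
    define y where "y = (1 / norm (T $$ x)) *\<^sub>R (T $$ x)"
    have y: "norm y = 1" using False by (simp add: y_def)
    have "inner (T $$ x) (T $$ x) = norm (T $$ x) * norm (T $$ x)"
      by (simp add: power2_norm_eq_inner flip: power2_eq_square)
    then have "inner y (T $$ x) = norm (T $$ x)" using False by (simp add: y_def)
    then show ?thesis using form[of y x] x y by simp
  qed (use \<open>0 \<le> M\<close> in simp)
qed fact

text \<open>Pointwise the integrand is at most M times the mean of the two squared trigonometric
  sums, and Parseval integrates it. Truncations then tend to arbitrary vectors.\<close>

lemma norm_toeplitz_matrix_le: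
  assumes a: "a \<in> C_2pi" and T: "toeplitz_matrix T a"
    and M: "\<And>t. t \<in> {0..2*pi} \<Longrightarrow> cmod (a t) \<le> M"
  shows "norm T \<le> M"
proof -
  have M0: "0 \<le> M" using M[of 0] norm_ge_zero[of "a 0"] by (meson atLeastAtMost_iff order_trans
    order_refl pi_ge_zero mult_nonneg_nonneg zero_le_numeral)
  have trunc: "\<bar>inner (truncate N y) (T $$ truncate N x)\<bar>
      \<le> M * ((norm (truncate N y))\<^sup>2 + (norm (truncate N x))\<^sup>2) / 2" for N x y
  proof -
    let ?u = "trig_sum N y" and ?v = "trig_sum N x"
    let ?f = "\<lambda>t. a t * (cnj (?u t) * ?v t)"
    let ?g = "\<lambda>t. M / 2 * ((cmod (?u t))\<^sup>2 + (cmod (?v t))\<^sup>2)"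
    have "cmod (integral {0..2*pi} ?f) \<le> integral {0..2*pi} ?g"
    proof (rule integral_norm_bound_integral)
      show "?f integrable_on {0..2*pi}" "?g integrable_on {0..2*pi}"
        by (intro integrable_continuous_interval continuous_intros C_2pi_continuous[OF a])+
      fix t assume "t \<in> {0..2*pi}"
      then have "norm (?f t) \<le> M * (cmod (?u t) * cmod (?v t))"
        unfolding norm_mult complex_mod_cnj by (intro mult_right_mono M) auto
      also have "\<dots> \<le> M * (((cmod (?u t))\<^sup>2 + (cmod (?v t))\<^sup>2) / 2)"
        using M0 sum_squares_bound[of "cmod (?u t)" "cmod (?v t)"] by (intro mult_left_mono) auto
      finally show "norm (?f t) \<le> ?g t" by simp
    qed
    also have "integral {0..2*pi} ?g = M / 2 * (integral {0..2*pi} (\<lambda>t. (cmod (?u t))\<^sup>2) +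
        integral {0..2*pi} (\<lambda>t. (cmod (?v t))\<^sup>2))"
      by (subst integral_mult_right, subst integral_add)
        (auto intro!: integrable_continuous_interval continuous_intros)
    also have "\<dots> = 2 * pi * (M * ((norm (truncate N y))\<^sup>2 + (norm (truncate N x))\<^sup>2) / 2)"
      unfolding trig_sum_parseval by (simp add: algebra_simps)
    finally have "cmod (integral {0..2*pi} ?f) / (2 * pi)
        \<le> M * ((norm (truncate N y))\<^sup>2 + (norm (truncate N x))\<^sup>2) / 2"
      by (simp add: pos_divide_le_eq mult.commute)
    moreover have "\<bar>inner (truncate N y) (T $$ truncate N x)\<bar> \<le> cmod (cinner (truncate N y) (T $$ truncate N x))"
      unfolding Re_cinner[symmetric] by (rule abs_Re_le_cmod)
    ultimately show ?thesis
      unfolding toeplitz_form_integral[OF a T] by (simp add: norm_divide)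
  qed
  show ?thesis
  proof (rule norm_le_of_form_bound[OF M0])
    fix x y
    show "\<bar>inner y (T $$ x)\<bar> \<le> M * ((norm y)\<^sup>2 + (norm x)\<^sup>2) / 2"
      by (rule LIMSEQ_le[of "\<lambda>N. \<bar>inner (truncate N y) (T $$ truncate N x)\<bar>" _
            "\<lambda>N. M * ((norm (truncate N y))\<^sup>2 + (norm (truncate N x))\<^sup>2) / 2"])
        (use trunc in \<open>auto intro!: tendsto_intros truncate_tendsto tendsto_op_apply_right\<close>)
  qed
qed

text \<open>The sup-norm estimate makes the operators Cauchy, and completeness produces one for the
  limit symbol. In this way existence passes beyond trigonometric polynomials.\<close>

lemma toeplitz_matrix_limit:
  assumes a: "\<And>n. a n \<in> C_2pi" and b: "b \<in> C_2pi" and T: "\<And>n. toeplitz_matrix (T n) (a n)"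
    and lim: "uniform_limit {0..2*pi} a b sequentially"
  shows "\<exists>S. toeplitz_matrix S b \<and> T \<longlonglongrightarrow> S"
proof -
  have ev: "\<exists>N. \<forall>n\<ge>N. \<forall>t\<in>{0..2*pi}. cmod (a n t - b t) < e" if "e > 0" for e
    using uniform_limitD[OF lim that] unfolding eventually_sequentially dist_norm .
  have "Cauchy T"
  proof (rule metric_CauchyI)
    fix e :: real assume "e > 0"
    then have "0 < e / 3" by simp
    from ev[OF this] obtain N
      where N: "\<And>n t. n \<ge> N \<Longrightarrow> t \<in> {0..2*pi} \<Longrightarrow> cmod (a n t - b t) < e / 3" by blast
    have "dist (T m) (T n) < e" if "m \<ge> N" "n \<ge> N" for m n
    proof -
      have "norm (T m - T n) \<le> e / 3 + e / 3"
      proof (rule norm_toeplitz_matrix_le[OF C_2pi_simps(5) toeplitz_matrix_diff])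
        fix t assume "t \<in> {0..2*pi}"
        then show "cmod (a m t - a n t) \<le> e / 3 + e / 3"
          using N[OF that(1), of t] N[OF that(2), of t] norm_triangle_ineq4[of "a m t - b t" "a n t - b t"]
          by simp
      qed (use a T in auto)
      with \<open>e > 0\<close> show ?thesis by (simp add: dist_norm)
    qed
    then show "\<exists>M. \<forall>m\<ge>M. \<forall>n\<ge>M. dist (T m) (T n) < e" by blast
  qed
  then obtain S where S: "T \<longlonglongrightarrow> S" using Cauchy_convergent convergent_def by blast
  \<comment> \<open>Entries converge to those of S by norm convergence and to the Fourier
    coefficients of b by uniform convergence of the symbols.\<close>
  have "ell2_nth (S $$ ell2_basis j) i = fourier_coeff b (int j - int i)" for i j
  proof (rule LIMSEQ_unique)
    have "(\<lambda>n. ell2_nth ((T n - S) $$ ell2_basis j) i) \<longlonglongrightarrow> 0"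
    proof (rule Lim_null_comparison)
      show "\<forall>\<^sub>F n in sequentially. norm (ell2_nth ((T n - S) $$ ell2_basis j) i) \<le> norm (T n - S)"
        by (rule always_eventually, rule allI,
            rule order_trans[OF norm_ell2_nth_le order_trans[OF norm_op_apply]]) simp
      show "(\<lambda>n. norm (T n - S)) \<longlonglongrightarrow> 0" using S by (simp add: tendsto_norm_zero_iff LIM_zero_iff)
    qed
    from tendsto_add[OF this tendsto_const[of "ell2_nth (S $$ ell2_basis j) i"]]
    show "(\<lambda>n. fourier_coeff (a n) (int j - int i)) \<longlonglongrightarrow> ell2_nth (S $$ ell2_basis j) i"
      by (simp add: toeplitz_matrixD[OF T])
    show "(\<lambda>n. fourier_coeff (a n) (int j - int i)) \<longlonglongrightarrow> fourier_coeff b (int j - int i)"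
    proof (rule metric_LIMSEQ_I)
      fix e :: real assume "e > 0"
      then have "0 < e / 2" by simp
      from ev[OF this] obtain N
        where N: "\<And>n t. n \<ge> N \<Longrightarrow> t \<in> {0..2*pi} \<Longrightarrow> cmod (a n t - b t) < e / 2" by blast
      have "dist (fourier_coeff (a n) (int j - int i)) (fourier_coeff b (int j - int i)) < e" if "n \<ge> N" for n
      proof -
        have "cmod (fourier_coeff (\<lambda>t. a n t - b t) (int j - int i)) \<le> e / 2"
          by (rule norm_fourier_coeff_le[OF C_2pi_simps(5)[OF a b]])
            (use N[OF that] in \<open>auto intro: less_imp_le\<close>)
        then show ?thesis using \<open>e > 0\<close> by (simp add: dist_norm fourier_coeff_diff a b)
      qed
      then show "\<exists>N. \<forall>n\<ge>N. dist (fourier_coeff (a n) (int j - int i)) (fourier_coeff b (int j - int i)) < e"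
        by blast
    qed
  qed
  with S show ?thesis by (auto simp: toeplitz_matrix_def)
qed

lemma uniform_limit_C_2pi_mult:
  assumes "uniform_limit {0..2*pi} a b sequentially" "b \<in> C_2pi" "c \<in> C_2pi"
  shows "uniform_limit {0..2*pi} (\<lambda>n t. a n t * c t) (\<lambda>t. b t * c t) sequentially"
  by (intro uniform_lim_mult assms uniform_limit_const compact_imp_bounded compact_continuous_image
      C_2pi_continuous compact_Icc)

text \<open>
  Existence of \<open>T(a)\<close> and compactness of the semicommutators \<open>T(a) T(b) - T(a b)\<close> are proved
  together, since only their conjunction is preserved by products of symbols \<open>a\<close>.
\<close>

definition toeplitz_regular :: "(real \<Rightarrow> complex) \<Rightarrow> bool"
  where "toeplitz_regular a \<longleftrightarrow> a \<in> C_2pi \<and> (\<exists>T. toeplitz_matrix T a \<and>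
    (\<forall>b S. b \<in> C_2pi \<longrightarrow> toeplitz_matrix S b \<longrightarrow>
      (\<exists>R. toeplitz_matrix R (\<lambda>t. a t * b t) \<and> compact_op (T * S - R))))"

lemma toeplitz_regularI:
  assumes "a \<in> C_2pi" "toeplitz_matrix T a"
    "\<And>b S. b \<in> C_2pi \<Longrightarrow> toeplitz_matrix S b \<Longrightarrow>
      \<exists>R. toeplitz_matrix R (\<lambda>t. a t * b t) \<and> compact_op (T * S - R)"
  shows "toeplitz_regular a"
  using assms unfolding toeplitz_regular_def by blast

lemma toeplitz_regularE:
  assumes "toeplitz_regular a"
  obtains T where "a \<in> C_2pi" "toeplitz_matrix T a"
    "\<And>b S. b \<in> C_2pi \<Longrightarrow> toeplitz_matrix S b \<Longrightarrow>
      \<exists>R. toeplitz_matrix R (\<lambda>t. a t * b t) \<and> compact_op (T * S - R)"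
  using assms unfolding toeplitz_regular_def by blast

lemma toeplitz_regular_const: "toeplitz_regular (\<lambda>_. c)"
proof (rule toeplitz_regularI[of _ "scalar_op c"])
  show "toeplitz_matrix (scalar_op c) (\<lambda>_. c)"
    by (auto simp: toeplitz_matrix_def fourier_coeff_const)
  fix b S assume "toeplitz_matrix S b"
  then have "toeplitz_matrix (scalar_op c * S) (\<lambda>t. c * b t)"
    by (simp add: toeplitz_matrix_def fourier_coeff_cmult)
  then show "\<exists>R. toeplitz_matrix R (\<lambda>t. c * b t) \<and> compact_op (scalar_op c * S - R)"
    by (intro exI[of _ "scalar_op c * S"]) simp
qed (rule C_2pi_simps)

text \<open>This symbol belongs to the backward shift U. Shifting the rows of a Toeplitz matrix S
  leaves it Toeplitz, so the semicommutator vanishes.\<close>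

lemma toeplitz_regular_cis: "toeplitz_regular (\<lambda>t. cis t)"
proof -
  obtain U where U: "\<And>x n. ell2_nth (U $$ x) n = ell2_nth x (Suc n)" using ex_backward_shift by blast
  show ?thesis
  proof (rule toeplitz_regularI[of _ U])
    show "toeplitz_matrix U (\<lambda>t. cis t)"
      using fourier_coeff_cis[of "\<lambda>_. 1"] by (auto simp: toeplitz_matrix_def U fourier_coeff_one)
    fix b S assume "toeplitz_matrix S b"
    then have "toeplitz_matrix (U * S) (\<lambda>t. cis t * b t)"
      by (simp add: toeplitz_matrix_def U fourier_coeff_cis algebra_simps)
    then show "\<exists>R. toeplitz_matrix R (\<lambda>t. cis t * b t) \<and> compact_op (U * S - R)"
      by (intro exI[of _ "U * S"]) simp
  qed (rule C_2pi_simps)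
qed

text \<open>This symbol belongs to the forward shift V, for which S V, not V S, is Toeplitz with the
  product symbol. As U S V = S, the defect V S - S V is (V U - 1) S V, and V U - 1 has rank
  one.\<close>

lemma toeplitz_regular_cis_minus: "toeplitz_regular (\<lambda>t. cis (- t))"
proof -
  obtain U where U: "\<And>x n. ell2_nth (U $$ x) n = ell2_nth x (Suc n)" using ex_backward_shift by blast
  obtain V where V: "\<And>x n. ell2_nth (V $$ x) n = (case n of 0 \<Rightarrow> 0 | Suc m \<Rightarrow> ell2_nth x m)"
    using ex_forward_shift by blast
  have V_basis: "V $$ ell2_basis j = ell2_basis (Suc j)" for j
    by (rule ell2_eqI) (auto simp: V split: nat.split)
  have "compact_op (V * U - 1)"
  proof (rule compact_op_rank_one[of _ "\<lambda>x. - ell2_nth x 0" "ell2_basis 0" 1])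
    fix x
    show "(V * U - 1) $$ x = (- ell2_nth x 0) *\<^sub>C ell2_basis 0"
      by (rule ell2_eqI) (auto simp: U V split: nat.split)
    show "cmod (- ell2_nth x 0) \<le> 1" if "norm x \<le> 1"
      using norm_ell2_nth_le[of x 0] that by simp
  qed
  show ?thesis
  proof (rule toeplitz_regularI[of _ V])
    show "toeplitz_matrix V (\<lambda>t. cis (- t))"
      using fourier_coeff_cis_minus[of "\<lambda>_. 1"]
      by (auto simp: toeplitz_matrix_def V_basis fourier_coeff_one)
    fix b S assume S: "toeplitz_matrix S b"
    then have "toeplitz_matrix (S * V) (\<lambda>t. cis (- t) * b t)"
      unfolding toeplitz_matrix_def fourier_coeff_cis_minus by (simp add: V_basis algebra_simps)
    moreover have "U * (S * V) = S"
      by (rule op_eq_basis) (simp add: U V_basis toeplitz_matrixD[OF S])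
    then have "V * S - S * V = (V * U - 1) * (S * V)"
      by (simp add: left_diff_distrib mult.assoc)
    then have "compact_op (V * S - S * V)"
      using compact_op_mult_right[OF \<open>compact_op (V * U - 1)\<close>] by simp
    ultimately show "\<exists>R. toeplitz_matrix R (\<lambda>t. cis (- t) * b t) \<and> compact_op (V * S - R)" by blast
  qed (rule C_2pi_simps)
qed

lemma toeplitz_regular_add:
  assumes "toeplitz_regular f" "toeplitz_regular g"
  shows "toeplitz_regular (\<lambda>t. f t + g t)"
proof -
  obtain T where f: "f \<in> C_2pi" "toeplitz_matrix T f"
    and T: "\<And>b S. b \<in> C_2pi \<Longrightarrow> toeplitz_matrix S b \<Longrightarrow>
      \<exists>R. toeplitz_matrix R (\<lambda>t. f t * b t) \<and> compact_op (T * S - R)"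
    using assms(1) by (rule toeplitz_regularE) blast
  obtain T' where g: "g \<in> C_2pi" "toeplitz_matrix T' g"
    and T': "\<And>b S. b \<in> C_2pi \<Longrightarrow> toeplitz_matrix S b \<Longrightarrow>
      \<exists>R. toeplitz_matrix R (\<lambda>t. g t * b t) \<and> compact_op (T' * S - R)"
    using assms(2) by (rule toeplitz_regularE) blast
  show ?thesis
  proof (rule toeplitz_regularI[of _ "T + T'"])
    fix b S assume b: "b \<in> C_2pi" "toeplitz_matrix S b"
    obtain R where R: "toeplitz_matrix R (\<lambda>t. f t * b t)" "compact_op (T * S - R)" using T[OF b] by blast
    obtain R' where R': "toeplitz_matrix R' (\<lambda>t. g t * b t)" "compact_op (T' * S - R')" using T'[OF b] by blast
    have "toeplitz_matrix (R + R') (\<lambda>t. f t * b t + g t * b t)"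
      by (intro toeplitz_matrix_add R R' C_2pi_simps f g b)
    moreover have "compact_op ((T * S - R) + (T' * S - R'))" by (intro compact_op_add R R')
    ultimately show "\<exists>R. toeplitz_matrix R (\<lambda>t. (f t + g t) * b t) \<and> compact_op ((T + T') * S - R)"
      by (intro exI[of _ "R + R'"]) (simp add: algebra_simps)
  qed (use f g in \<open>auto intro: C_2pi_simps toeplitz_matrix_add\<close>)
qed

text \<open>Regularity of f is applied twice, to g and to the product of g and b; this is why its
  definition quantifies over all b. The defect of W S is then a combination of three known compact
  defects.\<close>

lemma toeplitz_regular_mult:
  assumes "toeplitz_regular f" "toeplitz_regular g"
  shows "toeplitz_regular (\<lambda>t. f t * g t)"
proof -
  obtain T where f: "f \<in> C_2pi" "toeplitz_matrix T f"
    and T: "\<And>b S. b \<in> C_2pi \<Longrightarrow> toeplitz_matrix S b \<Longrightarrow>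
      \<exists>R. toeplitz_matrix R (\<lambda>t. f t * b t) \<and> compact_op (T * S - R)"
    using assms(1) by (rule toeplitz_regularE) blast
  obtain T' where g: "g \<in> C_2pi" "toeplitz_matrix T' g"
    and T': "\<And>b S. b \<in> C_2pi \<Longrightarrow> toeplitz_matrix S b \<Longrightarrow>
      \<exists>R. toeplitz_matrix R (\<lambda>t. g t * b t) \<and> compact_op (T' * S - R)"
    using assms(2) by (rule toeplitz_regularE) blast
  obtain W where W: "toeplitz_matrix W (\<lambda>t. f t * g t)" "compact_op (T * T' - W)" using T[OF g] by blast
  show ?thesis
  proof (rule toeplitz_regularI[OF _ W(1)])
    fix b S assume b: "b \<in> C_2pi" "toeplitz_matrix S b"
    obtain R where R: "toeplitz_matrix R (\<lambda>t. g t * b t)" "compact_op (T' * S - R)" using T'[OF b] by blast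
    obtain Q where Q: "toeplitz_matrix Q (\<lambda>t. f t * (g t * b t))" "compact_op (T * R - Q)"
      using T[OF C_2pi_simps(6)[OF g(1) b(1)] R(1)] by blast
    have "compact_op ((T * R - Q) + T * (T' * S - R) - (T * T' - W) * S)"
      by (intro compact_op_add compact_op_diff compact_op_mult_left compact_op_mult_right W Q R)
    also have "(T * R - Q) + T * (T' * S - R) - (T * T' - W) * S = W * S - Q"
      by (simp add: algebra_simps)
    finally show "\<exists>R. toeplitz_matrix R (\<lambda>t. f t * g t * b t) \<and> compact_op (W * S - R)"
      using Q by (intro exI[of _ Q]) (simp add: mult.assoc)
  qed (intro C_2pi_simps f g)
qed

text \<open>The semicommutators for f n converge in norm to the one for g, and norm limits of
  compact operators are compact.\<close>

lemma toeplitz_regular_limit: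
  assumes f: "\<And>n. toeplitz_regular (f n)" and g: "g \<in> C_2pi"
    and lim: "uniform_limit {0..2*pi} f g sequentially"
  shows "toeplitz_regular g"
proof -
  obtain T where fT: "\<And>n. f n \<in> C_2pi" "\<And>n. toeplitz_matrix (T n) (f n)"
    and T: "\<And>n b S. b \<in> C_2pi \<Longrightarrow> toeplitz_matrix S b \<Longrightarrow>
      \<exists>R. toeplitz_matrix R (\<lambda>t. f n t * b t) \<and> compact_op (T n * S - R)"
    using f unfolding toeplitz_regular_def by metis
  obtain T' where T': "toeplitz_matrix T' g" "T \<longlonglongrightarrow> T'"
    using toeplitz_matrix_limit[OF fT(1) g fT(2) lim] by blast
  show ?thesis
  proof (rule toeplitz_regularI[OF g T'(1)])
    fix b S assume b: "b \<in> C_2pi" "toeplitz_matrix S b"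
    obtain R where R: "\<And>n. toeplitz_matrix (R n) (\<lambda>t. f n t * b t)" "\<And>n. compact_op (T n * S - R n)"
      using T[OF b] by metis
    obtain R' where R': "toeplitz_matrix R' (\<lambda>t. g t * b t)" "R \<longlonglongrightarrow> R'"
      using toeplitz_matrix_limit[OF C_2pi_simps(6)[OF fT(1) b(1)] C_2pi_simps(6)[OF g b(1)] R(1)
          uniform_limit_C_2pi_mult[OF lim g b(1)]] by blast
    have "compact_op (T' * S - R')"
      by (rule compact_op_limit[of "\<lambda>n. T n * S - R n", OF _ R(2)]) (intro tendsto_intros T' R')
    with R' show "\<exists>R. toeplitz_matrix R (\<lambda>t. g t * b t) \<and> compact_op (T' * S - R)" by blast
  qed
qed

lemma toeplitz_regular: "a \<in> C_2pi \<Longrightarrow> toeplitz_regular a"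
  by (induction rule: C_2pi_induct)
    (auto intro: toeplitz_regular_const toeplitz_regular_cis toeplitz_regular_cis_minus
      toeplitz_regular_add toeplitz_regular_mult toeplitz_regular_limit)

lemma toeplitz_matrix_toeplitz:
  assumes "a \<in> C_2pi"
  shows "toeplitz_matrix (toeplitz a) a"
  using toeplitz_regular[OF assms] toeplitz_eqI unfolding toeplitz_regular_def by metis

lemma toeplitz_semicommutator_compact:
  assumes "a \<in> C_2pi" "b \<in> C_2pi"
  shows "compact_op (toeplitz a * toeplitz b - toeplitz (\<lambda>t. a t * b t))"
  using toeplitz_regular[OF assms(1)] toeplitz_eqI toeplitz_matrix_toeplitz[OF assms(2)] assms(2)
  unfolding toeplitz_regular_def by metis

lemma toeplitz_add:
  "a \<in> C_2pi \<Longrightarrow> b \<in> C_2pi \<Longrightarrow> toeplitz (\<lambda>t. a t + b t) = toeplitz a + toeplitz b"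
  by (intro toeplitz_eqI toeplitz_matrix_add toeplitz_matrix_toeplitz)

lemma toeplitz_const: "toeplitz (\<lambda>_. of_real c) = c *\<^sub>R 1"
  by (rule toeplitz_eqI) (auto simp: toeplitz_matrix_def fourier_coeff_const scaleR_conv_of_real[where 'a = complex])

lemma toeplitz_cong:
  "(\<And>t. t \<in> {0..2*pi} \<Longrightarrow> a t = b t) \<Longrightarrow> toeplitz a = toeplitz b"
  unfolding toeplitz_def using fourier_coeff_cong[of a b] by presburger

lemma toeplitz_tendsto:
  assumes "\<And>n. a n \<in> C_2pi" "b \<in> C_2pi" "uniform_limit {0..2*pi} a b sequentially"
  shows "(\<lambda>n. toeplitz (a n)) \<longlonglongrightarrow> toeplitz b"
  using toeplitz_matrix_limit[OF assms(1,2) toeplitz_matrix_toeplitz[OF assms(1)] assms(3)] toeplitz_eqI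
  by metis

lemma fourier_coeff_cnj:
  assumes "a \<in> C_2pi"
  shows "fourier_coeff (\<lambda>t. cnj (a t)) k = cnj (fourier_coeff a (- k))"
proof -
  have "integral {0..2*pi} (cnj \<circ> (\<lambda>t. a t * exp (- \<i> * of_int (- k) * of_real t)))
      = cnj (integral {0..2*pi} (\<lambda>t. a t * exp (- \<i> * of_int (- k) * of_real t)))"
    by (rule integral_linear[OF integrable_fourier[OF assms] bounded_linear_cnj])
  then show ?thesis by (simp add: fourier_coeff_def o_def exp_cnj)
qed

lemma self_adjoint_toeplitz_real:
  assumes "a \<in> C_2pi" "\<And>t. cnj (a t) = a t"
  shows "self_adjoint (toeplitz a)"
  unfolding self_adjoint_iff
proof (rule adjoint_pairI_basis)
  fix i j
  have "fourier_coeff a (int j - int i) = cnj (fourier_coeff a (- (int j - int i)))"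
    using fourier_coeff_cnj[OF assms(1), of "int j - int i"] unfolding assms(2) .
  then show "ell2_nth (toeplitz a $$ ell2_basis j) i = cnj (ell2_nth (toeplitz a $$ ell2_basis i) j)"
    unfolding toeplitz_matrixD[OF toeplitz_matrix_toeplitz[OF assms(1)]] by (simp only: minus_diff_eq)
qed

section \<open>Symbols of quasi-Toeplitz operators\<close>

definition has_symbol :: "ell2_op \<Rightarrow> (real \<Rightarrow> complex) \<Rightarrow> bool"
  where "has_symbol A a \<longleftrightarrow> a \<in> C_2pi \<and> compact_op (A - toeplitz a)"

lemma has_symbol_quasi_toeplitz: "has_symbol A a \<Longrightarrow> A \<in> quasi_toeplitz"
  unfolding has_symbol_def quasi_toeplitz_def
  by (intro CollectI exI[of _ a] exI[of _ "A - toeplitz a"]) simp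

lemma has_symbol_cong:
  assumes "has_symbol A a" "\<And>t. t \<in> {0..2*pi} \<Longrightarrow> a t = b t"
  shows "has_symbol A b"
proof -
  have "continuous_on {0..2*pi} b \<longleftrightarrow> continuous_on {0..2*pi} a"
    by (rule continuous_on_cong) (use assms(2) in auto)
  moreover have "a 0 = b 0" "a (2*pi) = b (2*pi)" using assms(2) by auto
  ultimately show ?thesis
    using assms toeplitz_cong[of a b] by (auto simp: has_symbol_def C_2pi_def)
qed

lemma has_symbol_toeplitz: "a \<in> C_2pi \<Longrightarrow> has_symbol (toeplitz a) a"
  by (simp add: has_symbol_def)

lemma has_symbol_const: "has_symbol (c *\<^sub>R 1) (\<lambda>_. of_real c)"
  by (simp add: has_symbol_def toeplitz_const C_2pi_simps)

lemma has_symbol_add: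
  assumes "has_symbol A a" "has_symbol B b"
  shows "has_symbol (A + B) (\<lambda>t. a t + b t)"
proof -
  have eq: "A + B - toeplitz (\<lambda>t. a t + b t) = (A - toeplitz a) + (B - toeplitz b)"
    using assms by (simp add: has_symbol_def toeplitz_add)
  show ?thesis
    using assms unfolding has_symbol_def eq by (auto intro: C_2pi_simps compact_op_add)
qed

text \<open>Replacing the factors one at a time by their Toeplitz parts costs compact terms and
  leaves the semicommutator of the symbols.\<close>

lemma has_symbol_mult:
  assumes "has_symbol A a" "has_symbol B b"
  shows "has_symbol (A * B) (\<lambda>t. a t * b t)"
proof -
  have eq: "A * B - toeplitz (\<lambda>t. a t * b t) = (A - toeplitz a) * B + toeplitz a * (B - toeplitz b)
      + (toeplitz a * toeplitz b - toeplitz (\<lambda>t. a t * b t))"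
    by (simp add: algebra_simps)
  show ?thesis
    using assms unfolding has_symbol_def eq
    by (intro conjI C_2pi_simps compact_op_add[OF compact_op_add[OF
        compact_op_mult_right compact_op_mult_left] toeplitz_semicommutator_compact]) auto
qed

lemma has_symbol_limit:
  assumes sym: "\<And>n. has_symbol (A n) (a n)" and b: "b \<in> C_2pi"
    and lim: "uniform_limit {0..2*pi} a b sequentially" "A \<longlonglongrightarrow> B"
  shows "has_symbol B b"
proof -
  have "(\<lambda>n. A n - toeplitz (a n)) \<longlonglongrightarrow> B - toeplitz b"
    using sym by (intro tendsto_diff toeplitz_tendsto lim b) (simp add: has_symbol_def)
  then have "compact_op (B - toeplitz b)"
    by (rule compact_op_limit) (use sym in \<open>simp add: has_symbol_def\<close>)
  with b show ?thesis by (simp add: has_symbol_def)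
qed

section \<open>Real symbols under the functional calculus\<close>

abbreviation has_real_symbol :: "ell2_op \<Rightarrow> (real \<Rightarrow> real) \<Rightarrow> bool"
  where "has_real_symbol A \<alpha> \<equiv> has_symbol A (\<lambda>t. of_real (\<alpha> t))"

lemma has_real_symbol_continuous:
  assumes "has_real_symbol A \<alpha>"
  shows "continuous_on {0..2*pi} \<alpha>" "\<alpha> 0 = \<alpha> (2 * pi)"
proof -
  have c: "(\<lambda>t. complex_of_real (\<alpha> t)) \<in> C_2pi" using assms by (simp add: has_symbol_def)
  then have "continuous_on {0..2*pi} (\<lambda>t. Re (complex_of_real (\<alpha> t)))"
    by (intro continuous_on_Re C_2pi_continuous)
  with c show "continuous_on {0..2*pi} \<alpha>" "\<alpha> 0 = \<alpha> (2 * pi)" by (simp_all add: C_2pi_def)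
qed

lemma has_real_symbol_op_poly:
  assumes "has_real_symbol A \<alpha>"
  shows "has_real_symbol (op_poly q A) (\<lambda>t. poly q (\<alpha> t))"
proof (induction q)
  case 0
  show ?case using has_symbol_const[of 0] by simp
next
  case (pCons c q)
  from has_symbol_add[OF has_symbol_const has_symbol_mult[OF assms pCons(2)], of c] show ?case by simp
qed

text \<open>Polynomials act on symbols by has_real_symbol_op_poly. One sequence converging to f on
  [c, d] works on the operator side and, as \<alpha> takes values in [c, d], on the symbol side
  too.\<close>

lemma has_real_symbol_op_fun:
  assumes A: "op_between c d A" and sym: "has_real_symbol A \<alpha>"
    and range: "\<And>t. t \<in> {0..2*pi} \<Longrightarrow> \<alpha> t \<in> {c..d}" and f: "continuous_on {c..d} f"
  shows "has_real_symbol (op_fun f A) (\<lambda>t. f (\<alpha> t))"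
proof -
  obtain q where q: "uniform_limit {c..d} (\<lambda>n x. poly (q n) x) f sequentially"
    using uniform_polynomial_approximation[OF f] .
  have "uniform_limit {0..2*pi} (\<lambda>n t. complex_of_real (poly (q n) (\<alpha> t))) (\<lambda>t. of_real (f (\<alpha> t))) sequentially"
  proof (rule uniform_limitI)
    fix e :: real assume "e > 0"
    from uniform_limitD[OF q this]
    show "\<forall>\<^sub>F n in sequentially. \<forall>t\<in>{0..2*pi}.
        dist (complex_of_real (poly (q n) (\<alpha> t))) (of_real (f (\<alpha> t))) < e"
    proof eventually_elim
      case (elim n)
      then show ?case using range by (simp add: dist_of_real)
    qed
  qed
  moreover have "continuous_on {0..2*pi} (\<lambda>t. f (\<alpha> t))"
    by (rule continuous_on_compose2[OF f has_real_symbol_continuous(1)[OF sym]]) (use range in auto)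
  then have "(\<lambda>t. complex_of_real (f (\<alpha> t))) \<in> C_2pi"
    using has_real_symbol_continuous(2)[OF sym] by (auto simp: C_2pi_def intro!: continuous_intros)
  ultimately show ?thesis
    using has_symbol_limit[OF has_real_symbol_op_poly[OF sym] _ _ op_fun_LIMSEQ[OF A q]] by blast
qed

text \<open>The Toeplitz part has a constant diagonal, and the compact part fades along it.\<close>

lemma has_symbol_diagonal_tendsto:
  assumes "has_symbol A a"
  shows "(\<lambda>m. ell2_nth (A $$ ell2_basis m) m) \<longlonglongrightarrow> fourier_coeff a 0"
proof -
  have a: "a \<in> C_2pi" and K: "compact_op (A - toeplitz a)" using assms by (simp_all add: has_symbol_def)
  have "ell2_nth ((A - toeplitz a) $$ ell2_basis m) m
      = ell2_nth (A $$ ell2_basis m) m - fourier_coeff a 0" for m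
    by (simp add: toeplitz_matrixD[OF toeplitz_matrix_toeplitz[OF a]])
  then show ?thesis
    using compact_op_diagonal_tendsto_0[OF K] by (simp add: LIM_zero_iff)
qed

text \<open>
  Compressing \<open>D \<ge> 0\<close> to \<open>T(\<surd>h) D T(\<surd>h) \<ge> 0\<close>, whose symbol is \<open>h b\<close>, and following its
  diagonal entries shows that \<open>h b\<close> has nonnegative mean.
\<close>

lemma has_symbol_positive_integral:
  fixes h :: "real \<Rightarrow> real"
  assumes D: "self_adjoint D" "\<And>x. 0 \<le> inner x (D $$ x)" and sym: "has_symbol D b"
    and h: "continuous_on {0..2*pi} h" "h 0 = h (2*pi)" "\<And>t. 0 \<le> h t"
  shows "0 \<le> integral {0..2*pi} (\<lambda>t. h t * Re (b t))" "integral {0..2*pi} (\<lambda>t. h t * Im (b t)) = 0"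
proof -
  define c where "c t = complex_of_real (sqrt (h t))" for t
  define C where "C = toeplitz c"
  define E where "E = C * D * C"
  have c: "c \<in> C_2pi" unfolding C_2pi_def c_def using h by (auto intro!: continuous_intros)
  have C: "self_adjoint C" unfolding C_def by (rule self_adjoint_toeplitz_real[OF c]) (simp add: c_def)
  have E: "self_adjoint E" unfolding E_def by (intro self_adjoint_congruence C D)
  have "has_symbol E (\<lambda>t. c t * b t * c t)"
    unfolding E_def C_def by (intro has_symbol_mult has_symbol_toeplitz c sym)
  moreover have "c t * b t * c t = of_real (h t) * b t" for t
  proof -
    have "c t * c t = of_real (h t)" using h(3)[of t] by (simp add: c_def flip: of_real_mult)
    then show ?thesis by (simp add: mult_ac)
  qed
  ultimately have symE: "has_symbol E (\<lambda>t. of_real (h t) * b t)" by simp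
  let ?z = "\<lambda>m. ell2_nth (E $$ ell2_basis m) m"
  have z: "?z m = cinner (ell2_basis m) (E $$ ell2_basis m)" for m by (simp add: cinner_basis_left)
  have "0 \<le> inner v (E $$ v)" for v
    unfolding E_def using D(2)[of "C $$ v"] by (simp only: op_apply_simps self_adjointD[OF C])
  then have Re: "0 \<le> Re (?z m)" for m
    by (simp only: z Re_cinner)
  have Im: "Im (?z m) = 0" for m
  proof -
    have "cinner (ell2_basis m) (E $$ ell2_basis m) = cnj (cinner (ell2_basis m) (E $$ ell2_basis m))"
      using E unfolding self_adjoint_def by (metis cinner_commute)
    then show ?thesis unfolding z by (metis complex_cnj_cancel_iff Reals_cnj_iff complex_is_Real_iff)
  qed
  have lim: "?z \<longlonglongrightarrow> fourier_coeff (\<lambda>t. of_real (h t) * b t) 0"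
    by (rule has_symbol_diagonal_tendsto[OF symE])
  have Re0: "0 \<le> Re (fourier_coeff (\<lambda>t. of_real (h t) * b t) 0)"
    by (rule LIMSEQ_le_const[OF tendsto_Re[OF lim]]) (use Re in auto)
  have Im0: "Im (fourier_coeff (\<lambda>t. of_real (h t) * b t) 0) = 0"
    using LIMSEQ_unique[OF tendsto_Im[OF lim]] by (simp add: Im)
  define f where "f t = of_real (h t) * b t" for t
  have "f \<in> C_2pi" using symE by (simp add: has_symbol_def f_def[abs_def])
  then have int: "f integrable_on {0..2*pi}" by (intro integrable_continuous_interval C_2pi_continuous)
  have "integral {0..2*pi} f = of_real (2 * pi) * fourier_coeff f 0" by (simp add: fourier_coeff_def)
  then have "0 \<le> Re (integral {0..2*pi} f)" "Im (integral {0..2*pi} f) = 0"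
    using Re0 Im0 unfolding f_def[symmetric, abs_def] by simp_all
  then have "0 \<le> integral {0..2*pi} (Re \<circ> f)" "integral {0..2*pi} (Im \<circ> f) = 0"
    using integral_linear[OF int bounded_linear_Re] integral_linear[OF int bounded_linear_Im] by simp_all
  then show "0 \<le> integral {0..2*pi} (\<lambda>t. h t * Re (b t))" "integral {0..2*pi} (\<lambda>t. h t * Im (b t)) = 0"
    by (simp_all add: o_def f_def)
qed

text \<open>The weight h is the positive part of u, for u = - Re b, Im b and - Im b in turn. Then h
  u is a continuous nonnegative function with nonpositive integral, so it vanishes and u \<le>
  0.\<close>

lemma has_symbol_nonneg:
  assumes D: "self_adjoint D" "\<And>x. 0 \<le> inner x (D $$ x)" and sym: "has_symbol D b"
    and t: "t \<in> {0..2*pi}"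
  shows "0 \<le> Re (b t)" "Im (b t) = 0"
proof -
  have b: "continuous_on {0..2*pi} b" "b 0 = b (2*pi)" using sym by (simp_all add: has_symbol_def C_2pi_def)
  have zero: "u t \<le> 0"
    if u: "continuous_on {0..2*pi} u" "integral {0..2*pi} (\<lambda>t. max 0 (u t) * u t) \<le> 0" for u :: "real \<Rightarrow> real"
  proof -
    let ?h = "\<lambda>t. max 0 (u t) * u t"
    have cont: "continuous_on {0..2*pi} ?h" by (intro continuous_intros u)
    have nonneg: "0 \<le> ?h t" for t by (auto simp: max_def)
    have "0 \<le> integral {0..2*pi} ?h"
      by (intro integral_nonneg integrable_continuous_interval cont nonneg)
    with u(2) have "integral {0..2*pi} ?h = 0" by simp
    then have "?h t = 0" using integral_eq_0_iff[OF cont] nonneg t by simp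
    then show ?thesis by (auto simp: max_def split: if_splits)
  qed
  have contp: "continuous_on {0..2*pi} (\<lambda>t. max 0 (u t))" if "continuous_on {0..2*pi} u" for u :: "real \<Rightarrow> real"
    by (intro continuous_intros that)
  have cRe: "continuous_on {0..2*pi} (\<lambda>t. - Re (b t))" and cIm: "continuous_on {0..2*pi} (\<lambda>t. Im (b t))"
    and cIm': "continuous_on {0..2*pi} (\<lambda>t. - Im (b t))"
    by (intro continuous_intros b)+
  have "integral {0..2*pi} (\<lambda>t. max 0 (- Re (b t)) * (- Re (b t))) \<le> 0"
    using has_symbol_positive_integral(1)[OF D sym contp[OF cRe]] b(2) by simp
  from zero[OF cRe this] show "0 \<le> Re (b t)" by simp
  have "integral {0..2*pi} (\<lambda>t. max 0 (Im (b t)) * Im (b t)) \<le> 0"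
    using has_symbol_positive_integral(2)[OF D sym contp[OF cIm]] b(2) by simp
  from zero[OF cIm this] have 1: "Im (b t) \<le> 0" .
  have "integral {0..2*pi} (\<lambda>t. max 0 (- Im (b t)) * (- Im (b t))) \<le> 0"
    using has_symbol_positive_integral(2)[OF D sym contp[OF cIm']] b(2) by simp
  from zero[OF cIm' this] 1 show "Im (b t) = 0" by simp
qed

text \<open>Positivity is applied to A - c and to d - A.\<close>

lemma has_symbol_between:
  assumes A: "op_between c d A" and sym: "has_symbol A a" and t: "t \<in> {0..2*pi}"
  shows "Re (a t) \<in> {c..d}" "Im (a t) = 0"
proof -
  have sa: "self_adjoint A" and bd: "c * (norm x)\<^sup>2 \<le> inner x (A $$ x)" "inner x (A $$ x) \<le> d * (norm x)\<^sup>2" for x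
    using A by (simp_all add: op_between_def)
  have 1: "has_symbol (A + (- c) *\<^sub>R 1) (\<lambda>t. a t + of_real (- c))"
    by (intro has_symbol_add sym has_symbol_const)
  have "self_adjoint (A + (- c) *\<^sub>R 1)" by (intro self_adjoint_add self_adjoint_scaleR sa self_adjoint_one)
  from has_symbol_nonneg[OF this _ 1 t] have l: "c \<le> Re (a t)" "Im (a t) = 0"
    using bd by (simp_all add: inner_diff_right power2_norm_eq_inner)
  have "has_symbol (d *\<^sub>R 1 + ((- 1) *\<^sub>R 1) * A) (\<lambda>t. of_real d + of_real (- 1) * a t)"
    by (intro has_symbol_add has_symbol_mult sym has_symbol_const)
  then have 2: "has_symbol (d *\<^sub>R 1 - A) (\<lambda>t. of_real d - a t)" by simp
  have "self_adjoint (d *\<^sub>R 1 - A)" by (intro self_adjoint_diff self_adjoint_scaleR sa self_adjoint_one)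
  from has_symbol_nonneg[OF this _ 2 t] have "Re (a t) \<le> d"
    using bd by (simp_all add: inner_diff_right power2_norm_eq_inner)
  with l show "Re (a t) \<in> {c..d}" "Im (a t) = 0" by simp_all
qed

lemma has_real_symbol_pos:
  assumes "positive_definite A" "has_real_symbol A \<alpha>" "t \<in> {0..2*pi}"
  shows "0 < \<alpha> t"
proof -
  obtain c d where "0 < c" "op_between c d A" using assms(1) positive_definite_between by metis
  then show ?thesis using has_symbol_between(1)[OF _ assms(2,3)] by force
qed

text \<open>Replaces the given complex symbol by its real part, so that symbols are computed with
  real powers.\<close>

lemma positive_definite_has_real_symbol:
  assumes "positive_definite A" "has_symbol A a"
  shows "t \<in> {0..2*pi} \<Longrightarrow> a t = of_real (Re (a t))" "has_real_symbol A (\<lambda>t. Re (a t))"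
proof -
  obtain c d where "op_between c d A" using assms(1) positive_definite_between by metis
  then show eq: "a t = of_real (Re (a t))" if "t \<in> {0..2*pi}" for t
    using has_symbol_between(2)[OF _ assms(2) that] by (simp add: complex_eq_iff)
  then show "has_real_symbol A (\<lambda>t. Re (a t))"
    by (intro has_symbol_cong[OF assms(2)])
qed

section \<open>Symbols of powers and of means\<close>

lemma has_real_symbol_op_powr:
  assumes "positive_definite A" "has_real_symbol A \<alpha>"
  shows "has_real_symbol (op_powr A r) (\<lambda>t. \<alpha> t powr r)"
proof -
  obtain c d where cd: "0 < c" "c \<le> d" "op_between c d A" using positive_definite_between[OF assms(1)] .
  show ?thesis
    unfolding op_powr_def
    by (rule has_real_symbol_op_fun[OF cd(3) assms(2) _ continuous_on_powr_pos[OF cd(1)]])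
      (use has_symbol_between(1)[OF cd(3) assms(2)] in simp)
qed

lemma has_real_symbol_mult:
  assumes "has_real_symbol A \<alpha>" "has_real_symbol B \<beta>"
  shows "has_real_symbol (A * B) (\<lambda>t. \<alpha> t * \<beta> t)"
  using has_symbol_mult[OF assms] by simp

text \<open>Symbols are scalar functions and commute, so the sandwich defining the mean
  collapses.\<close>

lemma has_real_symbol_geo_mean:
  assumes A: "positive_definite A" "has_real_symbol A \<alpha>" and B: "positive_definite B" "has_real_symbol B \<beta>"
  shows "has_real_symbol (geo_mean A s B) (\<lambda>t. \<alpha> t powr (1 - s) * \<beta> t powr s)"
proof -
  have "has_real_symbol (geo_mean A s B) (\<lambda>t. \<alpha> t powr (1/2) *
      (\<alpha> t powr (-1/2) * \<beta> t * \<alpha> t powr (-1/2)) powr s * \<alpha> t powr (1/2))"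
    unfolding geo_mean_def
    by (intro has_real_symbol_mult has_real_symbol_op_powr positive_definite_congruence
        positive_definite_op_powr A B)
  then show ?thesis
  proof (rule has_symbol_cong)
    fix t assume "t \<in> {0..2*pi}"
    then have pos: "0 < \<alpha> t" "0 < \<beta> t" using has_real_symbol_pos A B by blast+
    have half: "\<alpha> t powr (1/2) * \<alpha> t powr (1/2) = \<alpha> t" "\<alpha> t powr (-1/2) * \<alpha> t powr (-1/2) = \<alpha> t powr (-1)"
      using pos by (simp_all flip: powr_add)
    have "\<alpha> t powr (-1/2) * \<beta> t * \<alpha> t powr (-1/2) = \<alpha> t powr (-1) * \<beta> t"
      using half(2) by (simp only: mult_ac)
    then have "\<alpha> t powr (1/2) * (\<alpha> t powr (-1/2) * \<beta> t * \<alpha> t powr (-1/2)) powr s * \<alpha> t powr (1/2)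
        = (\<alpha> t powr (1/2) * \<alpha> t powr (1/2)) * (\<alpha> t powr (- s) * \<beta> t powr s)"
      using pos by (simp add: powr_mult powr_powr powr_divide powr_minus_divide)
    also have "\<dots> = \<alpha> t powr (1 + - s) * \<beta> t powr s"
      using pos unfolding half powr_add by simp
    finally show "complex_of_real (\<alpha> t powr (1/2) *
        (\<alpha> t powr (-1/2) * \<beta> t * \<alpha> t powr (-1/2)) powr s * \<alpha> t powr (1/2))
      = of_real (\<alpha> t powr (1 - s) * \<beta> t powr s)" by simp
  qed
qed

text \<open>Companion of \<open>good_mean\<close> in the induction on p, for symbols.\<close>

definition mean_symbol :: "nat \<Rightarrow> ((nat \<Rightarrow> real) \<Rightarrow> (nat \<Rightarrow> ell2_op) \<Rightarrow> ell2_op) \<Rightarrow> bool"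
  where "mean_symbol p M \<longleftrightarrow> (\<forall>w A \<alpha>. prob_weights p w \<longrightarrow> positive_tuple p A \<longrightarrow>
    (\<forall>i\<in>{1..p}. has_real_symbol (A i) (\<alpha> i)) \<longrightarrow>
    has_real_symbol (M w A) (\<lambda>t. \<Prod>i\<in>{1..p}. \<alpha> i t powr w i))"

context mean_iteration
begin

text \<open>The exponent of \<alpha> i is 1 - (1 - w i) = w i, and that of another \<alpha> j is (w
  j / (1 - w i)) (1 - w i) = w j.\<close>

lemma has_real_symbol_mean_step:
  assumes M: "mean_symbol p M" and A: "positive_tuple (Suc p) A"
    and sym: "\<And>i. i \<in> {1..Suc p} \<Longrightarrow> has_real_symbol (A i) (\<alpha> i)" and i: "i \<in> {1..Suc p}"
  shows "has_real_symbol (mean_step M w A i) (\<lambda>t. \<Prod>j\<in>{1..Suc p}. \<alpha> j t powr w j)"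
proof -
  let ?w = "\<lambda>j. omit i w j / (1 - w i)"
  have Ai: "positive_definite (A i)" using A i by (simp add: positive_tuple_def)
  have "\<forall>j\<in>{1..p}. has_real_symbol (omit i A j) (omit i \<alpha> j)"
    using sym skip_in[OF i] by (simp add: omit_eq)
  then have "has_real_symbol (M ?w (omit i A)) (\<lambda>t. \<Prod>j\<in>{1..p}. omit i \<alpha> j t powr ?w j)"
    using M prob_weights_omit[OF w p i] positive_tuple_omit[OF A i] unfolding mean_symbol_def by blast
  from has_real_symbol_geo_mean[OF Ai sym[OF i] positive_mean_omit[OF A i] this, of "1 - w i"]
  show ?thesis unfolding mean_step_def
  proof (rule has_symbol_cong)
    fix t assume "t \<in> {0..2*pi}"
    then have pos: "0 < \<alpha> j t" if "j \<in> {1..Suc p}" for j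
      using has_real_symbol_pos[OF _ sym[OF that]] A that by (simp add: positive_tuple_def)
    have "(\<Prod>j\<in>{1..p}. omit i \<alpha> j t powr ?w j) powr (1 - w i)
        = (\<Prod>j\<in>{1..p}. (omit i \<alpha> j t powr ?w j) powr (1 - w i))"
      by (rule prod_powr_distrib)
    also have "\<dots> = (\<Prod>j\<in>{1..p}. \<alpha> (skip i j) t powr w (skip i j))"
      using w_less_1[OF i] by (simp add: omit_eq powr_powr)
    finally have "\<alpha> i t powr (1 - (1 - w i)) * (\<Prod>j\<in>{1..p}. omit i \<alpha> j t powr ?w j) powr (1 - w i)
        = \<alpha> i t powr w i * (\<Prod>j\<in>{1..p}. \<alpha> (skip i j) t powr w (skip i j))" by simp
    also have "\<dots> = (\<Prod>j\<in>{1..Suc p}. \<alpha> j t powr w j)"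
      by (rule prod_omit[OF i, of "\<lambda>j. \<alpha> j t powr w j"])
    finally show "complex_of_real (\<alpha> i t powr (1 - (1 - w i)) *
          (\<Prod>j\<in>{1..p}. omit i \<alpha> j t powr ?w j) powr (1 - w i))
        = of_real (\<Prod>j\<in>{1..Suc p}. \<alpha> j t powr w j)" by (simp only:)
  qed
qed

text \<open>After one step all components share the symbol g, and a further step reproduces it
  because the powers g^(w j) multiply to g. The index starts at 1 since the initial symbols may
  differ.\<close>

lemma has_real_symbol_mean_iter:
  assumes M: "mean_symbol p M" and A: "positive_tuple (Suc p) A"
    and sym: "\<And>i. i \<in> {1..Suc p} \<Longrightarrow> has_real_symbol (A i) (\<alpha> i)" and i: "i \<in> {1..Suc p}"
  shows "has_real_symbol (mean_iter M w A (Suc k) i) (\<lambda>t. \<Prod>j\<in>{1..Suc p}. \<alpha> j t powr w j)"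
  using i
proof (induction k arbitrary: i)
  case 0
  then show ?case
    unfolding mean_iter_Suc mean_iter.simps(1) by (intro has_real_symbol_mean_step M A sym)
next
  case (Suc k)
  define g where "g t = (\<Prod>j\<in>{1..Suc p}. \<alpha> j t powr w j)" for t
  have IH: "has_real_symbol (mean_iter M w A (Suc k) j) g" if "j \<in> {1..Suc p}" for j
    unfolding g_def using that by (rule Suc.IH)
  have "has_real_symbol (mean_iter M w A (Suc (Suc k)) i) (\<lambda>t. \<Prod>j\<in>{1..Suc p}. g t powr w j)"
    unfolding mean_iter_Suc[of _ _ _ "Suc k"]
    by (intro has_real_symbol_mean_step M positive_mean_iter A IH Suc.prems)
  then have "has_real_symbol (mean_iter M w A (Suc (Suc k)) i) g"
  proof (rule has_symbol_cong)
    fix t assume t: "t \<in> {0..2*pi}"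
    have "positive_definite (mean_iter M w A (Suc k) i)"
      using positive_mean_iter[OF A, of "Suc k"] Suc.prems unfolding positive_tuple_def by blast
    then have "0 < g t" using has_real_symbol_pos IH[OF Suc.prems] t by blast
    then have "g t powr (\<Sum>j\<in>{1..Suc p}. w j) = (\<Prod>j\<in>{1..Suc p}. g t powr w j)"
      by (intro powr_sum) auto
    then show "complex_of_real (\<Prod>j\<in>{1..Suc p}. g t powr w j) = of_real (g t)"
      using \<open>0 < g t\<close> unfolding sum_w by simp
  qed
  then show ?case by (simp only: g_def)
qed

lemma has_real_symbol_limit_mean:
  assumes M: "mean_symbol p M" and A: "positive_tuple (Suc p) A"
    and sym: "\<And>i. i \<in> {1..Suc p} \<Longrightarrow> has_real_symbol (A i) (\<alpha> i)"
  shows "has_real_symbol (limit_mean A) (\<lambda>t. \<Prod>j\<in>{1..Suc p}. \<alpha> j t powr w j)"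
proof -
  have sym1: "has_real_symbol (mean_iter M w A (Suc k) 1) (\<lambda>t. \<Prod>j\<in>{1..Suc p}. \<alpha> j t powr w j)" for k
    by (rule has_real_symbol_mean_iter[OF M A sym]) auto
  have "(\<lambda>k. mean_iter M w A (Suc k) 1) \<longlonglongrightarrow> limit_mean A"
    by (intro LIMSEQ_Suc limit_mean(2) A) auto
  moreover have "(\<lambda>t. complex_of_real (\<Prod>j\<in>{1..Suc p}. \<alpha> j t powr w j)) \<in> C_2pi"
    using sym1[of 0] unfolding has_symbol_def by blast
  ultimately show ?thesis
    by (intro has_symbol_limit[OF sym1 _ uniform_limit_const])
qed

end

lemma mean_symbol_2: "mean_symbol 2 (weighted_mean 2)"
proof -
  have 12: "{1..2} = {1, 2::nat}" by auto
  have wm: "weighted_mean 2 w A = geo_mean (A 1) (w 2) (A 2)" for w A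
    by (simp add: eval_nat_numeral)
  have w: "prob_weights 2 w \<Longrightarrow> w 1 = 1 - w 2" for w
    unfolding prob_weights_def 12 by simp
  show ?thesis
    unfolding mean_symbol_def wm positive_tuple_def
  proof (intro allI impI)
    fix w and A :: "nat \<Rightarrow> ell2_op" and \<alpha> :: "nat \<Rightarrow> real \<Rightarrow> real"
    assume "prob_weights 2 w" "\<forall>i\<in>{1..2}. positive_definite (A i)"
      "\<forall>i\<in>{1..2}. has_real_symbol (A i) (\<alpha> i)"
    then have "has_real_symbol (geo_mean (A 1) (w 2) (A 2)) (\<lambda>t. \<alpha> 1 t powr w 1 * \<alpha> 2 t powr w 2)"
      unfolding w[OF \<open>prob_weights 2 w\<close>] 12 by (intro has_real_symbol_geo_mean) auto
    then show "has_real_symbol (geo_mean (A 1) (w 2) (A 2)) (\<lambda>t. \<Prod>i\<in>{1..2}. \<alpha> i t powr w i)"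
      unfolding 12 by simp
  qed
qed

lemma mean_iteration_weighted_mean:
  assumes "2 \<le> p" "prob_weights (Suc p) w"
  shows "mean_iteration p (weighted_mean p) w"
    and "weighted_mean (Suc p) w A = mean_iteration.limit_mean p (weighted_mean p) w A"
proof -
  show mi: "mean_iteration p (weighted_mean p) w"
    using assms good_mean_weighted_mean by unfold_locales auto
  show "weighted_mean (Suc p) w A = mean_iteration.limit_mean p (weighted_mean p) w A"
    using assms by (simp only: weighted_mean_Suc mean_iteration.limit_mean_def[OF mi])
qed

lemma mean_symbol_weighted_mean: "2 \<le> p \<Longrightarrow> mean_symbol p (weighted_mean p)"
proof (induction p rule: dec_induct)
  case base
  show ?case by (rule mean_symbol_2)
next
  case (step p)
  show ?case
    unfolding mean_symbol_def
  proof (intro allI impI)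
    fix w A \<alpha>
    assume w: "prob_weights (Suc p) w" and A: "positive_tuple (Suc p) A"
      and sym: "\<forall>i\<in>{1..Suc p}. has_real_symbol (A i) (\<alpha> i)"
    have p: "2 \<le> p" using step by simp
    from mean_iteration.has_real_symbol_limit_mean[OF mean_iteration_weighted_mean(1)[OF p w] step.IH A] sym
    show "has_real_symbol (weighted_mean (Suc p) w A) (\<lambda>t. \<Prod>i\<in>{1..Suc p}. \<alpha> i t powr w i)"
      unfolding mean_iteration_weighted_mean(2)[OF p w] by blast
  qed
qed

theorem theorem20:
  fixes p :: nat and w :: "nat \<Rightarrow> real"
    and a :: "nat \<Rightarrow> real \<Rightarrow> complex" and A E :: "nat \<Rightarrow> ell2_op"
    and g :: "real \<Rightarrow> complex" and G :: ell2_op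
  assumes "p \<ge> 3"
    and "\<And>i. i \<in> {1..p} \<Longrightarrow> a i \<in> C_2pi"
    and "\<And>i. i \<in> {1..p} \<Longrightarrow> compact_op (E i)"
    and "\<And>i. i \<in> {1..p} \<Longrightarrow> A i = toeplitz (a i) + E i"
    and "\<And>i. i \<in> {1..p} \<Longrightarrow> positive_definite (A i)"
    and "\<And>i. i \<in> {1..p} \<Longrightarrow> w i > 0"
    and "(\<Sum>i\<in>{1..p}. w i) = 1"
    and "g = (\<lambda>t. \<Prod>i\<in>{1..p}. a i t powr complex_of_real (w i))"
    and "G = weighted_mean p w A"
  shows "g \<in> C_2pi \<and>
    (\<exists>K K\<^sub>G.
      (\<forall>k\<ge>1. \<forall>i\<in>{1..p}. mean_seq p w A k i \<in> quasi_toeplitz \<and>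
         compact_op (K i k) \<and> mean_seq p w A k i = toeplitz g + K i k) \<and>
      (G \<in> quasi_toeplitz \<and> compact_op K\<^sub>G \<and> G = toeplitz g + K\<^sub>G) \<and>
      (\<forall>i\<in>{1..p}. (\<lambda>k. norm (K i k - K\<^sub>G)) \<longlonglongrightarrow> 0))"
proof -
  obtain q where p_eq: "p = Suc q" and q: "2 \<le> q" using \<open>p \<ge> 3\<close> by (cases p) auto
  have w: "prob_weights (Suc q) w" using assms(6,7) by (simp add: prob_weights_def p_eq)
  interpret mean_iteration q "weighted_mean q" w by (rule mean_iteration_weighted_mean(1)[OF q w])
  have A: "positive_tuple (Suc q) A" unfolding positive_tuple_def using assms(5) by (intro ballI) (simp only: p_eq)
  have sym: "has_symbol (A i) (a i)" if "i \<in> {1..p}" for i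
    using assms(2-4)[OF that] by (simp add: has_symbol_def)
  have real: "has_real_symbol (A i) (\<lambda>t. Re (a i t))" if "i \<in> {1..Suc q}" for i
    using positive_definite_has_real_symbol(2)[OF assms(5) sym] that by (simp add: p_eq)
  \<comment> \<open>\<open>g\<close> is written with complex powers; on [0, 2 pi] its factors are
    positive reals, where complex and real powers agree.\<close>
  have g: "of_real (\<Prod>i\<in>{1..Suc q}. Re (a i t) powr w i) = g t" if t: "t \<in> {0..2*pi}" for t
    unfolding assms(8) p_eq of_real_prod
  proof (rule prod.cong[OF refl])
    fix i assume i: "i \<in> {1..Suc q}"
    have "a i t = of_real (Re (a i t))"
      using positive_definite_has_real_symbol(1)[OF assms(5) sym t] i by (simp add: p_eq)
    moreover have "0 < Re (a i t)"
      using has_real_symbol_pos[OF assms(5) real t] i by (simp add: p_eq)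
    ultimately show "of_real (Re (a i t) powr w i) = a i t powr of_real (w i)"
      by (metis less_imp_le powr_of_real)
  qed
  have ms: "mean_symbol q (weighted_mean q)" by (rule mean_symbol_weighted_mean[OF q])
  have symk: "has_symbol (mean_seq p w A k i) g" if "k \<ge> 1" "i \<in> {1..p}" for k i
  proof -
    \<comment> \<open>k \<ge> 1 is written as Suc (k - 1), the form in which the iterates have the
      common symbol.\<close>
    have "has_real_symbol (mean_iter (weighted_mean q) w A (Suc (k - 1)) i)
        (\<lambda>t. \<Prod>i\<in>{1..Suc q}. Re (a i t) powr w i)"
      using that by (intro has_real_symbol_mean_iter ms A real) (simp_all add: p_eq)
    from has_symbol_cong[OF this g] show ?thesis using that by (simp add: mean_seq_def p_eq del: mean_iter.simps)
  qed
  have G: "G = limit_mean A" using assms(9) mean_iteration_weighted_mean(2)[OF q w] by (simp add: p_eq)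
  have symG: "has_symbol G g"
    unfolding G by (rule has_symbol_cong[OF has_real_symbol_limit_mean[OF ms A real] g])
  \<comment> \<open>Both remainders subtract the same \<open>toeplitz g\<close>, which cancels in
    their difference; the last claim is then norm convergence of the iterates to G.\<close>
  define K where "K i k = mean_seq p w A k i - toeplitz g" for i k
  define KG where "KG = G - toeplitz g"
  have "(\<lambda>k. norm (K i k - KG)) \<longlonglongrightarrow> 0" if "i \<in> {1..p}" for i
  proof -
    have "(\<lambda>k. mean_seq p w A k i) \<longlonglongrightarrow> G"
      using limit_mean(2)[OF A, of i] that by (simp add: G mean_seq_def p_eq)
    then show ?thesis by (simp add: K_def KG_def tendsto_norm_zero_iff LIM_zero_iff)
  qed
  then show ?thesis
    using symk symG has_symbol_quasi_toeplitz[OF symk] has_symbol_quasi_toeplitz[OF symG]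
    by (intro conjI exI[of _ K] exI[of _ KG] allI impI ballI)
      (auto simp: K_def KG_def has_symbol_def)
qed

end
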